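(* Up to isomorphism, there is a unique $A_\infty$ deformation of $\mathcal{A}$ over $\mathbb{F}_2[U]$ satisfying the following conditions: (1) the deformation is $\Gamma=G\times\mathbb{Z}$-graded, where the grading of the chords $\rho_i$ is $\gamma(\rho_i)=\mathrm{gr}(\rho_i)\times \mathrm{wn}(\rho_i)$; (2) the operations satisfy $\mu_4(\rho_4,\rho_3,\rho_2,\rho_1)=U\iota_1$ and $\mu_4(\rho_3,\rho_2,\rho_1,\rho_4)=U\iota_0$.
   Context: **Associative algebra.** $\mathcal{A}$ is the path algebra over $\mathbb{F}_2$ of the quiver with vertices $\iota_0,\iota_1$, arrows $\rho_1,\rho_3$ from $\iota_0$ to $\iota_1$ and $\rho_2,\rho_4$ from $\iota_1$ to $\iota_0$, modulo $\rho_2\rho_1=\rho_3\rho_2=\rho_4\rho_3=\rho_1\rho_4=0$ (paths are written left to right: $\iota_0\rho_1\iota_1=\rho_1$ and $\rho_1\rho_2\neq 0$). Put $\mathbf{k}=\mathbb{F}_2\iota_0\oplus\mathbb{F}_2\iota_1$, $1=\iota_0+\iota_1$, $\mathcal{A}[U]=\mathcal{A}\otimes\mathbb{F}_2[U]$. **Deformations.** An $A_\infty$ deformation of $\mathcal{A}$ over $\mathbb{F}_2[U]$ is a strictly unital $A_\infty$-algebra structure on $\mathcal{A}[U]$ with $\mathbf{k}[U]$-multilinear operations $\mu_n$, with $\mu_1=0$ and $\mu_2$ the ($U$-bilinear extension of the) multiplication of $\mathcal{A}$; i.e. for all $n$, $\sum \mu_{r+1+t}(\mathrm{Id}^{\otimes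 r}\otimes\mu_s\otimes\mathrm{Id}^{\otimes t})=0$ (sum over $r+s+t=n$), and $\mu_n$ vanishes for $n\ne2$ if some input is $\iota_0$ or $\iota_1$. Isomorphism means an isomorphism of $A_\infty$-algebras over $\mathbf{k}[U]$ (an $A_\infty$-homomorphism $\{f_n\}_{n\ge1}$ with $f_1$ bijective). **Gradings.** $G=\{(m;a,b)\in(\frac12\mathbb{Z})^3 : a+b\in\mathbb{Z},\ m+\frac{(2a+1)(a+b+1)+1}{2}\in\mathbb{Z}\}$ with product $(m;a,b)(n;c,d)=(m+n+ad-bc;a+c,b+d)$. $\mathrm{gr}(\rho_1)=(-\frac12;\frac12,-\frac12)$, $\mathrm{gr}(\rho_2)=(-\frac12;\frac12,\frac12)$, $\mathrm{gr}(\rho_3)=(-\frac12;-\frac12,\frac12)$, $\mathrm{gr}(\rho_4)=(-\frac32;-\frac12,-\frac12)$; $\mathrm{wn}(\rho_1)=\mathrm{wn}(\rho_2)=\mathrm{wn}(\rho_3)=0$, $\mathrm{wn}(\rho_4)=1$. These extend multiplicatively to a $\Gamma$-grading $\gamma$ of $\mathcal{A}$, with $\iota_0,\iota_1$ in the identity degree. Let $\lambda=(1;0,0)\times 0$, a central element of $\Gamma$. The deformation being $\Gamma$-graded means that $\mathcal{A}[U]$ is $\Gamma$-graded extending the grading of $\mathcal{A}$, with multiplication by $U$ homogeneous of a central degree $\gamma(U)$, and that $\mu_n(a_1,\dots,a_n)$ is homogeneous of degree $\lambda^{n-2}\gamma(a_1)\cdots\gamma(a_n)$ for homogeneous $a_i$.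 (Condition (2) then forces $\gamma(U)=(-2;0,0)\times 1$.) *)

theory Defs
  imports
    HOL.Rat
    "HOL-Library.Z2"
    "HOL-Library.Poly_Mapping"
    "HOL-Algebra.Elementary_Groups"
begin

section \<open>The path algebra of the quiver\<close>

datatype vertex = Vertex0 | Vertex1

datatype arrow = Arrow1 | Arrow2 | Arrow3 | Arrow4

fun source :: "arrow \<Rightarrow> vertex" where
  "source Arrow1 = Vertex0"
| "source Arrow2 = Vertex1"
| "source Arrow3 = Vertex0"
| "source Arrow4 = Vertex1"

fun target :: "arrow \<Rightarrow> vertex" where
  "target Arrow1 = Vertex1"
| "target Arrow2 = Vertex0"
| "target Arrow3 = Vertex1"
| "target Arrow4 = Vertex0"

text \<open>A path is a pair \<open>(v, es)\<close> of an initial vertex and a composable list of arrows, read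
  from left to right; \<open>(v, [])\<close> is the trivial path at \<open>v\<close>.\<close>

fun is_path :: "vertex \<Rightarrow> arrow list \<Rightarrow> bool" where
  "is_path v [] \<longleftrightarrow> True"
| "is_path v (e # es) \<longleftrightarrow> source e = v \<and> is_path (target e) es"

fun path_end :: "vertex \<Rightarrow> arrow list \<Rightarrow> vertex" where
  "path_end v [] = v"
| "path_end v (e # es) = path_end (target e) es"

lemma is_path_append: "is_path v (es @ fs) \<longleftrightarrow> is_path v es \<and> is_path (path_end v es) fs"
  by (induction es arbitrary: v) auto

lemma path_end_append: "path_end v (es @ fs) = path_end (path_end v es) fs"
  by (induction es arbitrary: v) auto

typedef path_algebra =
  "{f :: vertex \<times> arrow list \<Rightarrow> bit. finite {p. f p \<noteq> 0} \<and> (\<forall>v es. f (v, es) \<noteq> 0 \<longrightarrow> is_path v es)}"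
  morphisms coefficient Abs_path_algebra
  by (rule exI[of _ "\<lambda>_. 0"]) auto

setup_lifting type_definition_path_algebra

lift_definition path :: "vertex \<Rightarrow> arrow list \<Rightarrow> path_algebra" is
  "\<lambda>v es p. if is_path v es \<and> p = (v, es) then 1 else 0"
proof -
  fix v es
  have "{p. (if is_path v es \<and> p = (v, es) then 1 else 0 :: bit) \<noteq> 0} \<subseteq> {(v, es)}"
    by auto
  then show "finite {p. (if is_path v es \<and> p = (v, es) then 1 else 0 :: bit) \<noteq> 0} \<and>
      (\<forall>w fs. (if is_path v es \<and> (w, fs) = (v, es) then 1 else 0 :: bit) \<noteq> 0 \<longrightarrow> is_path w fs)"
    using finite_subset by auto
qed

lemma path_algebra_eqI:
  "x = y" if "\<And>v es. coefficient x (v, es) = coefficient y (v, es)"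
  using that by (metis coefficient_inject ext surj_pair)

instantiation path_algebra :: ab_group_add
begin

lift_definition zero_path_algebra :: path_algebra is "\<lambda>_. 0"
  by simp

lift_definition plus_path_algebra :: "path_algebra \<Rightarrow> path_algebra \<Rightarrow> path_algebra" is
  "\<lambda>f g p. f p + g p"
proof -
  fix f g :: "vertex \<times> arrow list \<Rightarrow> bit"
  assume f: "finite {p. f p \<noteq> 0} \<and> (\<forall>v es. f (v, es) \<noteq> 0 \<longrightarrow> is_path v es)"
    and g: "finite {p. g p \<noteq> 0} \<and> (\<forall>v es. g (v, es) \<noteq> 0 \<longrightarrow> is_path v es)"
  have "{p. f p + g p \<noteq> 0} \<subseteq> {p. f p \<noteq> 0} \<union> {p. g p \<noteq> 0}"
    by auto
  then have "finite {p. f p + g p \<noteq> 0}"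
    using f g by (meson finite_UnI finite_subset)
  moreover have "is_path v es" if "f (v, es) + g (v, es) \<noteq> 0" for v es
    using f g that by (metis add.right_neutral)
  ultimately show "finite {p. f p + g p \<noteq> 0} \<and>
      (\<forall>v es. f (v, es) + g (v, es) \<noteq> 0 \<longrightarrow> is_path v es)"
    by blast
qed

lift_definition uminus_path_algebra :: "path_algebra \<Rightarrow> path_algebra" is "\<lambda>f p. - f p"
  by simp

lift_definition minus_path_algebra :: "path_algebra \<Rightarrow> path_algebra \<Rightarrow> path_algebra" is
  "\<lambda>f g p. f p - g p"
proof -
  fix f g :: "vertex \<times> arrow list \<Rightarrow> bit"
  assume f: "finite {p. f p \<noteq> 0} \<and> (\<forall>v es. f (v, es) \<noteq> 0 \<longrightarrow> is_path v es)"
    and g: "finite {p. g p \<noteq> 0} \<and> (\<forall>v es. g (v, es) \<noteq> 0 \<longrightarrow> is_path v es)"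
  have "{p. f p - g p \<noteq> 0} \<subseteq> {p. f p \<noteq> 0} \<union> {p. g p \<noteq> 0}"
    by auto
  then have "finite {p. f p - g p \<noteq> 0}"
    using f g by (meson finite_UnI finite_subset)
  moreover have "is_path v es" if "f (v, es) - g (v, es) \<noteq> 0" for v es
    using f g that by (metis diff_0_right)
  ultimately show "finite {p. f p - g p \<noteq> 0} \<and>
      (\<forall>v es. f (v, es) - g (v, es) \<noteq> 0 \<longrightarrow> is_path v es)"
    by blast
qed

lemma coefficient_zero: "coefficient 0 p = 0"
  by transfer simp

lemma coefficient_add: "coefficient (x + y) p = coefficient x p + coefficient y p"
  by transfer simp

lemma coefficient_uminus: "coefficient (- x) p = - coefficient x p"
  by transfer simp

lemma coefficient_diff: "coefficient (x - y) p = coefficient x p - coefficient y p"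
  by transfer simp

instance
proof
  fix x y z :: path_algebra
  show "x + y + z = x + (y + z)"
    by (rule path_algebra_eqI) (simp only: coefficient_add add.assoc)
  show "x + y = y + x"
    by (rule path_algebra_eqI) (simp only: coefficient_add add.commute)
  show "0 + x = x"
    by (rule path_algebra_eqI) (simp only: coefficient_add coefficient_zero add_0_left)
  show "- x + x = 0"
    by (rule path_algebra_eqI)
      (simp only: coefficient_add coefficient_zero coefficient_uminus left_minus)
  show "x - y = x + - y"
    by (rule path_algebra_eqI)
      (simp only: coefficient_add coefficient_diff coefficient_uminus diff_conv_add_uminus)
qed

end

lemma coefficient_path:
  "coefficient (path v es) p = (if is_path v es \<and> p = (v, es) then 1 else 0)"
  by transfer simp

lemma sum_cut_twice:
  fixes t :: "nat \<Rightarrow> nat \<Rightarrow> 'a::comm_monoid_add"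
  shows "(\<Sum>k\<le>n. \<Sum>j\<le>k. t j k) = (\<Sum>j\<le>n. \<Sum>i\<le>n - j. t j (j + i))"
proof -
  have "(\<Sum>k\<le>n. \<Sum>j\<le>k. t j k) = (\<Sum>(k, j)\<in>(SIGMA k:{..n}. {..k}). t j k)"
    by (rule sum.Sigma) auto
  also have "\<dots> = (\<Sum>(j, i)\<in>(SIGMA j:{..n}. {..n - j}). t j (j + i))"
    by (rule sum.reindex_bij_witness[of _ "\<lambda>(j, i). (j + i, j)" "\<lambda>(k, j). (j, k - j)"]) auto
  also have "\<dots> = (\<Sum>j\<le>n. \<Sum>i\<le>n - j. t j (j + i))"
    by (rule sum.Sigma[symmetric]) auto
  finally show ?thesis .
qed

instantiation path_algebra :: ring_1
begin

text \<open>The bilinear extension of concatenation of paths: the coefficient of a path in a product is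
  the sum over the ways to cut the path into two pieces (see \<open>path_mult\<close> below).\<close>

lift_definition times_path_algebra :: "path_algebra \<Rightarrow> path_algebra \<Rightarrow> path_algebra" is
  "\<lambda>f g (v, es). \<Sum>k\<le>length es. f (v, take k es) * g (path_end v (take k es), drop k es)"
proof -
  fix f g :: "vertex \<times> arrow list \<Rightarrow> bit"
  assume f: "finite {p. f p \<noteq> 0} \<and> (\<forall>v es. f (v, es) \<noteq> 0 \<longrightarrow> is_path v es)"
    and g: "finite {p. g p \<noteq> 0} \<and> (\<forall>v es. g (v, es) \<noteq> 0 \<longrightarrow> is_path v es)"
  let ?h = "\<lambda>(v, es). \<Sum>k\<le>length es. f (v, take k es) * g (path_end v (take k es), drop k es)"
  have split: "\<exists>k. f (v, take k es) \<noteq> 0 \<and> g (path_end v (take k es), drop k es) \<noteq> 0"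
    if "?h (v, es) \<noteq> 0" for v es
  proof (rule ccontr)
    assume "\<nexists>k. f (v, take k es) \<noteq> 0 \<and> g (path_end v (take k es), drop k es) \<noteq> 0"
    then have "f (v, take k es) * g (path_end v (take k es), drop k es) = 0" for k
      by (metis mult_zero_left mult_zero_right)
    then have "?h (v, es) = 0"
      by (simp only: split_conv sum.neutral_const)
    with that show False
      by contradiction
  qed
  have "{p. ?h p \<noteq> 0} \<subseteq> (\<lambda>((v, es), (w, fs)). (v, es @ fs)) ` ({p. f p \<noteq> 0} \<times> {p. g p \<noteq> 0})"
  proof
    fix p assume "p \<in> {p. ?h p \<noteq> 0}"
    moreover obtain v es where p: "p = (v, es)"
      by (cases p)
    ultimately obtain k where
      "f (v, take k es) \<noteq> 0" "g (path_end v (take k es), drop k es) \<noteq> 0"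
      using split by blast
    then show "p \<in> (\<lambda>((v, es), (w, fs)). (v, es @ fs)) ` ({p. f p \<noteq> 0} \<times> {p. g p \<noteq> 0})"
      using p by (intro image_eqI[of _ _ "((v, take k es), (path_end v (take k es), drop k es))"]) auto
  qed
  then have "finite {p. ?h p \<noteq> 0}"
    using f g by (meson finite_SigmaI finite_imageI finite_subset)
  moreover have "is_path v es" if "?h (v, es) \<noteq> 0" for v es
    using split[OF that] f g by (metis append_take_drop_id is_path_append)
  ultimately show "finite {p. ?h p \<noteq> 0} \<and> (\<forall>v es. ?h (v, es) \<noteq> 0 \<longrightarrow> is_path v es)"
    by blast
qed

definition one_path_algebra :: path_algebra where
  "1 = path Vertex0 [] + path Vertex1 []"

lemma coefficient_times:
  "coefficient (x * y) (v, es) =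
    (\<Sum>k\<le>length es. coefficient x (v, take k es) * coefficient y (path_end v (take k es), drop k es))"
  by transfer simp

lemma coefficient_one: "coefficient 1 (v, es) = (if es = [] then 1 else 0)"
  by (cases v) (auto simp: one_path_algebra_def coefficient_add coefficient_path)

instance
proof
  fix x y z :: path_algebra
  show "x * y * z = x * (y * z)"
  proof (rule path_algebra_eqI)
    fix v :: vertex and es :: "arrow list"
    let ?n = "length es"
    let ?t = "\<lambda>(j::nat) (k::nat). coefficient x (v, take j es) *
      (coefficient y (path_end v (take j es), take (k - j) (drop j es)) *
       coefficient z (path_end v (take k es), drop k es))"
    have "coefficient (x * y * z) (v, es) = (\<Sum>k\<le>?n. \<Sum>j\<le>k. ?t j k)"
      unfolding coefficient_times sum_distrib_right
    proof (rule sum.cong[OF refl], rule sum.cong)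
      fix k :: nat assume "k \<in> {..?n}"
      then show "{..length (take k es)} = {..k}"
        by (simp only: length_take atMost_iff min_absorb2)
    next
      fix k j :: nat assume "j \<in> {..k}"
      then show "coefficient x (v, take j (take k es)) *
          coefficient y (path_end v (take j (take k es)), drop j (take k es)) *
          coefficient z (path_end v (take k es), drop k es) = ?t j k"
        by (simp only: take_take atMost_iff min_absorb1 drop_take mult.assoc)
    qed
    also have "\<dots> = (\<Sum>j\<le>?n. \<Sum>i\<le>?n - j. ?t j (j + i))"
      by (rule sum_cut_twice)
    also have "\<dots> = coefficient (x * (y * z)) (v, es)"
      unfolding coefficient_times sum_distrib_left
    proof (rule sum.cong[OF refl], rule sum.cong)
      fix j :: nat
      show "{..?n - j} = {..length (drop j es)}"
        by (simp only: length_drop)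
    next
      fix j i :: nat
      have "drop (j + i) es = drop i (drop j es)"
        by (simp add: add.commute)
      then show "?t j (j + i) = coefficient x (v, take j es) *
          (coefficient y (path_end v (take j es), take i (drop j es)) *
           coefficient z (path_end (path_end v (take j es)) (take i (drop j es)), drop i (drop j es)))"
        by (simp only: diff_add_inverse take_add path_end_append)
    qed
    finally show "coefficient (x * y * z) (v, es) = coefficient (x * (y * z)) (v, es)" .
  qed
  show "(x + y) * z = x * z + y * z"
    by (rule path_algebra_eqI) (simp only: coefficient_times coefficient_add distrib_right sum.distrib)
  show "x * (y + z) = x * y + x * z"
    by (rule path_algebra_eqI) (simp only: coefficient_times coefficient_add distrib_left sum.distrib)
  show "1 * x = x"
  proof (rule path_algebra_eqI)
    fix v es
    have "coefficient (1 * x) (v, es) =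
        (\<Sum>k\<le>length es. if k = 0 then coefficient x (v, es) else 0)"
      unfolding coefficient_times by (rule sum.cong) (auto simp: coefficient_one)
    then show "coefficient (1 * x) (v, es) = coefficient x (v, es)"
      by simp
  qed
  show "x * 1 = x"
  proof (rule path_algebra_eqI)
    fix v es
    have "coefficient (x * 1) (v, es) =
        (\<Sum>k\<le>length es. if k = length es then coefficient x (v, es) else 0)"
      unfolding coefficient_times by (rule sum.cong) (auto simp: coefficient_one)
    then show "coefficient (x * 1) (v, es) = coefficient x (v, es)"
      by simp
  qed
  have "coefficient 0 (Vertex0, []) \<noteq> coefficient 1 (Vertex0, [])"
    by (simp add: coefficient_zero coefficient_one)
  then show "(0 :: path_algebra) \<noteq> 1"
    by metis
qed

end

lemma path_mult:
  assumes "is_path v es" "is_path w fs"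
  shows "path v es * path w fs = (if path_end v es = w then path v (es @ fs) else 0)"
proof (rule path_algebra_eqI)
  fix u gs
  have "coefficient (path v es * path w fs) (u, gs) =
      (\<Sum>k\<le>length gs. if k = length es \<and> u = v \<and> gs = es @ fs \<and> path_end v es = w then 1 else 0)"
    unfolding coefficient_times
  proof (rule sum.cong[OF refl])
    fix k assume "k \<in> {..length gs}"
    then have "(take k gs = es \<and> drop k gs = fs) \<longleftrightarrow> (k = length es \<and> gs = es @ fs)"
      by (auto simp: min_absorb2)
    then show "coefficient (path v es) (u, take k gs) *
        coefficient (path w fs) (path_end u (take k gs), drop k gs) =
      (if k = length es \<and> u = v \<and> gs = es @ fs \<and> path_end v es = w then 1 else 0)"
      using assms by (auto simp: coefficient_path)
  qed
  also have "\<dots> = coefficient (if path_end v es = w then path v (es @ fs) else 0) (u, gs)"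
    using assms by (auto simp: coefficient_path coefficient_zero is_path_append)
  finally show "coefficient (path v es * path w fs) (u, gs) =
      coefficient (if path_end v es = w then path v (es @ fs) else 0) (u, gs)" .
qed


section \<open>The algebra \<open>A\<close>: the quotient by the two-sided ideal of relations\<close>

definition arrow_elem :: "arrow \<Rightarrow> path_algebra" where
  "arrow_elem e = path (source e) [e]"

definition relations :: "path_algebra set" where
  "relations =
    {arrow_elem Arrow2 * arrow_elem Arrow1, arrow_elem Arrow3 * arrow_elem Arrow2,
     arrow_elem Arrow4 * arrow_elem Arrow3, arrow_elem Arrow1 * arrow_elem Arrow4}"

inductive_set relation_ideal :: "path_algebra set" where
  zero: "0 \<in> relation_ideal"
| gen: "r \<in> relations \<Longrightarrow> a * r * b \<in> relation_ideal"
| add: "x \<in> relation_ideal \<Longrightarrow> y \<in> relation_ideal \<Longrightarrow> x + y \<in> relation_ideal"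

lemma relation_ideal_mult_left: "x \<in> relation_ideal \<Longrightarrow> c * x \<in> relation_ideal"
proof (induction rule: relation_ideal.induct)
  case (gen r a b)
  then show ?case
    using relation_ideal.gen[of r "c * a" b] by (simp add: mult.assoc)
next
  case zero
  show ?case
    by (simp add: relation_ideal.zero)
next
  case (add x y)
  then show ?case
    by (simp only: distrib_left relation_ideal.add)
qed

lemma relation_ideal_mult_right: "x \<in> relation_ideal \<Longrightarrow> x * c \<in> relation_ideal"
proof (induction rule: relation_ideal.induct)
  case (gen r a b)
  then show ?case
    using relation_ideal.gen[of r a "b * c"] by (simp add: mult.assoc)
next
  case zero
  show ?case
    by (simp add: relation_ideal.zero)
next
  case (add x y)
  then show ?case
    by (simp only: distrib_right relation_ideal.add)
qed

lemma relation_ideal_uminus: "x \<in> relation_ideal \<Longrightarrow> - x \<in> relation_ideal"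
  by (metis mult_minus1 relation_ideal_mult_left)

lemma relation_ideal_diff: "x \<in> relation_ideal \<Longrightarrow> y \<in> relation_ideal \<Longrightarrow> x - y \<in> relation_ideal"
  using relation_ideal.add[of x "- y"] relation_ideal_uminus[of y]
  by (simp only: add_uminus_conv_diff)

lemma one_notin_relation_ideal: "1 \<notin> relation_ideal"
proof
  have trivial: "coefficient (x * y) (v, []) = coefficient x (v, []) * coefficient y (v, [])"
    for x y v
    by (simp add: coefficient_times)
  have arrow: "coefficient (arrow_elem e) (v, []) = 0" for e v
    by (simp add: arrow_elem_def coefficient_path)
  have rel: "coefficient r (v, []) = 0" if "r \<in> relations" for r v
    using that by (auto simp: relations_def trivial arrow)
  have "coefficient x (v, []) = 0" if "x \<in> relation_ideal" for x v
    using that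
  proof (induction rule: relation_ideal.induct)
    case zero
    show ?case by (rule coefficient_zero)
  next
    case (gen r a b)
    then show ?case by (simp only: trivial rel mult_zero_left mult_zero_right)
  next
    case (add x y)
    then show ?case by (simp only: coefficient_add add_0_left)
  qed
  moreover assume "1 \<in> relation_ideal"
  ultimately have "coefficient 1 (Vertex0, []) = 0"
    by blast
  then show False
    by (simp add: coefficient_one)
qed

definition relation_congruent :: "path_algebra \<Rightarrow> path_algebra \<Rightarrow> bool" where
  "relation_congruent x y \<longleftrightarrow> x - y \<in> relation_ideal"

quotient_type torus_algebra = path_algebra / relation_congruent
  morphisms rep_torus_algebra to_torus_algebra
proof (rule equivpI)
  show "reflp relation_congruent"
    by (simp add: reflp_def relation_congruent_def relation_ideal.zero)
  show "symp relation_congruent"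
  proof (rule sympI)
    fix x y assume "relation_congruent x y"
    then show "relation_congruent y x"
      using relation_ideal_uminus[of "x - y"] by (simp add: relation_congruent_def)
  qed
  show "transp relation_congruent"
  proof (rule transpI)
    fix x y z assume "relation_congruent x y" "relation_congruent y z"
    then show "relation_congruent x z"
      using relation_ideal.add[of "x - y" "y - z"] by (simp add: relation_congruent_def)
  qed
qed

instantiation torus_algebra :: ring_1
begin

lift_definition zero_torus_algebra :: torus_algebra is 0 .

lift_definition one_torus_algebra :: torus_algebra is 1 .

lift_definition plus_torus_algebra :: "torus_algebra \<Rightarrow> torus_algebra \<Rightarrow> torus_algebra" is "(+)"
proof -
  fix x x' y y'
  assume A: "relation_congruent x x'" "relation_congruent y y'"
  have "x + y - (x' + y') = (x - x') + (y - y')"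
    by simp
  also have "\<dots> \<in> relation_ideal"
    using A unfolding relation_congruent_def by (rule relation_ideal.add)
  finally show "relation_congruent (x + y) (x' + y')"
    unfolding relation_congruent_def .
qed

lift_definition uminus_torus_algebra :: "torus_algebra \<Rightarrow> torus_algebra" is uminus
proof -
  fix x x'
  assume A: "relation_congruent x x'"
  have "- x - - x' = - (x - x')"
    by simp
  also have "\<dots> \<in> relation_ideal"
    using A unfolding relation_congruent_def by (rule relation_ideal_uminus)
  finally show "relation_congruent (- x) (- x')"
    unfolding relation_congruent_def .
qed

lift_definition minus_torus_algebra :: "torus_algebra \<Rightarrow> torus_algebra \<Rightarrow> torus_algebra" is "(-)"
proof -
  fix x x' y y'
  assume A: "relation_congruent x x'" "relation_congruent y y'"
  have "x - y - (x' - y') = (x - x') - (y - y')"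
    by simp
  also have "\<dots> \<in> relation_ideal"
    using A unfolding relation_congruent_def by (rule relation_ideal_diff)
  finally show "relation_congruent (x - y) (x' - y')"
    unfolding relation_congruent_def .
qed

lift_definition times_torus_algebra :: "torus_algebra \<Rightarrow> torus_algebra \<Rightarrow> torus_algebra" is "(*)"
proof -
  fix x x' y y'
  assume A: "relation_congruent x x'" "relation_congruent y y'"
  have "x * y - x' * y' = (x - x') * y + x' * (y - y')"
    by (simp add: left_diff_distrib right_diff_distrib)
  also have "\<dots> \<in> relation_ideal"
    using A unfolding relation_congruent_def
    by (intro relation_ideal.add relation_ideal_mult_left relation_ideal_mult_right)
  finally show "relation_congruent (x * y) (x' * y')"
    unfolding relation_congruent_def .
qed

instance
proof
  have "\<not> relation_congruent 0 1"
    using one_notin_relation_ideal relation_ideal_uminus[of "- 1"]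
    by (auto simp: relation_congruent_def)
  then show "(0 :: torus_algebra) \<noteq> 1"
    by transfer
qed (transfer; simp add: relation_congruent_def relation_ideal.zero algebra_simps)+

end

definition iota0 :: torus_algebra where "iota0 = to_torus_algebra (path Vertex0 [])"
definition iota1 :: torus_algebra where "iota1 = to_torus_algebra (path Vertex1 [])"

definition rho1 :: torus_algebra where "rho1 = to_torus_algebra (arrow_elem Arrow1)"
definition rho2 :: torus_algebra where "rho2 = to_torus_algebra (arrow_elem Arrow2)"
definition rho3 :: torus_algebra where "rho3 = to_torus_algebra (arrow_elem Arrow3)"
definition rho4 :: torus_algebra where "rho4 = to_torus_algebra (arrow_elem Arrow4)"


section \<open>The algebra \<open>A[U]\<close>\<close>

text \<open>The library's convolution product on \<open>nat \<Rightarrow>\<^sub>0 R\<close> makes it the polynomial ring \<open>R[U]\<close> in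
  a central variable, also for noncommutative \<open>R\<close>; \<open>Poly_Mapping.single k a\<close> is \<open>U\<^sup>k a\<close>.\<close>

type_synonym torus_algebra_U = "nat \<Rightarrow>\<^sub>0 torus_algebra"

definition const :: "torus_algebra \<Rightarrow> torus_algebra_U" where
  "const a = Poly_Mapping.single 0 a"

definition var_U :: torus_algebra_U where
  "var_U = Poly_Mapping.single 1 1"

definition ground_U :: "torus_algebra_U set" where
  "ground_U = {c. \<forall>k. Poly_Mapping.lookup c k \<in> {0, iota0, iota1, iota0 + iota1}}"


section \<open>\<open>A\<^sub>\<infinity>\<close>-algebras and homomorphisms in characteristic 2\<close>

text \<open>A family of operations of all arities \<open>n \<ge> 1\<close> is a single function on lists, the list length
  being the arity; the value on the empty list is junk that no condition below refers to. Since
  \<open>2 = 0\<close>, no signs occur.\<close>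

text \<open>Bimodule maps \<open>A[U]\<^sup>\<otimes>\<^sup>n \<rightarrow> A[U]\<close>, with tensor products over the ring \<open>k[U]\<close>. In particular
  such maps are \<open>F\<^sub>2[U]\<close>-linear in each argument.\<close>

definition multilinear :: "(torus_algebra_U list \<Rightarrow> torus_algebra_U) \<Rightarrow> bool" where
  "multilinear f \<longleftrightarrow>
    (\<forall>xs x y ys. f (xs @ [x + y] @ ys) = f (xs @ [x] @ ys) + f (xs @ [y] @ ys)) \<and>
    (\<forall>c\<in>ground_U. \<forall>x xs. f ((c * x) # xs) = c * f (x # xs)) \<and>
    (\<forall>c\<in>ground_U. \<forall>xs x. f (xs @ [x * c]) = f (xs @ [x]) * c) \<and>
    (\<forall>c\<in>ground_U. \<forall>xs x y ys. f (xs @ [x * c, y] @ ys) = f (xs @ [x, c * y] @ ys))"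

text \<open>The sum of \<open>f\<^bsub>r+1+t\<^esub> (Id\<^sup>\<otimes>\<^sup>r \<otimes> \<mu>\<^sub>s \<otimes> Id\<^sup>\<otimes>\<^sup>t)\<close> over all \<open>r + s + t = n\<close> with \<open>s \<ge> 1\<close>,
  evaluated on a list of length \<open>n\<close>.\<close>

definition insertion_sum :: "('a list \<Rightarrow> 'b::comm_monoid_add) \<Rightarrow> ('a list \<Rightarrow> 'a) \<Rightarrow> 'a list \<Rightarrow> 'b" where
  "insertion_sum f \<mu> xs =
    (\<Sum>r<length xs. \<Sum>s=1..length xs - r.
      f (take r xs @ [\<mu> (take s (drop r xs))] @ drop (r + s) xs))"

definition blocks :: "'a list \<Rightarrow> 'a list list set" where
  "blocks xs = {bs. concat bs = xs \<and> [] \<notin> set bs}"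

lemma finite_blocks: "finite (blocks xs)"
proof -
  have "length bs \<le> length (concat bs)" if "[] \<notin> set bs" for bs :: "'a list list"
    using that
  proof (induction bs)
    case (Cons b bs)
    then show ?case by (cases b) auto
  qed simp
  moreover have "length b \<le> length (concat bs)" if "b \<in> set bs" for b and bs :: "'a list list"
    using that by (induction bs) auto
  ultimately have "blocks xs \<subseteq>
      {bs. set bs \<subseteq> {b. set b \<subseteq> set xs \<and> length b \<le> length xs} \<and> length bs \<le> length xs}"
    unfolding blocks_def by fastforce
  then show ?thesis
    by (rule finite_subset) (intro finite_lists_length_le, simp_all)
qed

definition A_infinity_deformation :: "(torus_algebra_U list \<Rightarrow> torus_algebra_U) \<Rightarrow> bool" where
  "A_infinity_deformation \<mu> \<longleftrightarrow>
    multilinear \<mu> \<and>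
    (\<forall>xs. xs \<noteq> [] \<longrightarrow> insertion_sum \<mu> \<mu> xs = 0) \<and>
    (\<forall>x. \<mu> [x] = 0) \<and>
    (\<forall>x y. \<mu> [x, y] = x * y) \<and>
    (\<forall>xs. length xs \<noteq> 2 \<and> (const iota0 \<in> set xs \<or> const iota1 \<in> set xs) \<longrightarrow> \<mu> xs = 0)"

definition A_infinity_hom ::
  "(torus_algebra_U list \<Rightarrow> torus_algebra_U) \<Rightarrow> (torus_algebra_U list \<Rightarrow> torus_algebra_U) \<Rightarrow>
   (torus_algebra_U list \<Rightarrow> torus_algebra_U) \<Rightarrow> bool" where
  "A_infinity_hom \<mu> \<nu> f \<longleftrightarrow>
    multilinear f \<and>
    (\<forall>xs. xs \<noteq> [] \<longrightarrow> (\<Sum>bs\<in>blocks xs. \<nu> (map f bs)) = insertion_sum f \<mu> xs)"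

definition A_infinity_isomorphic ::
  "(torus_algebra_U list \<Rightarrow> torus_algebra_U) \<Rightarrow> (torus_algebra_U list \<Rightarrow> torus_algebra_U) \<Rightarrow> bool" where
  "A_infinity_isomorphic \<mu> \<nu> \<longleftrightarrow> (\<exists>f. A_infinity_hom \<mu> \<nu> f \<and> bij (\<lambda>x. f [x]))"


section \<open>Gradings\<close>

text \<open>Half-integers are represented as rationals \<open>q\<close> with \<open>2 q\<close> an integer.\<close>

definition G_group :: "(rat \<times> rat \<times> rat) monoid" where
  "G_group =
    \<lparr>carrier = {(m, a, b). 2 * m \<in> \<int> \<and> 2 * a \<in> \<int> \<and> 2 * b \<in> \<int> \<and> a + b \<in> \<int> \<and>
        m + ((2 * a + 1) * (a + b + 1) + 1) / 2 \<in> \<int>},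
     monoid.mult = (\<lambda>(m, a, b) (n, c, d). (m + n + a * d - b * c, a + c, b + d)),
     one = (0, 0, 0)\<rparr>"

lemma group_G_group: "group G_group"
proof (rule groupI)
  fix x y assume "x \<in> carrier G_group" "y \<in> carrier G_group"
  moreover obtain m a b where x: "x = (m, a, b)" by (cases x)
  moreover obtain n c d where y: "y = (n, c, d)" by (cases y)
  ultimately have A: "2 * m \<in> \<int>" "2 * a \<in> \<int>" "2 * b \<in> \<int>" "a + b \<in> \<int>"
    "m + ((2 * a + 1) * (a + b + 1) + 1) / 2 \<in> \<int>"
    and B: "2 * n \<in> \<int>" "2 * c \<in> \<int>" "2 * d \<in> \<int>" "c + d \<in> \<int>"
    "n + ((2 * c + 1) * (c + d + 1) + 1) / 2 \<in> \<int>"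
    by (auto simp: G_group_def)
  have "m + n + a * d - b * c + ((2 * (a + c) + 1) * ((a + c) + (b + d) + 1) + 1) / 2 =
    (m + ((2 * a + 1) * (a + b + 1) + 1) / 2) + (n + ((2 * c + 1) * (c + d + 1) + 1) / 2) +
    2 * a * (c + d) - 1"
    by (simp add: field_simps)
  also have "\<dots> \<in> \<int>"
    by (intro Ints_diff[OF Ints_add[OF Ints_add[OF A(5) B(5)] Ints_mult[OF A(2) B(4)]]] Ints_1)
  finally have 1: "m + n + a * d - b * c +
    ((2 * (a + c) + 1) * ((a + c) + (b + d) + 1) + 1) / 2 \<in> \<int>" .
  have "2 * (m + n + a * d - b * c) = 2 * m + 2 * n + (2 * a) * (c + d) - (a + b) * (2 * c)"
    by (simp add: algebra_simps)
  also have "\<dots> \<in> \<int>"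
    by (intro Ints_diff[OF Ints_add[OF Ints_add[OF A(1) B(1)] Ints_mult[OF A(2) B(4)]]]
        Ints_mult[OF A(4) B(2)])
  finally have 2: "2 * (m + n + a * d - b * c) \<in> \<int>" .
  have 3: "2 * (a + c) \<in> \<int>" "2 * (b + d) \<in> \<int>" "a + c + (b + d) \<in> \<int>"
    using Ints_add[OF A(2) B(2)] Ints_add[OF A(3) B(3)] Ints_add[OF A(4) B(4)]
    by (simp_all add: algebra_simps)
  show "x \<otimes>\<^bsub>G_group\<^esub> y \<in> carrier G_group"
    using 1 2 3 by (simp add: G_group_def x y)
next
  show "\<one>\<^bsub>G_group\<^esub> \<in> carrier G_group"
    by (simp add: G_group_def)
next
  fix x y z
  show "x \<otimes>\<^bsub>G_group\<^esub> y \<otimes>\<^bsub>G_group\<^esub> z = x \<otimes>\<^bsub>G_group\<^esub> (y \<otimes>\<^bsub>G_group\<^esub> z)"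
    by (cases x; cases y; cases z) (simp add: G_group_def algebra_simps)
next
  fix x
  show "\<one>\<^bsub>G_group\<^esub> \<otimes>\<^bsub>G_group\<^esub> x = x"
    by (cases x) (simp add: G_group_def)
next
  fix x assume "x \<in> carrier G_group"
  moreover obtain m a b where x: "x = (m, a, b)" by (cases x)
  ultimately have A: "2 * m \<in> \<int>" "2 * a \<in> \<int>" "2 * b \<in> \<int>" "a + b \<in> \<int>"
    "m + ((2 * a + 1) * (a + b + 1) + 1) / 2 \<in> \<int>"
    by (auto simp: G_group_def)
  have "- m + ((2 * (- a) + 1) * (- a + - b + 1) + 1) / 2 =
    - (m + ((2 * a + 1) * (a + b + 1) + 1) / 2) + 2 * a * (a + b) + 2"
    by (simp add: field_simps)
  also have "\<dots> \<in> \<int>"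
    by (intro Ints_add[OF Ints_add[OF Ints_minus[OF A(5)] Ints_mult[OF A(2) A(4)]]] Ints_numeral)
  finally have 1: "- m + ((2 * (- a) + 1) * (- a + - b + 1) + 1) / 2 \<in> \<int>" .
  have 2: "2 * (- m) \<in> \<int>" "2 * (- a) \<in> \<int>" "2 * (- b) \<in> \<int>" "- a + - b \<in> \<int>"
    using Ints_minus[OF A(1)] Ints_minus[OF A(2)] Ints_minus[OF A(3)] Ints_minus[OF A(4)] by simp_all
  have "(- m, - a, - b) \<in> carrier G_group"
    using 1 2 by (simp only: G_group_def partial_object.simps mem_Collect_eq split_conv simp_thms)
  then show "\<exists>y\<in>carrier G_group. y \<otimes>\<^bsub>G_group\<^esub> x = \<one>\<^bsub>G_group\<^esub>"
    by (rule bexI[rotated]) (simp add: G_group_def x)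
qed

type_synonym Gamma_elem = "(rat \<times> rat \<times> rat) \<times> int"

definition Gamma :: "Gamma_elem monoid" where
  "Gamma = G_group \<times>\<times> integer_group"

lemma group_Gamma: "group Gamma"
  unfolding Gamma_def by (intro DirProd_group group_G_group group_integer_group)

definition Gamma_center :: "Gamma_elem set" where
  "Gamma_center = {z \<in> carrier Gamma. \<forall>g\<in>carrier Gamma. z \<otimes>\<^bsub>Gamma\<^esub> g = g \<otimes>\<^bsub>Gamma\<^esub> z}"

definition lambda :: Gamma_elem where
  "lambda = ((1, 0, 0), 0)"

lemma lambda_central: "lambda \<in> Gamma_center"
  by (auto simp: lambda_def Gamma_center_def Gamma_def G_group_def)

definition Gamma_prod :: "Gamma_elem list \<Rightarrow> Gamma_elem" where
  "Gamma_prod gs = foldr (mult Gamma) gs \<one>\<^bsub>Gamma\<^esub>"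

fun gr :: "arrow \<Rightarrow> rat \<times> rat \<times> rat" where
  "gr Arrow1 = (- 1 / 2, 1 / 2, - 1 / 2)"
| "gr Arrow2 = (- 1 / 2, 1 / 2, 1 / 2)"
| "gr Arrow3 = (- 1 / 2, - 1 / 2, 1 / 2)"
| "gr Arrow4 = (- 3 / 2, - 1 / 2, - 1 / 2)"

fun wn :: "arrow \<Rightarrow> int" where
  "wn Arrow1 = 0"
| "wn Arrow2 = 0"
| "wn Arrow3 = 0"
| "wn Arrow4 = 1"

lemma gr_in_G_group: "gr e \<in> carrier G_group"
  by (cases e) (simp_all add: G_group_def)

definition path_degree :: "arrow list \<Rightarrow> Gamma_elem" where
  "path_degree es = Gamma_prod (map (\<lambda>e. (gr e, wn e)) es)"

text \<open>\<open>homogeneous u g\<close> is the degree \<open>g\<close> part of \<open>A[U]\<close>, for the grading in which \<open>U\<close> has degree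
  \<open>u\<close>: the span of all \<open>U\<^sup>k p\<close> with \<open>p\<close> a path such that \<open>u\<^sup>k \<gamma>(p) = g\<close>. When \<open>u\<close> is central this
  is the only grading of \<open>A[U]\<close> that extends the one of \<open>A\<close> and for which multiplication by \<open>U\<close>
  is homogeneous of degree \<open>u\<close>.\<close>

inductive_set homogeneous :: "Gamma_elem \<Rightarrow> Gamma_elem \<Rightarrow> torus_algebra_U set"
  for u g :: Gamma_elem where
  zero: "0 \<in> homogeneous u g"
| gen: "is_path v es \<Longrightarrow> u [^]\<^bsub>Gamma\<^esub> k \<otimes>\<^bsub>Gamma\<^esub> path_degree es = g \<Longrightarrow>
    Poly_Mapping.single k (to_torus_algebra (path v es)) \<in> homogeneous u g" for k :: nat
| add: "x \<in> homogeneous u g \<Longrightarrow> y \<in> homogeneous u g \<Longrightarrow> x + y \<in> homogeneous u g"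

definition Gamma_graded :: "(torus_algebra_U list \<Rightarrow> torus_algebra_U) \<Rightarrow> bool" where
  "Gamma_graded \<mu> \<longleftrightarrow>
    (\<exists>u\<in>Gamma_center. \<forall>xs gs. xs \<noteq> [] \<and> set gs \<subseteq> carrier Gamma \<and>
      list_all2 (\<lambda>x g. x \<in> homogeneous u g) xs gs \<longrightarrow>
      \<mu> xs \<in> homogeneous u (lambda [^]\<^bsub>Gamma\<^esub> (int (length xs) - 2) \<otimes>\<^bsub>Gamma\<^esub> Gamma_prod gs))"

definition torus_deformation :: "(torus_algebra_U list \<Rightarrow> torus_algebra_U) \<Rightarrow> bool" where
  "torus_deformation \<mu> \<longleftrightarrow>
    A_infinity_deformation \<mu> \<and>
    Gamma_graded \<mu> \<and>
    \<mu> [const rho4, const rho3, const rho2, const rho1] = var_U * const iota1 \<and>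
    \<mu> [const rho3, const rho2, const rho1, const rho4] = var_U * const iota0"

end

theory Submission
  imports Defs
begin

text \<open>
The algebra is quadratic monomial: besides the idempotents it has as a basis the chords, that is,
the paths in which every arrow is followed by its cyclic successor, and it is Koszul, the dual words
being the descending ones, in which every arrow is preceded by its successor. Deformation problems
of a Koszul algebra are governed by the values of cochains on the dual words, and here the grading
leaves almost no room for such values. This is the whole idea; the rest makes it explicit enough to
be carried out in all arities at once.

\<^bold>\<open>The Koszul property.\<close> A composable bar word of chords is of exactly one of three kinds
(\<open>composable_word_cases\<close>): \<^emph>\<open>critical\<close>, a descending word of single arrows; \<^emph>\<open>long\<close>, a descending
word of arrows followed by a chord \<open>p q\<close> that is longer than its first arrow \<open>p\<close> and
whose first arrow continues the descent, and then by arbitrary chords;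
or \<^emph>\<open>merge\<close>, the same with \<open>p q\<close> split into the two entries \<open>p | q\<close>. Splitting is a bijection from
long to merge words, and it contracts the bar complex onto the critical words. For cochains this
gives two statements. An equation \<open>\<delta>\<phi> = f\<close> can be solved on merge words by a closed recursion, with
\<open>\<phi> = 0\<close> on merge words and any prescribed values on critical words (\<open>hochschild_solution\<close>). A cocycle
that vanishes on merge and on critical words is zero (\<open>cocycle_eq_0\<close>). Hence an obstruction, which is
always a cocycle, only has to be examined on critical words.

\<^bold>\<open>Existence.\<close> The operations are built arity by arity. The defect \<open>E = \<mu> \<circ> \<mu>\<close> satisfies \<open>E \<circ> \<mu> = \<mu> \<circ> E\<close>
because insertion of cochains is pre-Lie (\<open>insertion_sum_pre_Lie\<close>), so its first possibly nonzero
component is a Hochschild cocycle. The next operation is chosen to kill it on merge words, with the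
critical values \<open>U\<close> times an idempotent in arity four and zero otherwise. On critical words the
defect then vanishes (\<open>defect_critical\<close>): an inner operation can only return a multiple of an
idempotent, which strict unitality forbids as an input except to the product, and the two products
cancel.

\<^bold>\<open>Uniqueness.\<close> An isomorphism \<open>f\<close> with \<open>f\<^sub>1 = id\<close> is built in the same way; its defect is the difference
of the two sides of the homomorphism equation, and again its first component is a cocycle
(\<open>hom_defect_cocycle\<close>). Comparing degrees (\<open>critical_value\<close>), a cochain in the degree of the operations
vanishes on every critical word whose length is not four, and on those of length four it can only take
combinations of \<open>U\<close> times an idempotent and closed chords of length four. The two prescribed operations
fix these combinations up to a single bit (\<open>torus_deformation_four_words\<close>), and changing that bit
amounts to changing \<open>f\<^sub>3\<close> by the cochain with \<open>(\<rho>\<^sub>1, \<rho>\<^sub>4, \<rho>\<^sub>3) \<mapsto> \<rho>\<^sub>3\<rho>\<^sub>4\<rho>\<^sub>1\<close> (\<open>four_word_correction\<close>).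
\<close>


section \<open>Insertions and block decompositions of lists\<close>

text \<open>\<open>deconc \<psi> xs\<close> is the sum of \<open>\<psi> a b\<close> over all cuts \<open>xs = a @ b\<close>. The recursion on the list turns the
coalgebra identities of the bar construction into inductions without index arithmetic.\<close>

fun deconc :: "('a list \<Rightarrow> 'a list \<Rightarrow> 'b::comm_monoid_add) \<Rightarrow> 'a list \<Rightarrow> 'b" where
  "deconc \<psi> [] = \<psi> [] []"
| "deconc \<psi> (x # xs) = \<psi> [] (x # xs) + deconc (\<lambda>a. \<psi> (x # a)) xs"

lemma deconc_eq_sum: "deconc \<psi> xs = (\<Sum>s\<le>length xs. \<psi> (take s xs) (drop s xs))"
proof (induction xs arbitrary: \<psi>)
  case (Cons x xs)
  show ?case
    by (simp add: Cons.IH sum.atMost_Suc_shift del: sum.atMost_Suc)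
qed simp

lemma deconc_cong [fundef_cong]:
  assumes "xs = ys" "\<And>a b. a @ b = ys \<Longrightarrow> \<psi> a b = \<chi> a b"
  shows "deconc \<psi> xs = deconc \<chi> ys"
  unfolding deconc_eq_sum assms(1) by (intro sum.cong refl assms(2)) simp

lemma deconc_add: "deconc (\<lambda>a b. \<psi> a b + \<chi> a b) xs = deconc \<psi> xs + deconc \<chi> xs"
  by (simp add: deconc_eq_sum sum.distrib)

lemma deconc_zero [simp]: "deconc (\<lambda>a b. 0) xs = 0"
  by (simp add: deconc_eq_sum)

lemma deconc_eq_0: "(\<And>a b. a @ b = xs \<Longrightarrow> \<psi> a b = 0) \<Longrightarrow> deconc \<psi> xs = 0"
  using deconc_cong[of xs xs \<psi> "\<lambda>a b. 0"] by simp

text \<open>Both sides sum over the ways to cut the list twice.\<close>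

lemma deconc_coassoc:
  "deconc (\<lambda>a b. deconc (\<lambda>c d. \<chi> a c d) b) xs = deconc (\<lambda>a b. deconc (\<lambda>c d. \<chi> c d b) a) xs"
proof (induction xs arbitrary: \<chi>)
  case (Cons x xs)
  show ?case
    by (simp add: Cons.IH[of "\<lambda>a. \<chi> (x # a)"] deconc_add add.assoc)
qed simp

lemma deconc_append_Cons:
  "deconc \<psi> (xs @ y # ys) =
    deconc (\<lambda>a b. \<psi> a (b @ y # ys)) xs + deconc (\<lambda>a b. \<psi> (xs @ y # a) b) ys"
  by (induction xs arbitrary: \<psi>) (simp_all add: add.assoc)

definition hom_add :: "('a::comm_monoid_add \<Rightarrow> 'b::comm_monoid_add) \<Rightarrow> bool" where
  "hom_add h \<longleftrightarrow> h 0 = 0 \<and> (\<forall>x y. h (x + y) = h x + h y)"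

lemma hom_add_sum: "hom_add h \<Longrightarrow> h (sum g A) = (\<Sum>x\<in>A. h (g x))"
  by (induction A rule: infinite_finite_induct) (auto simp: hom_add_def)

lemma hom_add_deconc: "hom_add h \<Longrightarrow> h (deconc \<psi> xs) = deconc (\<lambda>a b. h (\<psi> a b)) xs"
  by (simp add: deconc_eq_sum hom_add_sum)

lemma insertion_sum_Nil [simp]: "insertion_sum \<phi> g [] = 0"
  by (simp add: insertion_sum_def)

lemma insertion_sum_Cons:
  "insertion_sum \<phi> g (x # xs) =
    deconc (\<lambda>a b. \<phi> (g (x # a) # b)) xs + insertion_sum (\<lambda>ys. \<phi> (x # ys)) g xs"
proof -
  have "(\<Sum>s = 1..Suc (length xs). \<phi> (g (take s (x # xs)) # drop s (x # xs))) =
      (\<Sum>s\<le>length xs. \<phi> (g (x # take s xs) # drop s xs))"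
    by (rule sum.reindex_bij_witness[of _ Suc "\<lambda>s. s - 1"]) (auto simp: take_Cons' drop_Cons')
  then show ?thesis
    unfolding insertion_sum_def deconc_eq_sum
    by (simp add: sum.lessThan_Suc_shift del: sum.lessThan_Suc)
qed

lemma insertion_sum_add_left:
  "insertion_sum (\<lambda>ys. \<phi> ys + \<chi> ys) g xs = insertion_sum \<phi> g xs + insertion_sum \<chi> g xs"
  by (simp add: insertion_sum_def sum.distrib)

lemma insertion_sum_cong:
  assumes "\<And>a b c. xs = a @ b @ c \<Longrightarrow> b \<noteq> [] \<Longrightarrow> \<phi> (a @ [g b] @ c) = \<chi> (a @ [h b] @ c)"
  shows "insertion_sum \<phi> g xs = insertion_sum \<chi> h xs"
  unfolding insertion_sum_def
proof (intro sum.cong refl)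
  fix r s assume "r \<in> {..<length xs}" "s \<in> {1..length xs - r}"
  then show "\<phi> (take r xs @ [g (take s (drop r xs))] @ drop (r + s) xs) =
      \<chi> (take r xs @ [h (take s (drop r xs))] @ drop (r + s) xs)"
    by (intro assms) (auto simp: add.commute[of r s] simp flip: drop_drop)
qed

lemma insertion_sum_eq_0:
  assumes "\<And>a b c. xs = a @ b @ c \<Longrightarrow> b \<noteq> [] \<Longrightarrow> \<phi> (a @ [g b] @ c) = 0"
  shows "insertion_sum \<phi> g xs = 0"
  using insertion_sum_cong[of xs \<phi> g "\<lambda>_. 0" g] assms by (simp add: insertion_sum_def)

lemma hom_add_insertion:
  "hom_add h \<Longrightarrow> h (insertion_sum \<phi> g xs) = insertion_sum (\<lambda>ys. h (\<phi> ys)) g xs"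
  by (simp add: insertion_sum_def hom_add_sum)

text \<open>Insertion of \<open>g\<close> is a coderivation for the deconcatenation of lists.\<close>

lemma insertion_sum_deconc:
  "insertion_sum (deconc \<psi>) g xs =
    deconc (\<lambda>a b. insertion_sum (\<lambda>c. \<psi> c b) g a + insertion_sum (\<psi> a) g b) xs"
proof (induction xs arbitrary: \<psi>)
  case (Cons x xs)
  have "deconc (\<lambda>a b. deconc (\<lambda>c. \<psi> (g (x # a) # c)) b) xs =
      deconc (\<lambda>a b. deconc (\<lambda>c d. \<psi> (g (x # c) # d) b) a) xs"
    by (rule deconc_coassoc)
  then show ?case
    by (simp add: insertion_sum_Cons insertion_sum_add_left deconc_add Cons.IH algebra_simps)
qed simp

text \<open>A window of \<open>xs @ x # ys\<close> lies before \<open>x\<close>, contains \<open>x\<close>, or lies after \<open>x\<close>. Linearity in a single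
argument is read off from this splitting.\<close>

lemma insertion_sum_mid:
  "insertion_sum \<phi> g (xs @ x # ys) =
    insertion_sum (\<lambda>a. \<phi> (a @ x # ys)) g xs
    + deconc (\<lambda>a b. deconc (\<lambda>c d. \<phi> (a @ g (b @ x # c) # d)) ys) xs
    + insertion_sum (\<lambda>b. \<phi> (xs @ x # b)) g ys"
proof (induction xs arbitrary: \<phi>)
  case (Cons z xs)
  show ?case
    by (simp add: insertion_sum_Cons deconc_append_Cons deconc_add Cons.IH algebra_simps)
qed (simp add: insertion_sum_Cons)

definition slot_additive :: "('a::comm_monoid_add list \<Rightarrow> 'b::comm_monoid_add) \<Rightarrow> bool" where
  "slot_additive f \<longleftrightarrow> (\<forall>xs ys. hom_add (\<lambda>x. f (xs @ x # ys)))"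

lemma slot_additive_D: "slot_additive f \<Longrightarrow> hom_add (\<lambda>x. f (xs @ x # ys))"
  by (simp add: slot_additive_def)

lemma slot_additive_Cons: "slot_additive f \<Longrightarrow> slot_additive (\<lambda>xs. f (x # xs))"
  unfolding slot_additive_def
proof (intro allI)
  fix xs ys
  assume "\<forall>xs ys. hom_add (\<lambda>x. f (xs @ x # ys))"
  from this[rule_format, of "x # xs" ys] show "hom_add (\<lambda>y. f (x # xs @ y # ys))"
    by simp
qed

lemma slot_additive_hd: "slot_additive f \<Longrightarrow> hom_add (\<lambda>x. f (x # ys))"
  using slot_additive_D[of f "[]"] by simp

lemma slot_additive_0: "slot_additive f \<Longrightarrow> f (xs @ 0 # ys) = 0"
  unfolding slot_additive_def hom_add_def by blast

text \<open>Composition of cochains by insertion is pre-Lie: the two sides differ by the ways to insert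
  \<open>g\<close> into two disjoint windows, and each of these occurs twice.\<close>

lemma insertion_sum_pre_Lie:
  fixes \<phi> :: "'a::comm_monoid_add list \<Rightarrow> 'b::ab_group_add"
  assumes "slot_additive \<phi>" and double: "\<And>y :: 'b. y + y = 0"
  shows "insertion_sum (insertion_sum \<phi> g) g xs = insertion_sum \<phi> (insertion_sum g g) xs"
  using assms(1)
proof (induction xs arbitrary: \<phi>)
  case (Cons x xs)
  \<comment> \<open>\<open>A\<close> collects the pairs of disjoint windows of which the first one starts at \<open>x\<close>; it arises once for
    each order of the two insertions.\<close>
  define A where "A = deconc (\<lambda>a b. insertion_sum (\<lambda>c. \<phi> (g (x # a) # c)) g b) xs"
  have IH: "insertion_sum (insertion_sum (\<lambda>ys. \<phi> (x # ys)) g) g xs =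
      insertion_sum (\<lambda>ys. \<phi> (x # ys)) (insertion_sum g g) xs"
    by (intro Cons.IH slot_additive_Cons Cons.prems)
  have hd: "hom_add (\<lambda>y. \<phi> (y # b))" for b
    by (rule slot_additive_hd[OF Cons.prems])
  have "deconc (\<lambda>a b. \<phi> (insertion_sum g g (x # a) # b)) xs =
      deconc (\<lambda>a b. deconc (\<lambda>c d. \<phi> (g (g (x # c) # d) # b)) a
        + insertion_sum (\<lambda>c. \<phi> (g (x # c) # b)) g a) xs"
    using hd by (intro deconc_cong refl)
      (simp add: insertion_sum_Cons hom_add_def hom_add_deconc[OF hd] hom_add_insertion[OF hd])
  also have "\<dots> = deconc (\<lambda>a b. deconc (\<lambda>c d. \<phi> (g (g (x # a) # c) # d)) b) xs
      + deconc (\<lambda>a b. insertion_sum (\<lambda>c. \<phi> (g (x # c) # b)) g a) xs"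
    by (simp add: deconc_add deconc_coassoc[of "\<lambda>a c d. \<phi> (g (g (x # a) # c) # d)"])
  finally have R: "deconc (\<lambda>a b. \<phi> (insertion_sum g g (x # a) # b)) xs = \<dots>" .
  have "insertion_sum (insertion_sum \<phi> g) g (x # xs) =
      deconc (\<lambda>a b. deconc (\<lambda>c d. \<phi> (g (g (x # a) # c) # d)) b) xs + A
      + (insertion_sum (deconc (\<lambda>a b. \<phi> (g (x # a) # b))) g xs
      + insertion_sum (insertion_sum (\<lambda>ys. \<phi> (x # ys)) g) g xs)"
    by (simp add: insertion_sum_Cons[of _ _ x] insertion_sum_add_left A_def)
      (simp add: insertion_sum_Cons deconc_add)
  also have "insertion_sum (deconc (\<lambda>a b. \<phi> (g (x # a) # b))) g xs =
      deconc (\<lambda>a b. insertion_sum (\<lambda>c. \<phi> (g (x # c) # b)) g a) xs + A"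
    by (simp add: insertion_sum_deconc deconc_add A_def)
  finally have "insertion_sum (insertion_sum \<phi> g) g (x # xs) =
      deconc (\<lambda>a b. \<phi> (insertion_sum g g (x # a) # b)) xs
      + insertion_sum (\<lambda>ys. \<phi> (x # ys)) (insertion_sum g g) xs + (A + A)"
    by (simp add: R IH algebra_simps)
  then show ?case
    by (simp add: double insertion_sum_Cons)
qed simp

definition block_sum :: "('b list \<Rightarrow> 'c::comm_monoid_add) \<Rightarrow> ('a list \<Rightarrow> 'b) \<Rightarrow> 'a list \<Rightarrow> 'c" where
  "block_sum \<phi> f xs = (\<Sum>bs\<in>blocks xs. \<phi> (map f bs))"

lemma blocks_Nil: "blocks [] = {[]}"
proof -
  have "bs = []" if "concat bs = []" "[] \<notin> set bs" for bs :: "'a list list"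
    using that by (cases bs) auto
  then show ?thesis by (auto simp: blocks_def)
qed

lemma sum_blocks_Cons:
  "(\<Sum>bs\<in>blocks (x # xs). F bs) = deconc (\<lambda>a b. \<Sum>bs\<in>blocks b. F ((x # a) # bs)) xs"
proof -
  define S where "S s = (\<lambda>bs. (x # take s xs) # bs) ` blocks (drop s xs)" for s
  have "blocks (x # xs) = (\<Union>s\<in>{..length xs}. S s)"
  proof
    show "blocks (x # xs) \<subseteq> (\<Union>s\<in>{..length xs}. S s)"
    proof
      fix bs assume "bs \<in> blocks (x # xs)"
      then have c: "concat bs = x # xs" "[] \<notin> set bs"
        by (auto simp: blocks_def)
      then obtain b cs where bs: "bs = b # cs"
        by (cases bs) auto
      then obtain a where b: "b = x # a" and a: "a @ concat cs = xs"
        using c by (cases b) auto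
      have "bs \<in> S (length a)"
        unfolding S_def bs b using a c(2) bs by (auto simp: blocks_def)
      moreover have "length a \<le> length xs"
        using a by auto
      ultimately show "bs \<in> (\<Union>s\<in>{..length xs}. S s)"
        by blast
    qed
    show "(\<Union>s\<in>{..length xs}. S s) \<subseteq> blocks (x # xs)"
      by (auto simp: S_def blocks_def)
  qed
  moreover have "S s \<inter> S t = {}" if "s \<le> length xs" "t \<le> length xs" "s \<noteq> t" for s t
  proof -
    have "take s xs \<noteq> take t xs"
      using that by (metis length_take min_absorb2)
    then show ?thesis
      by (auto simp: S_def)
  qed
  ultimately have "(\<Sum>bs\<in>blocks (x # xs). F bs) = (\<Sum>s\<le>length xs. \<Sum>bs\<in>S s. F bs)"
    by (simp, subst sum.UNION_disjoint) (auto simp: S_def finite_blocks)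
  also have "\<dots> = (\<Sum>s\<le>length xs. \<Sum>bs\<in>blocks (drop s xs). F ((x # take s xs) # bs))"
    unfolding S_def by (rule sum.cong[OF refl]) (simp add: sum.reindex)
  finally show ?thesis
    by (simp add: deconc_eq_sum)
qed

lemma block_sum_Nil [simp]: "block_sum \<phi> f [] = \<phi> []"
  by (simp add: block_sum_def blocks_Nil)

lemma block_sum_Cons:
  "block_sum \<phi> f (x # xs) = deconc (\<lambda>a b. block_sum (\<lambda>ys. \<phi> (f (x # a) # ys)) f b) xs"
  by (simp add: block_sum_def sum_blocks_Cons)

lemma block_sum_add:
  "block_sum (\<lambda>ys. \<phi> ys + \<chi> ys) f xs = block_sum \<phi> f xs + block_sum \<chi> f xs"
  by (simp add: block_sum_def sum.distrib)

lemma hom_add_block_sum: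
  "hom_add h \<Longrightarrow> h (block_sum \<phi> f xs) = block_sum (\<lambda>ys. h (\<phi> ys)) f xs"
  by (simp add: block_sum_def hom_add_sum)

lemma hom_add_block_sum_hd:
  "slot_additive \<phi> \<Longrightarrow> hom_add (\<lambda>y. block_sum (\<lambda>ys. \<phi> (y # ys)) f b)"
  using slot_additive_hd[of \<phi>] by (simp add: hom_add_def block_sum_def sum.distrib)

text \<open>Cutting a list of blocks is the same as cutting the list itself and then choosing blocks on both sides.\<close>

lemma block_sum_deconc:
  "block_sum (deconc \<psi>) f xs = deconc (\<lambda>a b. block_sum (\<lambda>c. block_sum (\<psi> c) f b) f a) xs"
proof (induction xs arbitrary: \<psi> rule: length_induct)
  case (1 xs)
  show ?case
  proof (cases xs)
    case (Cons x xs')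
    have "block_sum (deconc \<psi>) f xs =
        deconc (\<lambda>a b. block_sum (\<lambda>ys. \<psi> [] (f (x # a) # ys)) f b) xs'
        + deconc (\<lambda>a b. block_sum (deconc (\<lambda>c. \<psi> (f (x # a) # c))) f b) xs'"
      by (simp add: Cons block_sum_Cons block_sum_add deconc_add)
    also have "deconc (\<lambda>a b. block_sum (deconc (\<lambda>c. \<psi> (f (x # a) # c))) f b) xs' =
        deconc (\<lambda>a b. deconc (\<lambda>d e. block_sum (\<lambda>c. block_sum (\<psi> (f (x # a) # c)) f e) f d) b) xs'"
      using 1 by (intro deconc_cong refl) (auto simp: Cons)
    also have "\<dots> = deconc (\<lambda>a b. block_sum (\<lambda>c. block_sum (\<psi> c) f b) f (x # a)) xs'"
      by (subst deconc_coassoc) (simp add: block_sum_Cons)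
    finally show ?thesis
      by (simp add: Cons block_sum_Cons[of "\<psi> []"])
  qed simp
qed

text \<open>The linearization of \<open>block_sum \<phi> f\<close> in the direction \<open>e\<close>: exactly one block is sent through \<open>e\<close>, all the
others through \<open>f\<close>. It is what a homomorphism's defect has to be inserted into.\<close>

fun marked :: "('b list \<Rightarrow> 'c::comm_monoid_add) \<Rightarrow> ('a list \<Rightarrow> 'b) \<Rightarrow> ('a list \<Rightarrow> 'b) \<Rightarrow> 'a list list \<Rightarrow> 'c" where
  "marked \<phi> f e [] = 0"
| "marked \<phi> f e (b # bs) = \<phi> (e b # map f bs) + marked (\<lambda>ys. \<phi> (f b # ys)) f e bs"

definition marked_sum ::
  "('b list \<Rightarrow> 'c::comm_monoid_add) \<Rightarrow> ('a list \<Rightarrow> 'b) \<Rightarrow> ('a list \<Rightarrow> 'b) \<Rightarrow> 'a list \<Rightarrow> 'c" where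
  "marked_sum \<phi> f e xs = (\<Sum>bs\<in>blocks xs. marked \<phi> f e bs)"

lemma marked_sum_Nil [simp]: "marked_sum \<phi> f e [] = 0"
  by (simp add: marked_sum_def blocks_Nil)

lemma marked_sum_Cons:
  "marked_sum \<phi> f e (x # xs) =
    deconc (\<lambda>a b. block_sum (\<lambda>ys. \<phi> (e (x # a) # ys)) f b
      + marked_sum (\<lambda>ys. \<phi> (f (x # a) # ys)) f e b) xs"
  by (simp add: marked_sum_def block_sum_def sum_blocks_Cons sum.distrib)

lemma marked_sum_add:
  assumes "slot_additive \<phi>"
  shows "marked_sum \<phi> f (\<lambda>ys. e ys + e' ys) xs = marked_sum \<phi> f e xs + marked_sum \<phi> f e' xs"
proof -
  have "marked \<phi> f (\<lambda>ys. e ys + e' ys) bs = marked \<phi> f e bs + marked \<phi> f e' bs" for bs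
    using assms
  proof (induction bs arbitrary: \<phi>)
    case (Cons b bs)
    from slot_additive_hd[OF Cons.prems] Cons.IH[OF slot_additive_Cons[OF Cons.prems]]
    show ?case
      by (simp add: hom_add_def algebra_simps)
  qed simp
  then show ?thesis
    by (simp add: marked_sum_def sum.distrib)
qed

text \<open>A window together with the block that swallows its value fills one block of the original list, so
  inserting \<open>g\<close> before choosing blocks marks the block in which it happens.\<close>

lemma insertion_sum_block_sum:
  assumes "slot_additive \<phi>"
  shows "insertion_sum (block_sum \<phi> f) g xs = marked_sum \<phi> f (insertion_sum f g) xs"
  using assms
proof (induction xs arbitrary: \<phi> rule: length_induct)
  case (1 xs)
  show ?case
  proof (cases xs)
    case (Cons x xs')
    let ?G = "\<lambda>y b. block_sum (\<lambda>ys. \<phi> (y # ys)) f b"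
    have hd: "hom_add (\<lambda>y. ?G y b)" for b
      by (rule hom_add_block_sum_hd[OF 1(2)])
    have "insertion_sum (block_sum \<phi> f) g xs =
        deconc (\<lambda>a b. deconc (\<lambda>c d. ?G (f (g (x # a) # c)) d) b) xs'
        + insertion_sum (deconc (\<lambda>a b. ?G (f (x # a)) b)) g xs'"
      by (simp add: Cons insertion_sum_Cons block_sum_Cons)
    also have "\<dots> = deconc (\<lambda>a b. deconc (\<lambda>c d. ?G (f (g (x # c) # d)) b) a) xs'
        + deconc (\<lambda>a b. insertion_sum (\<lambda>c. ?G (f (x # c)) b) g a) xs'
        + deconc (\<lambda>a b. insertion_sum (?G (f (x # a))) g b) xs'"
      by (subst deconc_coassoc) (simp add: insertion_sum_deconc deconc_add add.assoc)
    also have "deconc (\<lambda>a b. insertion_sum (?G (f (x # a))) g b) xs' =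
        deconc (\<lambda>a b. marked_sum (\<lambda>ys. \<phi> (f (x # a) # ys)) f (insertion_sum f g) b) xs'"
    proof (intro deconc_cong refl)
      fix a b assume "a @ b = xs'"
      then have "length b < length xs"
        by (auto simp: Cons)
      then show "insertion_sum (?G (f (x # a))) g b =
          marked_sum (\<lambda>ys. \<phi> (f (x # a) # ys)) f (insertion_sum f g) b"
        using 1(1) slot_additive_Cons[OF 1(2)] by blast
    qed
    also have "deconc (\<lambda>a b. deconc (\<lambda>c d. ?G (f (g (x # c) # d)) b) a) xs'
        + deconc (\<lambda>a b. insertion_sum (\<lambda>c. ?G (f (x # c)) b) g a) xs' =
        deconc (\<lambda>a b. ?G (insertion_sum f g (x # a)) b) xs'"
      unfolding deconc_add[symmetric]
    proof (intro deconc_cong refl)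
      fix a b
      have "?G (insertion_sum f g (x # a)) b =
          ?G (deconc (\<lambda>c d. f (g (x # c) # d)) a) b + ?G (insertion_sum (\<lambda>c. f (x # c)) g a) b"
        using hd[of b] by (simp add: insertion_sum_Cons hom_add_def)
      then show "deconc (\<lambda>c d. ?G (f (g (x # c) # d)) b) a + insertion_sum (\<lambda>c. ?G (f (x # c)) b) g a =
          ?G (insertion_sum f g (x # a)) b"
        by (simp only: hom_add_deconc[OF hd] hom_add_insertion[OF hd])
    qed
    finally show ?thesis
      by (simp add: Cons marked_sum_Cons deconc_add)
  qed simp
qed

text \<open>Dually, a marked block that is itself cut into blocks is a window of consecutive blocks, on which \<open>g\<close>
is evaluated after \<open>f\<close>.\<close>

lemma marked_sum_block_sum:
  assumes "slot_additive \<phi>"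
  shows "marked_sum \<phi> f (block_sum g f) xs = block_sum (insertion_sum \<phi> g) f xs"
  using assms
proof (induction xs arbitrary: \<phi> rule: length_induct)
  case (1 xs)
  show ?case
  proof (cases xs)
    case (Cons x xs')
    let ?G = "\<lambda>y b. block_sum (\<lambda>ys. \<phi> (y # ys)) f b"
    have hd: "hom_add (\<lambda>y. ?G y b)" for b
      by (rule hom_add_block_sum_hd[OF 1(2)])
    have "block_sum (insertion_sum \<phi> g) f xs =
        deconc (\<lambda>a b. block_sum (deconc (\<lambda>c d. \<phi> (g (f (x # a) # c) # d))) f b) xs'
        + deconc (\<lambda>a b. block_sum (insertion_sum (\<lambda>ys. \<phi> (f (x # a) # ys)) g) f b) xs'"
      by (simp add: Cons block_sum_Cons insertion_sum_Cons block_sum_add deconc_add)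
    also have "deconc (\<lambda>a b. block_sum (insertion_sum (\<lambda>ys. \<phi> (f (x # a) # ys)) g) f b) xs' =
        deconc (\<lambda>a b. marked_sum (\<lambda>ys. \<phi> (f (x # a) # ys)) f (block_sum g f) b) xs'"
    proof (intro deconc_cong refl)
      fix a b assume "a @ b = xs'"
      then have "length b < length xs"
        by (auto simp: Cons)
      then show "block_sum (insertion_sum (\<lambda>ys. \<phi> (f (x # a) # ys)) g) f b =
          marked_sum (\<lambda>ys. \<phi> (f (x # a) # ys)) f (block_sum g f) b"
        using 1(1) slot_additive_Cons[OF 1(2), of "f (x # a)"] by metis
    qed
    also have "deconc (\<lambda>a b. block_sum (deconc (\<lambda>c d. \<phi> (g (f (x # a) # c) # d))) f b) xs' =
        deconc (\<lambda>a b. deconc (\<lambda>c d. block_sum (\<lambda>e. ?G (g (f (x # c) # e)) b) f d) a) xs'"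
      by (simp only: block_sum_deconc) (rule deconc_coassoc)
    also have "\<dots> = deconc (\<lambda>a b. ?G (block_sum g f (x # a)) b) xs'"
      by (intro deconc_cong refl)
        (simp only: block_sum_Cons hom_add_deconc[OF hd] hom_add_block_sum[OF hd])
    finally show ?thesis
      by (simp add: Cons marked_sum_Cons deconc_add)
  qed simp
qed

text \<open>The block containing \<open>x\<close> separates the blocks before it from those after it; like
\<open>insertion_sum_mid\<close>, this isolates the dependence on one argument.\<close>

lemma block_sum_mid:
  fixes \<phi> :: "'b list \<Rightarrow> 'c::comm_monoid_add"
  shows "block_sum \<phi> f (xs @ x # ys) =
    deconc (\<lambda>a b. deconc (\<lambda>c d. block_sum (\<lambda>as. block_sum (\<lambda>ds. \<phi> (as @ f (b @ x # c) # ds)) f d) f a) ys) xs"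
proof (induction xs arbitrary: \<phi> rule: length_induct)
  case (1 xs)
  show ?case
  proof (cases xs)
    case Nil
    then show ?thesis by (simp add: block_sum_Cons)
  next
    case (Cons z xs')
    let ?K = "\<lambda>\<phi> a b. deconc (\<lambda>c d. block_sum (\<lambda>as. block_sum (\<lambda>ds. \<phi> (as @ f (b @ x # c) # ds)) f d) f a) ys"
    have "block_sum \<phi> f (xs @ x # ys) =
        deconc (\<lambda>a b. block_sum (\<lambda>ys. \<phi> (f (z # a) # ys)) f (b @ x # ys)) xs'
        + deconc (\<lambda>a b. block_sum (\<lambda>ys. \<phi> (f (z # xs' @ x # a) # ys)) f b) ys"
      by (simp add: Cons block_sum_Cons deconc_append_Cons)
    also have "deconc (\<lambda>a b. block_sum (\<lambda>ys. \<phi> (f (z # a) # ys)) f (b @ x # ys)) xs' =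
        deconc (\<lambda>a b. deconc (?K (\<lambda>ys. \<phi> (f (z # a) # ys))) b) xs'"
    proof (intro deconc_cong refl)
      fix a b assume "a @ b = xs'"
      then have "length b < length xs"
        by (auto simp: Cons)
      then show "block_sum (\<lambda>ys. \<phi> (f (z # a) # ys)) f (b @ x # ys) =
          deconc (?K (\<lambda>ys. \<phi> (f (z # a) # ys))) b"
        using 1 by blast
    qed
    also have "\<dots> = deconc (\<lambda>a b. ?K \<phi> (z # a) b) xs'"
    proof -
      have swap: "deconc (\<lambda>a b. deconc (\<psi> a b) ys) a = deconc (\<lambda>c d. deconc (\<lambda>a b. \<psi> a b c d) a) ys"
        for \<psi> :: "_ \<Rightarrow> _ \<Rightarrow> _ \<Rightarrow> _ \<Rightarrow> 'c" and a
        unfolding deconc_eq_sum by (rule sum.swap)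
      show ?thesis
        by (subst deconc_coassoc) (simp add: block_sum_Cons swap)
    qed
    finally show ?thesis
      by (simp add: Cons add.commute)
  qed
qed

section \<open>A basis of the algebra\<close>

fun next_arrow :: "arrow \<Rightarrow> arrow" where
  "next_arrow Arrow1 = Arrow2"
| "next_arrow Arrow2 = Arrow3"
| "next_arrow Arrow3 = Arrow4"
| "next_arrow Arrow4 = Arrow1"

abbreviation ascending :: "arrow list \<Rightarrow> bool" where
  "ascending \<equiv> successively (\<lambda>a b. b = next_arrow a)"

abbreviation descending :: "arrow list \<Rightarrow> bool" where
  "descending \<equiv> successively (\<lambda>a b. a = next_arrow b)"

lemma source_next_arrow [simp]: "source (next_arrow a) = target a"
  by (cases a) auto

lemma target_next_arrow: "target (next_arrow a) = source a"
  by (cases a) auto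

lemma next_arrow_neq [simp]:
  "next_arrow (next_arrow a) \<noteq> a" "a \<noteq> next_arrow (next_arrow a)"
  by (cases a; simp)+

text \<open>This is why the algebra is monomial with a basis of ascending paths: of the two continuations of an
arrow, one is its successor and the other one gives a relation.\<close>

lemma composable_arrows: "target a = source b \<Longrightarrow> b = next_arrow a \<or> a = next_arrow b"
  by (cases a; cases b) auto

lemma ascending_is_path: "ascending es \<Longrightarrow> es \<noteq> [] \<Longrightarrow> is_path (source (hd es)) es"
proof (induction es)
  case (Cons a es)
  then show ?case by (cases es) auto
qed simp

lemma is_path_source: "is_path v es \<Longrightarrow> es \<noteq> [] \<Longrightarrow> v = source (hd es)"
  by (cases es) auto

lemma not_successively:
  assumes "\<not> successively P xs"
  shows "\<exists>as a b bs. xs = as @ a # b # bs \<and> \<not> P a b"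
  using assms
proof (induction xs)
  case (Cons x xs)
  show ?case
  proof (cases "successively P xs")
    case True
    then obtain y ys where "xs = y # ys" "\<not> P x y"
      using Cons.prems by (cases xs) auto
    then show ?thesis
      by (intro exI[of _ "[]"]) auto
  next
    case False
    then obtain as a b bs where "xs = as @ a # b # bs" "\<not> P a b"
      using Cons.IH by blast
    then show ?thesis
      by (intro exI[of _ "x # as"]) auto
  qed
qed simp

lemma bit_double: "(b :: bit) + b = 0"
  by (cases b) auto

lemma path_algebra_double: "(x :: path_algebra) + x = 0"
  by (rule path_algebra_eqI) (simp add: coefficient_add coefficient_zero bit_double)

lemma torus_algebra_double: "(x :: torus_algebra) + x = 0"
proof (induction x rule: torus_algebra.abs_induct)
  case (1 y)
  have "to_torus_algebra y + to_torus_algebra y = to_torus_algebra (y + y)"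
    by (simp add: plus_torus_algebra.abs_eq)
  then show ?case
    by (simp add: path_algebra_double zero_torus_algebra_def)
qed

lemma double [simp]: "(x :: torus_algebra_U) + x = 0"
  by (rule poly_mapping_eqI) (simp add: lookup_add torus_algebra_double)

lemma double_left [simp]: "(x :: torus_algebra_U) + (x + y) = y"
  by (simp add: add.assoc[symmetric])

lemma eq_iff_add_eq_0: "(x :: torus_algebra_U) = y \<longleftrightarrow> x + y = 0"
  by (metis add.commute double_left add_0_right)

text \<open>Every path in the support of \<open>a * r * b\<close> contains one of the forbidden pairs of consecutive arrows, so
the ideal meets the span of the ascending paths only in zero. Hence the coefficients at ascending paths
are well defined on the quotient.\<close>

lemma coefficient_relation_ideal:
  assumes "x \<in> relation_ideal" "ascending es"
  shows "coefficient x (v, es) = 0"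
  using assms
proof (induction arbitrary: v rule: relation_ideal.induct)
  case zero
  show ?case by (rule coefficient_zero)
next
  case (add x y)
  then show ?case by (simp add: coefficient_add)
next
  case (gen r a b)
  have r: "coefficient r (w, fs) = 0" if "ascending fs" for w fs
    using gen.hyps that
    by (auto simp: relations_def arrow_elem_def path_mult coefficient_path)
  have r': "coefficient r (w, take k (drop j es)) = 0" for w k j
    using gen.prems by (intro r)
      (metis append_take_drop_id successively_append_iff)
  have ar: "coefficient (a * r) (w, take k es) = 0" for w k
    unfolding coefficient_times by (simp only: drop_take r' mult_zero_right sum.neutral_const)
  show ?case
    unfolding coefficient_times[of "a * r"] by (simp only: ar mult_zero_left sum.neutral_const)
qed

lift_definition basis_coefficient :: "torus_algebra \<Rightarrow> vertex \<times> arrow list \<Rightarrow> bit" is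
  "\<lambda>x (v, es). if ascending es then coefficient x (v, es) else 0"
proof (intro ext, clarify)
  fix x y v es
  assume "relation_congruent x y"
  then have "ascending es \<Longrightarrow> coefficient (x - y) (v, es) = 0"
    unfolding relation_congruent_def by (rule coefficient_relation_ideal)
  then have "ascending es \<Longrightarrow> coefficient x (v, es) = coefficient y (v, es)"
    by (simp only: coefficient_diff right_minus_eq)
  then show "(if ascending es then coefficient x (v, es) else 0) =
      (if ascending es then coefficient y (v, es) else 0)"
    by (simp only: cong: if_cong)
qed

abbreviation path_class :: "vertex \<Rightarrow> arrow list \<Rightarrow> torus_algebra" where
  "path_class v es \<equiv> to_torus_algebra (path v es)"

lemma path_class_mult:
  "is_path v es \<Longrightarrow> is_path w fs \<Longrightarrow>
    path_class v es * path_class w fs = (if path_end v es = w then path_class v (es @ fs) else 0)"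
  by (simp add: times_torus_algebra.abs_eq path_mult zero_torus_algebra_def)

lemma path_class_eq_0:
  assumes "is_path v es" "\<not> ascending es"
  shows "path_class v es = 0"
proof -
  have "\<exists>xs a b ys. es = xs @ a # b # ys \<and> b \<noteq> next_arrow a"
    using not_successively[OF assms(2)] by blast
  then obtain xs a b ys where es: "es = xs @ [a, b] @ ys" and ab: "b \<noteq> next_arrow a"
    by auto
  have v: "is_path v xs" "source a = path_end v xs" "source b = target a" "is_path (target b) ys"
    using assms(1) by (auto simp: es is_path_append)
  have "a = next_arrow b"
    using composable_arrows[of a b] ab v(3) by simp
  then have "arrow_elem a * arrow_elem b \<in> relations"
    by (cases b) (auto simp: relations_def)
  then have "path v xs * (arrow_elem a * arrow_elem b) * path (target b) ys \<in> relation_ideal"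
    by (rule relation_ideal.gen)
  also have "path v xs * (arrow_elem a * arrow_elem b) * path (target b) ys = path v es"
    using v by (simp add: arrow_elem_def path_mult is_path_append path_end_append es)
  finally show ?thesis
    by (simp add: zero_torus_algebra_def torus_algebra.abs_eq_iff relation_congruent_def)
qed

lemma basis_coefficient_add:
  "basis_coefficient (x + y) p = basis_coefficient x p + basis_coefficient y p"
  by transfer (auto simp: coefficient_add split: prod.splits)

lemma basis_coefficient_0: "basis_coefficient 0 p = 0"
  by transfer (auto simp: coefficient_zero split: prod.splits)

lemma basis_coefficient_path_class:
  "is_path v es \<Longrightarrow> ascending es \<Longrightarrow>
    basis_coefficient (path_class v es) p = (if p = (v, es) then 1 else 0)"
  by (cases p) (auto simp: basis_coefficient.abs_eq coefficient_path)

definition monomial :: "nat \<Rightarrow> vertex \<Rightarrow> arrow list \<Rightarrow> torus_algebra_U" where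
  "monomial k v es = Poly_Mapping.single k (path_class v es)"

lemma monomial_mult:
  "is_path v es \<Longrightarrow> is_path w fs \<Longrightarrow>
    monomial k v es * monomial l w fs =
      (if path_end v es = w then monomial (k + l) v (es @ fs) else 0)"
  by (simp add: monomial_def mult_single path_class_mult)

lemma monomial_eq_0: "is_path v es \<Longrightarrow> \<not> ascending es \<Longrightarrow> monomial k v es = 0"
  by (simp add: monomial_def path_class_eq_0)

lemma path_algebra_induct [case_names zero add path]:
  assumes "P 0" "\<And>x y. P x \<Longrightarrow> P y \<Longrightarrow> P (x + y)" "\<And>v es. is_path v es \<Longrightarrow> P (path v es)"
  shows "P (x :: path_algebra)"
proof -
  have fin: "finite {p. coefficient x p \<noteq> 0}"
    using coefficient[of x] by simp
  define n where "n = card {p. coefficient x p \<noteq> 0}"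
  then show ?thesis
    using fin
  proof (induction n arbitrary: x)
    case 0
    then have "x = 0"
      by (intro path_algebra_eqI) (simp add: coefficient_zero)
    then show ?case using assms(1) by simp
  next
    case (Suc n)
    then obtain v es where p: "coefficient x (v, es) \<noteq> 0"
      by (metis (mono_tags, lifting) Collect_empty_eq card.empty nat.distinct(1) surj_pair)
    then have path: "is_path v es"
      using coefficient[of x] by auto
    have one: "coefficient x (v, es) = 1"
      using p by (cases "coefficient x (v, es)") auto
    have "{p. coefficient (x + path v es) p \<noteq> 0} = {p. coefficient x p \<noteq> 0} - {(v, es)}"
      using path one by (auto simp: coefficient_add coefficient_path bit_double split: if_splits)
    then have "P (x + path v es)"
      using Suc p by (intro Suc.IH) (auto simp: card_Diff_singleton)
    then have "P (x + path v es + path v es)"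
      using assms path by blast
    then show ?case
      by (simp add: add.assoc path_algebra_double)
  qed
qed

lemma torus_algebra_induct [case_names zero add path]:
  assumes "P 0" "\<And>x y. P x \<Longrightarrow> P y \<Longrightarrow> P (x + y)"
    "\<And>v es. is_path v es \<Longrightarrow> ascending es \<Longrightarrow> P (path_class v es)"
  shows "P (x :: torus_algebra)"
proof (induction x rule: torus_algebra.abs_induct)
  case (1 y)
  show ?case
  proof (induction y rule: path_algebra_induct)
    case zero
    then show ?case using assms(1) by (simp add: zero_torus_algebra_def)
  next
    case (add x y)
    then show ?case using assms(2) by (metis plus_torus_algebra.abs_eq)
  next
    case (path v es)
    then show ?case using assms(1,3) path_class_eq_0 by metis
  qed
qed

text \<open>Additive statements about \<open>A[U]\<close> only have to be checked on the monomials \<open>U\<^sup>k p\<close> with \<open>p\<close> ascending.\<close>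

lemma monomial_induct [case_names zero add monomial]:
  assumes zero: "P 0" and add: "\<And>x y. P x \<Longrightarrow> P y \<Longrightarrow> P (x + y)"
    and mono: "\<And>k v es. is_path v es \<Longrightarrow> ascending es \<Longrightarrow> P (monomial k v es)"
  shows "P (x :: torus_algebra_U)"
proof -
  have single: "P (Poly_Mapping.single k a)" for k a
    by (induction a rule: torus_algebra_induct)
      (auto simp: zero single_add intro: add mono[unfolded monomial_def])
  have "P (\<Sum>k\<in>A. Poly_Mapping.single k (Poly_Mapping.lookup x k))" for A
    by (induction A rule: infinite_finite_induct) (auto intro: zero add single)
  moreover have "(\<Sum>k\<in>Poly_Mapping.keys x. Poly_Mapping.single k (Poly_Mapping.lookup x k)) = x"
    by (rule poly_mapping_eqI) (simp add: lookup_sum lookup_single when_def in_keys_iff)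
  ultimately show ?thesis
    by metis
qed

definition support :: "torus_algebra_U \<Rightarrow> (nat \<times> vertex \<times> arrow list) set" where
  "support x = {(k, v, es). basis_coefficient (Poly_Mapping.lookup x k) (v, es) \<noteq> 0}"

lemma support_0 [simp]: "support 0 = {}"
  by (simp add: support_def basis_coefficient_0)

lemma support_add: "support (x + y) = (support x - support y) \<union> (support y - support x)"
proof -
  have "(a + b \<noteq> 0) = ((a \<noteq> 0) \<noteq> (b \<noteq> 0))" for a b :: bit
    by (cases a; cases b) auto
  then show ?thesis
    by (auto simp: support_def lookup_add basis_coefficient_add)
qed

lemma support_monomial:
  "is_path v es \<Longrightarrow> ascending es \<Longrightarrow> support (monomial k v es) = {(k, v, es)}"
  by (auto simp: support_def monomial_def lookup_single when_def basis_coefficient_path_class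
      basis_coefficient_0 split: if_splits)

lemma finite_support: "finite (support x)"
  by (induction x rule: monomial_induct) (auto simp: support_add support_monomial)

lemma support_basis: "(k, v, es) \<in> support x \<Longrightarrow> is_path v es \<and> ascending es"
  by (induction x rule: monomial_induct) (auto simp: support_add support_monomial)

text \<open>Over the field with two elements an element of \<open>A[U]\<close> is determined by its finite support, and linear extension is
summation over the support.\<close>

definition linear_extension ::
  "(nat \<Rightarrow> vertex \<Rightarrow> arrow list \<Rightarrow> torus_algebra_U) \<Rightarrow> torus_algebra_U \<Rightarrow> torus_algebra_U" where
  "linear_extension g x = (\<Sum>(k, v, es)\<in>support x. g k v es)"

lemma hom_add_linear_extension: "hom_add (linear_extension g)"
  unfolding hom_add_def
proof (intro conjI allI)
  fix x y
  let ?g = "\<lambda>(k, v, es). g k v es"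
  have fin: "finite (support x)" "finite (support y)"
    by (rule finite_support)+
  have "sum ?g (support x) = sum ?g (support x \<inter> support y) + sum ?g (support x - support y)"
    "sum ?g (support y) = sum ?g (support x \<inter> support y) + sum ?g (support y - support x)"
    by (metis fin sum.Int_Diff Int_commute)+
  moreover have "sum ?g (support (x + y)) =
      sum ?g (support x - support y) + sum ?g (support y - support x)"
    unfolding support_add by (rule sum.union_disjoint) (use fin in auto)
  ultimately show "linear_extension g (x + y) = linear_extension g x + linear_extension g y"
    unfolding linear_extension_def by (simp add: algebra_simps)
qed (simp add: linear_extension_def)

lemma linear_extension_monomial:
  "is_path v es \<Longrightarrow> ascending es \<Longrightarrow> linear_extension g (monomial k v es) = g k v es"
  by (simp add: linear_extension_def support_monomial)

lemma linear_extension_support: "linear_extension (\<lambda>k v es. monomial k v es) x = x"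
proof (induction x rule: monomial_induct)
  case (add x y)
  then show ?case
    using hom_add_linear_extension by (simp add: hom_add_def)
qed (simp_all add: linear_extension_monomial, simp add: linear_extension_def)

lemma support_eq_empty: "support x = {} \<Longrightarrow> x = 0"
  using linear_extension_support[of x] by (simp add: linear_extension_def)

definition U_pow :: "nat \<Rightarrow> torus_algebra_U" where
  "U_pow k = Poly_Mapping.single k 1"

lemma U_pow_eq: "U_pow k = monomial k Vertex0 [] + monomial k Vertex1 []"
  unfolding monomial_def single_add[symmetric] U_pow_def plus_torus_algebra.abs_eq
    one_path_algebra_def[symmetric] one_torus_algebra_def[symmetric] by (rule refl)

lemma U_pow_monomial: "is_path v es \<Longrightarrow> U_pow k * monomial l v es = monomial (k + l) v es"
  by (simp add: U_pow_def monomial_def mult_single)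

lemma U_pow_central: "U_pow k * x = x * U_pow k"
proof (induction x rule: monomial_induct)
  case (monomial l v es)
  then show ?case
    by (simp add: U_pow_def monomial_def mult_single add.commute)
qed (simp_all add: algebra_simps)

lemma U_pow_add: "U_pow (k + l) = U_pow k * U_pow l"
  by (simp add: U_pow_def mult_single)

lemma U_pow_0: "U_pow 0 = 1"
  by (simp add: U_pow_def)

lemma one_eq_monomials: "(1 :: torus_algebra_U) = monomial 0 Vertex0 [] + monomial 0 Vertex1 []"
  using U_pow_eq[of 0] by (simp add: U_pow_0)

section \<open>Multilinear cochains\<close>

type_synonym cochain = "torus_algebra_U list \<Rightarrow> torus_algebra_U"

abbreviation idem :: "vertex \<Rightarrow> torus_algebra_U" where
  "idem v \<equiv> monomial 0 v []"

lemma const_iota: "const iota0 = idem Vertex0" "const iota1 = idem Vertex1"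
  by (simp_all add: const_def iota0_def iota1_def monomial_def)

text \<open>The ground ring is spanned by the \<open>U\<^sup>k \<iota>\<close>, so that multilinearity can be tested on these scalars.\<close>

lemma ground_U_induct [consumes 1, case_names zero add monomial]:
  assumes c: "c \<in> ground_U" and zero: "P 0" and add: "\<And>x y. P x \<Longrightarrow> P y \<Longrightarrow> P (x + y)"
    and mono: "\<And>k v. P (monomial k v [])"
  shows "P c"
proof -
  have single: "P (Poly_Mapping.single k (Poly_Mapping.lookup c k))" for k
  proof -
    have "Poly_Mapping.lookup c k \<in> {0, iota0, iota1, iota0 + iota1}"
      using c by (simp add: ground_U_def)
    then show ?thesis
      using zero mono[of k Vertex0] mono[of k Vertex1]
        add[OF mono[of k Vertex0] mono[of k Vertex1]]
      by (auto simp: single_add monomial_def iota0_def iota1_def)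
  qed
  have "P (\<Sum>k\<in>A. Poly_Mapping.single k (Poly_Mapping.lookup c k))" for A
    by (induction A rule: infinite_finite_induct) (auto intro: zero add single)
  moreover have "(\<Sum>k\<in>Poly_Mapping.keys c. Poly_Mapping.single k (Poly_Mapping.lookup c k)) = c"
    by (rule poly_mapping_eqI) (simp add: lookup_sum lookup_single when_def in_keys_iff)
  ultimately show ?thesis
    by metis
qed

lemma monomial_ground_U [simp]: "monomial k v [] \<in> ground_U"
  by (cases v) (auto simp: ground_U_def monomial_def lookup_single when_def iota0_def iota1_def)

lemma U_pow_ground_U [simp]: "U_pow k \<in> ground_U"
proof -
  have "1 = iota0 + iota1"
    by (simp only: iota0_def iota1_def plus_torus_algebra.abs_eq one_torus_algebra_def
        one_path_algebra_def)
  then show ?thesis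
    by (auto simp: ground_U_def U_pow_def lookup_single when_def)
qed

lemma multilinear_additive:
  assumes "multilinear f"
  shows "slot_additive f"
proof -
  have add: "f (xs @ (x + y) # ys) = f (xs @ x # ys) + f (xs @ y # ys)" for xs x y ys
    using assms by (simp add: multilinear_def)
  have "f (xs @ 0 # ys) = 0" for xs ys
    using add[of xs 0 0 ys] by simp
  then show ?thesis
    using add by (simp add: slot_additive_def hom_add_def)
qed

lemma multilinear_left: "multilinear f \<Longrightarrow> c \<in> ground_U \<Longrightarrow> f ((c * x) # xs) = c * f (x # xs)"
  by (simp add: multilinear_def)

lemma multilinear_right: "multilinear f \<Longrightarrow> c \<in> ground_U \<Longrightarrow> f (xs @ [x * c]) = f (xs @ [x]) * c"
  by (simp add: multilinear_def)

lemma multilinear_middle: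
  "multilinear f \<Longrightarrow> c \<in> ground_U \<Longrightarrow> f (xs @ (x * c) # y # ys) = f (xs @ x # (c * y) # ys)"
  by (simp add: multilinear_def)

lemma multilinearI:
  assumes add: "slot_additive f"
    and left: "\<And>k v x xs. f ((monomial k v [] * x) # xs) = monomial k v [] * f (x # xs)"
    and right: "\<And>k v x xs. f (xs @ [x * monomial k v []]) = f (xs @ [x]) * monomial k v []"
    and middle: "\<And>k v x y xs ys.
      f (xs @ (x * monomial k v []) # y # ys) = f (xs @ x # (monomial k v [] * y) # ys)"
  shows "multilinear f"
proof -
  note zero = slot_additive_0[OF add]
  have plus: "f (xs @ (x + y) # ys) = f (xs @ x # ys) + f (xs @ y # ys)" for xs x y ys
    using add by (simp add: slot_additive_def hom_add_def)
  have "f ((c * x) # xs) = c * f (x # xs)" if "c \<in> ground_U" for c x xs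
    using that by (induction c rule: ground_U_induct)
      (use zero[of "[]"] plus[of "[]"] in \<open>simp_all add: left distrib_right\<close>)
  moreover have "f (xs @ [x * c]) = f (xs @ [x]) * c" if "c \<in> ground_U" for c x xs
    using that by (induction c rule: ground_U_induct)
      (simp_all add: right zero plus distrib_left)
  moreover have "f (xs @ (x * c) # y # ys) = f (xs @ x # (c * y) # ys)" if "c \<in> ground_U" for c x y xs ys
    using that by (induction c rule: ground_U_induct)
      (use zero[of "xs @ [x]"] plus[of "xs @ [x]"] in
        \<open>simp_all add: middle zero plus distrib_left distrib_right\<close>)
  ultimately show ?thesis
    by (simp add: multilinear_def plus)
qed

text \<open>Powers of \<open>U\<close> are central, hence can be passed from argument to argument to the left end.\<close>

lemma multilinear_U_pow:
  assumes "multilinear f"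
  shows "f (xs @ (U_pow k * x) # ys) = U_pow k * f (xs @ x # ys)"
proof (induction xs arbitrary: x ys rule: rev_induct)
  case Nil
  then show ?case using multilinear_left[OF assms] by simp
next
  case (snoc z xs)
  have "f (xs @ z # (U_pow k * x) # ys) = f (xs @ (U_pow k * z) # x # ys)"
    using multilinear_middle[OF assms] U_pow_central by (metis U_pow_ground_U)
  then show ?case
    by (simp add: snoc.IH)
qed

definition multiply :: cochain where
  "multiply xs = (case xs of [x, y] \<Rightarrow> x * y | _ \<Rightarrow> 0)"

lemma multilinear_add: "multilinear f \<Longrightarrow> multilinear g \<Longrightarrow> multilinear (\<lambda>xs. f xs + g xs)"
  by (simp add: multilinear_def algebra_simps)

lemma hom_add_mult_left: "hom_add (\<lambda>y. (c :: 'a::semiring_0) * y)"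
  by (simp add: hom_add_def distrib_left)

lemma hom_add_mult_right: "hom_add (\<lambda>y. y * (c :: 'a::semiring_0))"
  by (simp add: hom_add_def distrib_right)

lemma slot_additive_insertion_sum:
  fixes f :: "'a::ab_group_add list \<Rightarrow> 'b::ab_group_add"
  assumes f: "slot_additive f" and g: "slot_additive g"
  shows "slot_additive (insertion_sum f g)"
proof -
  have add: "f (a @ (x + y) # b) = f (a @ x # b) + f (a @ y # b)"
    "g (c @ (x + y) # d) = g (c @ x # d) + g (c @ y # d)" for a b c d x y
    using f g by (simp_all add: slot_additive_def hom_add_def)
  have "insertion_sum f g (xs @ (x + y) # ys) =
      insertion_sum f g (xs @ x # ys) + insertion_sum f g (xs @ y # ys)" for xs x y ys
    by (simp add: insertion_sum_mid add insertion_sum_add_left deconc_add algebra_simps)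
  moreover from this[of _ 0 0] have "insertion_sum f g (xs @ 0 # ys) = 0" for xs ys
    by simp
  ultimately show ?thesis
    by (simp add: slot_additive_def hom_add_def)
qed

lemma slot_additive_block_sum:
  fixes f :: "'b::ab_group_add list \<Rightarrow> 'c::ab_group_add" and g :: "'a::ab_group_add list \<Rightarrow> 'b"
  assumes f: "slot_additive f" and g: "slot_additive g"
  shows "slot_additive (block_sum f g)"
proof -
  have add: "f (a @ (x + y) # b) = f (a @ x # b) + f (a @ y # b)" for a b x y
    using f by (simp add: slot_additive_def hom_add_def)
  have add': "g (c @ (x + y) # d) = g (c @ x # d) + g (c @ y # d)" for c d x y
    using g by (simp add: slot_additive_def hom_add_def)
  have "block_sum f g (xs @ (x + y) # ys) =
      block_sum f g (xs @ x # ys) + block_sum f g (xs @ y # ys)" for xs x y ys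
    by (simp add: block_sum_mid add add' block_sum_add deconc_add)
  moreover from this[of _ 0 0] have "block_sum f g (xs @ 0 # ys) = 0" for xs ys
    by simp
  ultimately show ?thesis
    by (simp add: slot_additive_def hom_add_def)
qed

text \<open>Balancing in neighbouring arguments \<open>x, y\<close> is checked on the four positions of the window relative to
them; if it ends at \<open>x\<close> or starts at \<open>y\<close>, the scalar moves through the inner operation first.\<close>

lemma multilinear_insertion_sum:
  assumes f: "multilinear f" and g: "multilinear g"
  shows "multilinear (insertion_sum f g)"
proof (rule multilinearI)
  show "slot_additive (insertion_sum f g)"
    by (intro slot_additive_insertion_sum multilinear_additive f g)
  fix k v x xs
  let ?c = "monomial k v []"
  show "insertion_sum f g ((?c * x) # xs) = ?c * insertion_sum f g (x # xs)"
    by (simp add: insertion_sum_Cons multilinear_left f g distrib_left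
        hom_add_deconc[OF hom_add_mult_left] hom_add_insertion[OF hom_add_mult_left])
  show "insertion_sum f g (xs @ [x * ?c]) = insertion_sum f g (xs @ [x]) * ?c"
    by (simp add: insertion_sum_mid multilinear_right f g distrib_right
        hom_add_deconc[OF hom_add_mult_right] hom_add_insertion[OF hom_add_mult_right])
  fix y ys
  have 1: "f (a @ g (b @ [x * ?c]) # y # ys) = f (a @ g (b @ [x]) # (?c * y) # ys)" for a b
    by (simp add: multilinear_right multilinear_middle f g)
  have 2: "f (a @ g (b @ (x * ?c) # y # c) # d) = f (a @ g (b @ x # (?c * y) # c) # d)" for a b c d
    by (simp add: multilinear_middle g)
  have 3: "f (xs @ (x * ?c) # g (y # a) # b) = f (xs @ x # g ((?c * y) # a) # b)" for a b
    by (simp add: multilinear_middle multilinear_left f g)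
  show "insertion_sum f g (xs @ (x * ?c) # y # ys) = insertion_sum f g (xs @ x # (?c * y) # ys)"
    by (simp add: insertion_sum_mid insertion_sum_Cons 1 2 3 multilinear_middle[OF f])
qed

lemma multilinear_block_sum:
  assumes f: "multilinear f" and g: "multilinear g"
  shows "multilinear (block_sum f g)"
proof (rule multilinearI)
  show "slot_additive (block_sum f g)"
    by (intro slot_additive_block_sum multilinear_additive f g)
  fix k v x xs
  let ?c = "monomial k v []"
  show "block_sum f g ((?c * x) # xs) = ?c * block_sum f g (x # xs)"
    by (simp add: block_sum_Cons multilinear_left f g
        hom_add_deconc[OF hom_add_mult_left] hom_add_block_sum[OF hom_add_mult_left])
  show "block_sum f g (xs @ [x * ?c]) = block_sum f g (xs @ [x]) * ?c"
    by (simp add: block_sum_mid multilinear_right f g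
        hom_add_deconc[OF hom_add_mult_right] hom_add_block_sum[OF hom_add_mult_right])
  fix y ys
  show "block_sum f g (xs @ (x * ?c) # y # ys) = block_sum f g (xs @ x # (?c * y) # ys)"
    by (simp add: block_sum_mid block_sum_Cons multilinear_right multilinear_left
        multilinear_middle f g)
qed

abbreviation chord :: "arrow list \<Rightarrow> torus_algebra_U" where
  "chord es \<equiv> monomial 0 (source (hd es)) es"

abbreviation chord_word :: "arrow list list \<Rightarrow> bool" where
  "chord_word ws \<equiv> \<forall>w\<in>set ws. w \<noteq> [] \<and> ascending w"

abbreviation composable :: "arrow list list \<Rightarrow> bool" where
  "composable \<equiv> successively (\<lambda>a b. target (last a) = source (hd b))"

lemma path_end_last: "path_end v es = (if es = [] then v else target (last es))"
  by (induction v es rule: path_end.induct) auto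

lemma chord_mult:
  assumes "a \<noteq> []" "ascending a" "b \<noteq> []" "ascending b"
  shows "chord a * chord b = (if ascending (a @ b) then chord (a @ b) else 0)"
proof (cases "target (last a) = source (hd b)")
  case True
  then have "is_path (source (hd a)) (a @ b)"
    using assms by (simp add: is_path_append ascending_is_path path_end_last)
  then show ?thesis
    using assms True by (simp add: monomial_mult ascending_is_path path_end_last monomial_eq_0)
next
  case False
  then have "\<not> ascending (a @ b)"
    using assms by (auto simp: successively_append_iff)
  then show ?thesis
    using assms False by (simp add: monomial_mult ascending_is_path path_end_last)
qed

lemma idem_chord: "a \<noteq> [] \<Longrightarrow> ascending a \<Longrightarrow> idem v * chord a = (if v = source (hd a) then chord a else 0)"
  by (simp add: monomial_mult ascending_is_path)

lemma chord_idem: "a \<noteq> [] \<Longrightarrow> ascending a \<Longrightarrow> chord a * idem v = (if v = target (last a) then chord a else 0)"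
  by (auto simp: monomial_mult ascending_is_path path_end_last)

lemma multilinear_not_composable:
  assumes f: "multilinear f" and ws: "chord_word ws" "\<not> composable ws"
  shows "f (map chord ws) = 0"
proof -
  obtain xs a b ys where w: "ws = xs @ a # b # ys" "target (last a) \<noteq> source (hd b)"
    using not_successively[OF ws(2)] by blast
  then have ab: "a \<noteq> []" "ascending a" "b \<noteq> []" "ascending b"
    using ws(1) by auto
  let ?c = "idem (target (last a))"
  have "f (map chord ws) = f (map chord xs @ (chord a * ?c) # chord b # map chord ys)"
    using ab by (simp add: w chord_idem)
  also have "\<dots> = f (map chord xs @ chord a # (?c * chord b) # map chord ys)"
    by (rule multilinear_middle[OF f]) simp
  also have "\<dots> = f ((map chord xs @ [chord a]) @ 0 # map chord ys)"
    using ab w(2) by (simp add: idem_chord)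
  also have "\<dots> = 0"
    by (rule slot_additive_0[OF multilinear_additive[OF f]])
  finally show ?thesis .
qed


definition unital_on :: "nat \<Rightarrow> cochain \<Rightarrow> bool" where
  "unital_on n f \<longleftrightarrow> (\<forall>xs. length xs = n \<and> 1 \<in> set xs \<longrightarrow> f xs = 0)"

lemma unital_onD: "unital_on n f \<Longrightarrow> length (xs @ 1 # ys) = n \<Longrightarrow> f (xs @ 1 # ys) = 0"
  by (auto simp: unital_on_def)

text \<open>An idempotent entry is a unit whose idempotent can be moved to the neighbour on its left, or out of
the operation if there is none.\<close>

lemma unital_on_idem:
  assumes f: "multilinear f" and u: "unital_on n f" and n: "length (xs @ idem v # ys) = n"
  shows "f (xs @ idem v # ys) = 0"
proof (cases xs rule: rev_cases)
  case Nil
  have "f ((idem v * 1) # ys) = idem v * f (1 # ys)"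
    by (rule multilinear_left[OF f]) simp
  then show ?thesis
    using unital_onD[OF u, of "[]" ys] n Nil by simp
next
  case (snoc xs' x)
  have "f (xs' @ x # (idem v * 1) # ys) = f (xs' @ (x * idem v) # 1 # ys)"
    by (rule multilinear_middle[OF f, symmetric]) simp
  also have "\<dots> = 0"
    using unital_onD[OF u, of "xs' @ [x * idem v]" ys] n snoc by simp
  finally show ?thesis
    by (simp add: snoc)
qed

text \<open>Expanding the arguments from left to right into monomials leaves words of chords and idempotents;
  the latter are excluded by normalization, and words that are not composable by balancing.\<close>

lemma multilinear_eq_0:
  assumes f: "multilinear f" and u: "unital_on n f"
    and words: "\<And>ws. chord_word ws \<Longrightarrow> composable ws \<Longrightarrow> length ws = n \<Longrightarrow> f (map chord ws) = 0"
    and n: "length xs = n"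
  shows "f xs = 0"
proof -
  have "f (map chord ws @ xs) = 0" if "chord_word ws" "length ws + length xs = n" for ws xs
    using that
  proof (induction xs arbitrary: ws)
    case Nil
    then show ?case
      using words[of ws] multilinear_not_composable[OF f, of ws] by (cases "composable ws") auto
  next
    case (Cons x xs)
    show ?case
    proof (induction x rule: monomial_induct)
      case zero
      show ?case by (rule slot_additive_0[OF multilinear_additive[OF f]])
    next
      case (add x y)
      then show ?case
        using multilinear_additive[OF f] by (simp add: slot_additive_def hom_add_def)
    next
      case (monomial k v es)
      have "f (map chord ws @ monomial 0 v es # xs) = 0"
      proof (cases "es = []")
        case True
        then show ?thesis
          using unital_on_idem[OF f u] Cons.prems by simp
      next
        case False
        then have "v = source (hd es)"
          using monomial is_path_source by blast
        then show ?thesis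
          using Cons.IH[of "ws @ [es]"] Cons.prems monomial False by auto
      qed
      then have "f (map chord ws @ (U_pow k * monomial 0 v es) # xs) = 0"
        using multilinear_U_pow[OF f] by simp
      then show ?case
        using monomial by (simp add: U_pow_monomial)
    qed
  qed
  from this[of "[]" xs] n show ?thesis by simp
qed

section \<open>Cochains prescribed on words of chords\<close>

text \<open>The normalized \<open>U\<close>-linear extension of a function on words of chords: the terms of an argument that lie
in the ground ring are dropped.\<close>

fun word_extension :: "(arrow list list \<Rightarrow> torus_algebra_U) \<Rightarrow> cochain" where
  "word_extension W [] = W []"
| "word_extension W (x # xs) =
    linear_extension (\<lambda>k v es. if es = [] then 0 else U_pow k * word_extension (\<lambda>ws. W (es # ws)) xs) x"

lemma linear_extension_cong:
  assumes "\<And>k v es. is_path v es \<Longrightarrow> ascending es \<Longrightarrow> g k v es = h k v es"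
  shows "linear_extension g x = linear_extension h x"
  unfolding linear_extension_def
  by (intro sum.cong refl) (use support_basis in \<open>auto intro!: assms\<close>)

lemma hom_add_linear_extension_param:
  assumes "\<And>k v es. hom_add (\<lambda>x. g x k v es)"
  shows "hom_add (\<lambda>x. linear_extension (g x) z)"
  using assms by (simp add: hom_add_def linear_extension_def sum.distrib split_def)

lemma hom_add_comp_linear_extension:
  "hom_add h \<Longrightarrow> h (linear_extension g x) = linear_extension (\<lambda>k v es. h (g k v es)) x"
  by (simp add: linear_extension_def hom_add_sum split_def)

lemma word_extension_cong:
  assumes "\<And>ws. chord_word ws \<Longrightarrow> length ws = length xs \<Longrightarrow> W ws = V ws"
  shows "word_extension W xs = word_extension V xs"
  using assms
proof (induction xs arbitrary: W V)
  case (Cons x xs)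
  have "word_extension (\<lambda>ws. W (es # ws)) xs = word_extension (\<lambda>ws. V (es # ws)) xs"
    if "es \<noteq> []" "ascending es" for es
    using that by (intro Cons.IH Cons.prems) auto
  then show ?case
    by (auto intro!: linear_extension_cong)
qed simp

lemma word_extension_zero: "word_extension (\<lambda>_. 0) xs = 0"
  by (induction xs) (simp_all add: linear_extension_def cong: if_cong)

lemma word_extension_eq_0:
  "(\<And>ws. chord_word ws \<Longrightarrow> length ws = length xs \<Longrightarrow> W ws = 0) \<Longrightarrow> word_extension W xs = 0"
  using word_extension_cong[of xs W "\<lambda>_. 0"] word_extension_zero by simp

lemma slot_additive_word_extension: "slot_additive (word_extension W)"
proof -
  have "hom_add (\<lambda>x. word_extension W (xs @ x # ys))" for xs ys
  proof (induction xs arbitrary: W)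
    case Nil
    show ?case by (simp add: hom_add_linear_extension)
  next
    case (Cons z xs)
    have "hom_add (\<lambda>x. if es = [] then 0 else U_pow k * word_extension (\<lambda>ws. W (es # ws)) (xs @ x # ys))"
      for k es
      using Cons.IH[of "\<lambda>ws. W (es # ws)"] by (simp add: hom_add_def distrib_left)
    then show ?case
      by (simp add: hom_add_linear_extension_param)
  qed
  then show ?thesis
    by (simp add: slot_additive_def)
qed

lemma word_extension_monomial:
  assumes "is_path v es" "ascending es"
  shows "word_extension W (monomial k v es # xs) =
    (if es = [] then 0 else U_pow k * word_extension (\<lambda>ws. W (es # ws)) xs)"
  using assms by (simp add: linear_extension_monomial)

lemma word_extension_chords: "chord_word ws \<Longrightarrow> word_extension W (map chord ws) = W ws"
  by (induction ws arbitrary: W)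
    (simp_all add: linear_extension_monomial ascending_is_path U_pow_0)

lemma word_extension_one: "word_extension W (xs @ 1 # ys) = 0"
proof (induction xs arbitrary: W)
  case Nil
  have "linear_extension g 1 = g 0 Vertex0 [] + g 0 Vertex1 []" for g
    using hom_add_linear_extension[of g]
    by (simp add: one_eq_monomials hom_add_def linear_extension_monomial)
  then show ?case by simp
next
  case (Cons x xs)
  then show ?case by (simp add: linear_extension_def cong: if_cong)
qed

lemma word_extension_mult_left: "c * word_extension W xs = word_extension (\<lambda>ws. c * W ws) xs"
proof (induction xs arbitrary: W)
  case (Cons x xs)
  have "c * (U_pow k * y) = U_pow k * (c * y)" for k y
    by (metis U_pow_central mult.assoc)
  then show ?case
    by (simp add: hom_add_comp_linear_extension[OF hom_add_mult_left] Cons.IH if_distrib cong: if_cong)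
qed simp

lemma U_pow_left: "x * (U_pow k * y) = U_pow k * (x * y)"
  by (metis U_pow_central mult.assoc)

text \<open>Bilinearity over the idempotents is a support condition on \<open>W\<close>: words must be composable, and values
must begin and end at the vertices where the word does.\<close>

lemma multilinear_word_extension:
  assumes left: "\<And>w ws v. chord_word (w # ws) \<Longrightarrow>
      idem v * W (w # ws) = (if v = source (hd w) then W (w # ws) else 0)"
    and right: "\<And>w ws v. chord_word (ws @ [w]) \<Longrightarrow>
      W (ws @ [w]) * idem v = (if v = target (last w) then W (ws @ [w]) else 0)"
    and composable: "\<And>ws. chord_word ws \<Longrightarrow> \<not> composable ws \<Longrightarrow> W ws = 0"
  shows "multilinear (word_extension W)"
proof (rule multilinearI)
  note lin [simp] = slot_additive_word_extension[unfolded slot_additive_def hom_add_def, rule_format]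
  have lin0 [simp]: "word_extension V (0 # xs) = 0"
    "word_extension V ((x + y) # xs) = word_extension V (x # xs) + word_extension V (y # xs)"
    for V xs x y
    using hom_add_linear_extension by (auto simp: hom_add_def)
  have lin1 [simp]: "word_extension V (x # 0 # xs) = 0"
    "word_extension V (x # (y + z) # xs) = word_extension V (x # y # xs) + word_extension V (x # z # xs)"
    for V xs x y z
    using slot_additive_word_extension[of V, unfolded slot_additive_def hom_add_def, rule_format, of "[x]"]
    by (auto simp del: word_extension.simps)
  show "slot_additive (word_extension W)"
    by (rule slot_additive_word_extension)
  have mono: "monomial k v [] = U_pow k * idem v" for k v
    by (simp add: U_pow_monomial)
  fix k v x xs
  let ?c = "monomial k v []"
  show "word_extension W ((?c * x) # xs) = ?c * word_extension W (x # xs)"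
  proof (induction x rule: monomial_induct)
    case (monomial l w es)
    show ?case
    proof (cases "es = []")
      case True
      then show ?thesis
        by (simp add: monomial_mult word_extension_monomial del: word_extension.simps)
    next
      case False
      then have w: "w = source (hd es)"
        using monomial is_path_source by blast
      let ?V = "\<lambda>ws. W (es # ws)"
      have "idem v * word_extension ?V xs = (if v = w then word_extension ?V xs else 0)"
        using False monomial left[of es] w
        by (auto simp: word_extension_mult_left intro!: word_extension_cong word_extension_eq_0)
      moreover have "?c * (U_pow l * y) = U_pow (k + l) * (idem v * y)" for y
        unfolding mono[of k v] U_pow_add mult.assoc by (simp only: U_pow_left[of "idem v"])
      ultimately show ?thesis
        using False monomial
        by (simp add: monomial_mult word_extension_monomial del: word_extension.simps)
    qed
  qed (simp_all add: distrib_left del: word_extension.simps)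
  show "word_extension W (xs @ [x * ?c]) = word_extension W (xs @ [x]) * ?c"
    using right
  proof (induction xs arbitrary: W)
    case Nil
    show ?case
    proof (induction x rule: monomial_induct)
      case (monomial l w es)
      show ?case
      proof (cases "es = []")
        case True
        then show ?thesis
          by (simp add: monomial_mult word_extension_monomial del: word_extension.simps(2))
      next
        case False
        have "W [es] * idem v = (if v = target (last es) then W [es] else 0)"
          using Nil.prems[of "[]" es v] False monomial by simp
        moreover have "(U_pow l * y) * ?c = U_pow (l + k) * (y * idem v)" for y
          unfolding mono[of k v] U_pow_add mult.assoc by (simp only: U_pow_left[of y])
        ultimately show ?thesis
          using False monomial
          by (auto simp: monomial_mult word_extension_monomial path_end_last simp del: word_extension.simps(2))
      qed
    qed (simp_all add: distrib_right del: word_extension.simps)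
  next
    case (Cons z xs)
    have "(if es = [] then 0 else U_pow l * word_extension (\<lambda>ws. W (es # ws)) (xs @ [x * ?c])) =
        (if es = [] then 0 else U_pow l * word_extension (\<lambda>ws. W (es # ws)) (xs @ [x])) * ?c"
      if "ascending es" for l es
    proof (cases "es = []")
      case False
      have "word_extension (\<lambda>ws. W (es # ws)) (xs @ [x * ?c]) =
          word_extension (\<lambda>ws. W (es # ws)) (xs @ [x]) * ?c"
        by (rule Cons.IH) (use Cons.prems[of "es # _"] that False in auto)
      then show ?thesis by (simp add: mult.assoc)
    qed simp
    then show ?case
      by (simp add: hom_add_comp_linear_extension[OF hom_add_mult_right] cong: linear_extension_cong)
  qed
  fix y ys
  show "word_extension W (xs @ (x * ?c) # y # ys) = word_extension W (xs @ x # (?c * y) # ys)"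
    using composable
  proof (induction xs arbitrary: W)
    case Nil
    have "word_extension W ((x * ?c) # y # ys) = word_extension W (x # (?c * y) # ys)"
    proof (induction x rule: monomial_induct)
      case x: (monomial l w es)
      show ?case
      proof (induction y rule: monomial_induct)
        case y: (monomial m u fs)
        let ?E = "word_extension (\<lambda>ws. W (es # fs # ws)) ys"
        have L: "word_extension W ((monomial l w es * ?c) # monomial m u fs # ys) =
            (if es = [] \<or> fs = [] \<or> path_end w es \<noteq> v then 0 else U_pow (l + k) * (U_pow m * ?E))"
          using x y by (auto simp: monomial_mult word_extension_monomial simp del: word_extension.simps)
        have R: "word_extension W (monomial l w es # (?c * monomial m u fs) # ys) =
            (if es = [] \<or> fs = [] \<or> v \<noteq> u then 0 else U_pow l * (U_pow (k + m) * ?E))"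
          using x y by (auto simp: monomial_mult word_extension_monomial simp del: word_extension.simps)
        have "?E = 0" if "es \<noteq> []" "fs \<noteq> []" "path_end w es \<noteq> u"
        proof (rule word_extension_eq_0)
          fix ws assume "chord_word ws"
          then show "W (es # fs # ws) = 0"
            using that x y is_path_source[of u fs]
            by (intro Nil.prems) (auto simp: path_end_last)
        qed
        then show ?case
          unfolding L R by (auto simp: U_pow_add mult.assoc)
      qed (simp_all add: distrib_left del: word_extension.simps)
    qed (simp_all add: distrib_right del: word_extension.simps)
    then show ?case by simp
  next
    case (Cons z xs)
    have "word_extension (\<lambda>ws. W (es # ws)) (xs @ (x * ?c) # y # ys) =
        word_extension (\<lambda>ws. W (es # ws)) (xs @ x # (?c * y) # ys)"
      if "ascending es" "es \<noteq> []" for es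
    proof (rule Cons.IH)
      fix ws assume "chord_word ws" "\<not> composable ws"
      then show "W (es # ws) = 0"
        using that by (intro Cons.prems) (auto simp: successively_Cons)
    qed
    then show ?case
      unfolding append_Cons word_extension.simps by (intro linear_extension_cong) simp
  qed
qed

section \<open>Gradings\<close>

lemma Gamma_mult:
  "((m, a, b), w) \<otimes>\<^bsub>Gamma\<^esub> ((n, c, d), v) = ((m + n + a * d - b * c, a + c, b + d), w + v)"
  by (simp add: Gamma_def G_group_def)

lemma Gamma_one: "\<one>\<^bsub>Gamma\<^esub> = ((0, 0, 0), 0)"
  by (simp add: Gamma_def G_group_def)

lemma Gamma_assoc: "g \<otimes>\<^bsub>Gamma\<^esub> h \<otimes>\<^bsub>Gamma\<^esub> k = g \<otimes>\<^bsub>Gamma\<^esub> (h \<otimes>\<^bsub>Gamma\<^esub> k)"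
  by (cases g; cases h; cases k; auto simp: Gamma_mult algebra_simps)

lemma Gamma_one_left [simp]: "\<one>\<^bsub>Gamma\<^esub> \<otimes>\<^bsub>Gamma\<^esub> g = g"
  by (cases g) (auto simp: Gamma_mult Gamma_one)

lemma Gamma_one_right [simp]: "g \<otimes>\<^bsub>Gamma\<^esub> \<one>\<^bsub>Gamma\<^esub> = g"
  by (cases g) (auto simp: Gamma_mult Gamma_one)

text \<open>Multiplication by the central element \<open>((n, 0, 0), k)\<close>, which covers both \<open>\<lambda>\<close> and the degree of \<open>U\<close>.
Written as a function on the left it commutes past everything by rewriting.\<close>

fun shift :: "int \<Rightarrow> int \<Rightarrow> Gamma_elem \<Rightarrow> Gamma_elem" where
  "shift n k ((m, a, b), w) = ((m + of_int n, a, b), w + k)"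

lemma shift_mult_left [simp]: "shift n k g \<otimes>\<^bsub>Gamma\<^esub> h = shift n k (g \<otimes>\<^bsub>Gamma\<^esub> h)"
  by (cases g; cases h; auto simp: Gamma_mult)

lemma shift_mult_right [simp]: "g \<otimes>\<^bsub>Gamma\<^esub> shift n k h = shift n k (g \<otimes>\<^bsub>Gamma\<^esub> h)"
  by (cases g; cases h; auto simp: Gamma_mult)

lemma shift_shift [simp]: "shift n k (shift m l g) = shift (n + m) (k + l) g"
  by (cases g) auto

lemma shift_0 [simp]: "shift 0 0 g = g"
  by (cases g) auto

interpretation Gamma: group Gamma
  by (rule group_Gamma)

lemma shift_eq_mult: "shift n k g = ((of_int n, 0, 0), k) \<otimes>\<^bsub>Gamma\<^esub> g"
  by (cases g) (auto simp: Gamma_mult)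

lemma shift_closed: "g \<in> carrier Gamma \<Longrightarrow> shift n k g \<in> carrier Gamma"
  unfolding shift_eq_mult
  by (intro Gamma.m_closed) (auto simp: Gamma_def G_group_def)

lemma lambda_nat_pow: "lambda [^]\<^bsub>Gamma\<^esub> (n :: nat) = ((of_nat n, 0, 0), 0)"
  by (induction n) (auto simp: lambda_def Gamma_mult Gamma_one)

lemma lambda_int_pow: "lambda [^]\<^bsub>Gamma\<^esub> (n :: int) = ((of_int n, 0, 0), 0)"
proof (cases "n \<ge> 0")
  case True
  then show ?thesis
    by (simp add: int_pow_def2 lambda_nat_pow)
next
  case False
  have "inv\<^bsub>Gamma\<^esub> ((of_nat (nat (- n)), 0, 0), 0) = ((of_int n, 0, 0), 0)"
    using False by (intro Gamma.inv_equality) (auto simp: Gamma_mult Gamma_one Gamma_def G_group_def)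
  then show ?thesis
    using False by (simp add: int_pow_def2 lambda_nat_pow)
qed

lemma lambda_int_pow_mult: "lambda [^]\<^bsub>Gamma\<^esub> (n :: int) \<otimes>\<^bsub>Gamma\<^esub> g = shift n 0 g"
  by (simp add: lambda_int_pow shift_eq_mult)

definition U_degree :: Gamma_elem where
  "U_degree = ((- 2, 0, 0), 1)"

lemma U_degree_pow_mult:
  "U_degree [^]\<^bsub>Gamma\<^esub> (k :: nat) \<otimes>\<^bsub>Gamma\<^esub> g = shift (- 2 * int k) (int k) g"
proof -
  have "U_degree [^]\<^bsub>Gamma\<^esub> (k :: nat) = ((- 2 * of_nat k, 0, 0), int k)"
    by (induction k) (auto simp: U_degree_def Gamma_mult Gamma_one)
  then show ?thesis
    by (simp add: shift_eq_mult)
qed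

lemma U_degree_central: "U_degree \<in> Gamma_center"
  by (auto simp: U_degree_def Gamma_center_def Gamma_def G_group_def)

lemma Gamma_prod_Nil [simp]: "Gamma_prod [] = \<one>\<^bsub>Gamma\<^esub>"
  by (simp add: Gamma_prod_def)

lemma Gamma_prod_Cons [simp]: "Gamma_prod (g # gs) = g \<otimes>\<^bsub>Gamma\<^esub> Gamma_prod gs"
  by (simp add: Gamma_prod_def)

lemma Gamma_prod_append: "Gamma_prod (gs @ hs) = Gamma_prod gs \<otimes>\<^bsub>Gamma\<^esub> Gamma_prod hs"
  by (induction gs) (simp_all add: Gamma_assoc)

lemma Gamma_prod_closed: "set gs \<subseteq> carrier Gamma \<Longrightarrow> Gamma_prod gs \<in> carrier Gamma"
  by (induction gs) auto

lemma path_degree_Nil [simp]: "path_degree [] = \<one>\<^bsub>Gamma\<^esub>"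
  by (simp add: path_degree_def)

lemma path_degree_Cons: "path_degree (e # es) = (gr e, wn e) \<otimes>\<^bsub>Gamma\<^esub> path_degree es"
  by (simp add: path_degree_def)

lemma path_degree_append: "path_degree (es @ fs) = path_degree es \<otimes>\<^bsub>Gamma\<^esub> path_degree fs"
  by (simp add: path_degree_def Gamma_prod_append)

lemma path_degree_closed [simp]: "path_degree es \<in> carrier Gamma"
proof -
  have "(gr e, wn e) \<in> carrier Gamma" for e
    using gr_in_G_group by (simp add: Gamma_def)
  then show ?thesis
    unfolding path_degree_def by (intro Gamma_prod_closed) auto
qed

text \<open>Since ascending paths are linearly independent, homogeneity constrains each monomial separately. The
vanishing of cochains for degree reasons rests on this.\<close>

lemma homogeneous_support:
  "x \<in> homogeneous u g \<Longrightarrow> (k, v, es) \<in> support x \<Longrightarrow>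
    u [^]\<^bsub>Gamma\<^esub> k \<otimes>\<^bsub>Gamma\<^esub> path_degree es = g"
proof (induction rule: homogeneous.induct)
  case (gen l w fs)
  then show ?case
    by (cases "ascending fs")
      (simp_all add: support_monomial monomial_eq_0 flip: monomial_def)
qed (auto simp: support_add)

abbreviation homog :: "Gamma_elem \<Rightarrow> torus_algebra_U set" where
  "homog \<equiv> homogeneous U_degree"

lemma homog_monomial:
  "is_path v es \<Longrightarrow> shift (- 2 * int k) (int k) (path_degree es) = g \<Longrightarrow> monomial k v es \<in> homog g"
  unfolding monomial_def by (rule homogeneous.gen) (simp_all add: U_degree_pow_mult)

lemma homog_support:
  "x \<in> homog g \<Longrightarrow> (k, v, es) \<in> support x \<Longrightarrow> shift (- 2 * int k) (int k) (path_degree es) = g"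
  using homogeneous_support[of x U_degree g k v es] by (simp add: U_degree_pow_mult)

lemma homog_sum: "(\<And>i. i \<in> A \<Longrightarrow> f i \<in> homog g) \<Longrightarrow> sum f A \<in> homog g"
  by (induction A rule: infinite_finite_induct) (auto intro: homogeneous.intros)

lemma homog_deconc: "(\<And>a b. a @ b = xs \<Longrightarrow> \<psi> a b \<in> homog g) \<Longrightarrow> deconc \<psi> xs \<in> homog g"
  unfolding deconc_eq_sum by (intro homog_sum) auto

lemma homog_mult:
  assumes "x \<in> homog g" "y \<in> homog h"
  shows "x * y \<in> homog (g \<otimes>\<^bsub>Gamma\<^esub> h)"
  using assms(1)
proof (induction rule: homogeneous.induct)
  case (gen k v es)
  note x = gen
  show ?case
    using assms(2)
  proof (induction rule: homogeneous.induct)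
    case (gen l w fs)
    have "monomial k v es * monomial l w fs \<in> homog (g \<otimes>\<^bsub>Gamma\<^esub> h)"
    proof (cases "path_end v es = w")
      case True
      have "shift (- 2 * int (k + l)) (int (k + l)) (path_degree (es @ fs)) = g \<otimes>\<^bsub>Gamma\<^esub> h"
        using x(2) gen(2) by (auto simp: U_degree_pow_mult path_degree_append algebra_simps)
      then show ?thesis
        using True x(1) gen(1) by (simp add: monomial_mult homog_monomial is_path_append)
    qed (use x(1) gen(1) in \<open>simp add: monomial_mult homogeneous.zero\<close>)
    then show ?case
      by (simp add: monomial_def)
  qed (simp_all add: distrib_left homogeneous.zero homogeneous.add)
qed (simp_all add: distrib_right homogeneous.zero homogeneous.add)

lemma homog_U_pow: "x \<in> homog g \<Longrightarrow> U_pow k * x \<in> homog (shift (- 2 * int k) (int k) g)"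
proof (induction rule: homogeneous.induct)
  case (gen l v es)
  then show ?case
    using homog_monomial[of v es "k + l"]
    by (auto simp: U_pow_monomial U_degree_pow_mult algebra_simps simp flip: monomial_def)
qed (simp_all add: distrib_left homogeneous.zero homogeneous.add)

definition homog_list :: "torus_algebra_U list \<Rightarrow> Gamma_elem list \<Rightarrow> bool" where
  "homog_list = list_all2 (\<lambda>x g. g \<in> carrier Gamma \<and> x \<in> homog g)"

text \<open>A map of \<open>n\<close> arguments shifts degrees by \<open>\<lambda>\<^sup>n\<^sup>+\<^sup>d\<close>. The operations have \<open>d = -2\<close>, the components of a homomorphism
\<open>d = -1\<close>, and the defect of the operations \<open>d = -3\<close>.\<close>

definition graded :: "int \<Rightarrow> cochain \<Rightarrow> bool" where
  "graded d \<phi> \<longleftrightarrow> (\<forall>xs gs. xs \<noteq> [] \<and> homog_list xs gs \<longrightarrow>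
    \<phi> xs \<in> homog (shift (int (length xs) + d) 0 (Gamma_prod gs)))"

lemma gradedD:
  "graded d \<phi> \<Longrightarrow> xs \<noteq> [] \<Longrightarrow> homog_list xs gs \<Longrightarrow>
    \<phi> xs \<in> homog (shift (int (length xs) + d) 0 (Gamma_prod gs))"
  by (simp add: graded_def)

lemma homog_list_carrier: "homog_list xs gs \<Longrightarrow> set gs \<subseteq> carrier Gamma"
  unfolding homog_list_def by (induction rule: list_all2_induct) auto

text \<open>The condition met by \<open>\<lambda>ys. \<phi> (x # ys)\<close> when \<open>\<phi>\<close> is graded and \<open>x\<close> has degree \<open>g\<close>; the empty list is
included because \<open>x\<close> may be the only argument.\<close>

definition graded_from ::
  "int \<Rightarrow> Gamma_elem \<Rightarrow> cochain \<Rightarrow> bool" where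
  "graded_from d g \<phi> \<longleftrightarrow> (\<forall>xs gs. homog_list xs gs \<longrightarrow>
    \<phi> xs \<in> homog (shift (int (length xs) + d) 0 (g \<otimes>\<^bsub>Gamma\<^esub> Gamma_prod gs)))"

lemma graded_from_Cons:
  assumes "graded_from d g \<phi>" "h \<in> carrier Gamma" "x \<in> homog h"
  shows "graded_from (d + 1) (g \<otimes>\<^bsub>Gamma\<^esub> h) (\<lambda>ys. \<phi> (x # ys))"
  unfolding graded_from_def
proof (intro allI impI)
  fix ys hs assume "homog_list ys hs"
  then have "homog_list (x # ys) (h # hs)"
    using assms by (simp add: homog_list_def)
  then have "\<phi> (x # ys) \<in>
      homog (shift (int (length (x # ys)) + d) 0 (g \<otimes>\<^bsub>Gamma\<^esub> Gamma_prod (h # hs)))"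
    using assms(1) by (simp only: graded_from_def)
  then show "\<phi> (x # ys) \<in>
      homog (shift (int (length ys) + (d + 1)) 0 (g \<otimes>\<^bsub>Gamma\<^esub> h \<otimes>\<^bsub>Gamma\<^esub> Gamma_prod hs))"
    by (simp add: Gamma_assoc algebra_simps)
qed

lemma homog_list_Cons:
  assumes "homog_list (x # xs) gs"
  obtains g hs where "gs = g # hs" "g \<in> carrier Gamma" "x \<in> homog g" "homog_list xs hs"
  using assms by (auto simp: homog_list_def list_all2_Cons1)

lemma homog_list_append:
  assumes "homog_list (xs @ ys) gs"
  obtains as bs where "gs = as @ bs" "homog_list xs as" "homog_list ys bs"
  using assms by (auto simp: homog_list_def list_all2_append1)

lemma graded_window:
  assumes "graded d \<mu>" "g \<in> carrier Gamma" "x \<in> homog g" "homog_list a gs"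
  shows "\<mu> (x # a) \<in> homog (shift (int (length a) + 1 + d) 0 (g \<otimes>\<^bsub>Gamma\<^esub> Gamma_prod gs))"
    and "shift (int (length a) + 1 + d) 0 (g \<otimes>\<^bsub>Gamma\<^esub> Gamma_prod gs) \<in> carrier Gamma"
proof -
  have "homog_list (x # a) (g # gs)"
    using assms by (simp add: homog_list_def)
  from gradedD[OF assms(1) _ this]
  show "\<mu> (x # a) \<in> homog (shift (int (length a) + 1 + d) 0 (g \<otimes>\<^bsub>Gamma\<^esub> Gamma_prod gs))"
    by (simp add: algebra_simps)
  show "shift (int (length a) + 1 + d) 0 (g \<otimes>\<^bsub>Gamma\<^esub> Gamma_prod gs) \<in> carrier Gamma"
    using assms homog_list_carrier by (intro shift_closed Gamma.m_closed Gamma_prod_closed)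
qed

lemma graded_from_insertion_sum:
  assumes "graded_from d g \<phi>" "graded (- 2) \<mu>"
  shows "graded_from (d - 1) g (insertion_sum \<phi> \<mu>)"
proof -
  have "insertion_sum \<phi> \<mu> xs \<in> homog (shift (int (length xs) + (d - 1)) 0 (g \<otimes>\<^bsub>Gamma\<^esub> Gamma_prod gs))"
    if "homog_list xs gs" for xs gs
    using that assms(1)
  proof (induction xs arbitrary: gs \<phi> d g)
    case Nil
    show ?case by (simp add: homogeneous.zero)
  next
    case (Cons x xs)
    obtain h hs where gs: "gs = h # hs" "h \<in> carrier Gamma" "x \<in> homog h" "homog_list xs hs"
      using homog_list_Cons[OF Cons.prems(1)] by blast
    have "deconc (\<lambda>a b. \<phi> (\<mu> (x # a) # b)) xs \<in>
        homog (shift (int (length xs) + d) 0 (g \<otimes>\<^bsub>Gamma\<^esub> Gamma_prod gs))"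
    proof (rule homog_deconc)
      fix a b assume ab: "a @ b = xs"
      then obtain as bs where hs: "hs = as @ bs" "homog_list a as" "homog_list b bs"
        using gs(4) homog_list_append by blast
      note w = graded_window[OF assms(2) gs(2,3) hs(2)]
      from graded_from_Cons[OF Cons.prems(2) w(2,1)] hs(3)
      have "\<phi> (\<mu> (x # a) # b) \<in> homog (shift (int (length b) + (d + 1)) 0
          (g \<otimes>\<^bsub>Gamma\<^esub> shift (int (length a) + 1 + - 2) 0 (h \<otimes>\<^bsub>Gamma\<^esub> Gamma_prod as)
            \<otimes>\<^bsub>Gamma\<^esub> Gamma_prod bs))"
        by (simp only: graded_from_def)
      then show "\<phi> (\<mu> (x # a) # b) \<in>
          homog (shift (int (length xs) + d) 0 (g \<otimes>\<^bsub>Gamma\<^esub> Gamma_prod gs))"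
        by (simp add: ab[symmetric] gs hs Gamma_prod_append Gamma_assoc algebra_simps)
    qed
    moreover have "insertion_sum (\<lambda>ys. \<phi> (x # ys)) \<mu> xs \<in>
        homog (shift (int (length xs) + (d + 1 - 1)) 0 (g \<otimes>\<^bsub>Gamma\<^esub> h \<otimes>\<^bsub>Gamma\<^esub> Gamma_prod hs))"
      by (intro Cons.IH gs graded_from_Cons[OF Cons.prems(2)])
    ultimately show ?case
      by (simp add: insertion_sum_Cons homogeneous.add gs Gamma_assoc)
  qed
  then show ?thesis
    by (simp add: graded_from_def)
qed

lemma graded_from_block_sum:
  assumes "graded_from d g \<phi>" "graded (- 1) f"
  shows "graded_from d g (block_sum \<phi> f)"
proof -
  have "block_sum \<phi> f xs \<in> homog (shift (int (length xs) + d) 0 (g \<otimes>\<^bsub>Gamma\<^esub> Gamma_prod gs))"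
    if "homog_list xs gs" for xs gs
    using that assms(1)
  proof (induction xs arbitrary: gs \<phi> d g rule: length_induct)
    case (1 xs)
    show ?case
    proof (cases xs)
      case Nil
      then show ?thesis
        using 1(3)[unfolded graded_from_def, rule_format, OF 1(2)] by simp
    next
      case (Cons x xs')
      obtain h hs where gs: "gs = h # hs" "h \<in> carrier Gamma" "x \<in> homog h" "homog_list xs' hs"
        using homog_list_Cons 1(2) Cons by metis
      show ?thesis
        unfolding Cons block_sum_Cons
      proof (rule homog_deconc)
        fix a b assume ab: "a @ b = xs'"
        then obtain as bs where hs: "hs = as @ bs" "homog_list a as" "homog_list b bs"
          using gs(4) homog_list_append by blast
        note w = graded_window[OF assms(2) gs(2,3) hs(2)]
        have "length b < length xs"
          using ab Cons by auto
        from 1(1)[rule_format, OF this hs(3) graded_from_Cons[OF 1(3) w(2,1)]]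
        show "block_sum (\<lambda>ys. \<phi> (f (x # a) # ys)) f b \<in>
            homog (shift (int (length (x # xs')) + d) 0 (g \<otimes>\<^bsub>Gamma\<^esub> Gamma_prod gs))"
          by (simp add: ab[symmetric] gs hs Gamma_prod_append Gamma_assoc algebra_simps)
      qed
    qed
  qed
  then show ?thesis
    by (simp add: graded_from_def)
qed

lemma graded_iff_graded_from:
  "graded d \<phi> \<longleftrightarrow> graded_from d \<one>\<^bsub>Gamma\<^esub> (\<lambda>xs. if xs = [] then 0 else \<phi> xs)"
  by (auto simp: graded_def graded_from_def homogeneous.zero)

lemma graded_insertion_sum:
  assumes "graded d \<phi>" "graded (- 2) \<mu>"
  shows "graded (d - 1) (insertion_sum \<phi> \<mu>)"
proof -
  have "insertion_sum \<phi> \<mu> = insertion_sum (\<lambda>xs. if xs = [] then 0 else \<phi> xs) \<mu>"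
    by (intro ext insertion_sum_cong) simp
  then have "graded_from (d - 1) \<one>\<^bsub>Gamma\<^esub> (insertion_sum \<phi> \<mu>)"
    using graded_from_insertion_sum[OF assms(1)[unfolded graded_iff_graded_from] assms(2)]
    by simp
  then show ?thesis
    by (simp add: graded_def graded_from_def)
qed

lemma graded_block_sum:
  assumes "graded d \<phi>" "graded (- 1) f"
  shows "graded d (block_sum \<phi> f)"
proof -
  have "block_sum \<phi> f xs = block_sum (\<lambda>xs. if xs = [] then 0 else \<phi> xs) f xs" if "xs \<noteq> []" for xs
    unfolding block_sum_def using that by (intro sum.cong refl) (auto simp: blocks_def)
  moreover have "graded_from d \<one>\<^bsub>Gamma\<^esub> (block_sum (\<lambda>xs. if xs = [] then 0 else \<phi> xs) f)"
    using graded_from_block_sum[OF assms(1)[unfolded graded_iff_graded_from] assms(2)] .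
  ultimately show ?thesis
    by (simp add: graded_def graded_from_def)
qed

lemma graded_add: "graded d \<phi> \<Longrightarrow> graded d \<chi> \<Longrightarrow> graded d (\<lambda>xs. \<phi> xs + \<chi> xs)"
  by (simp add: graded_def homogeneous.add)

lemma word_extension_homog:
  assumes "\<And>ws. chord_word ws \<Longrightarrow> length ws = length xs \<Longrightarrow>
      W ws \<in> homog (shift d 0 (g \<otimes>\<^bsub>Gamma\<^esub> path_degree (concat ws)))"
    and "homog_list xs gs"
  shows "word_extension W xs \<in> homog (shift d 0 (g \<otimes>\<^bsub>Gamma\<^esub> Gamma_prod gs))"
  using assms
proof (induction xs arbitrary: W g gs)
  case Nil
  then show ?case
    using Nil.prems(1)[of "[]"] by (simp add: homog_list_def)
next
  case (Cons x xs)
  obtain h hs where gs: "gs = h # hs" "x \<in> homog h" "homog_list xs hs"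
    using homog_list_Cons[OF Cons.prems(2)] by blast
  have "(if es = [] then 0 else U_pow k * word_extension (\<lambda>ws. W (es # ws)) xs) \<in>
      homog (shift d 0 (g \<otimes>\<^bsub>Gamma\<^esub> Gamma_prod gs))" if s: "(k, v, es) \<in> support x" for k v es
  proof (cases "es = []")
    case False
    have "word_extension (\<lambda>ws. W (es # ws)) xs \<in>
        homog (shift d 0 (g \<otimes>\<^bsub>Gamma\<^esub> path_degree es \<otimes>\<^bsub>Gamma\<^esub> Gamma_prod hs))"
    proof (rule Cons.IH[OF _ gs(3)])
      fix ws assume "chord_word ws" "length ws = length xs"
      then show "W (es # ws) \<in>
          homog (shift d 0 (g \<otimes>\<^bsub>Gamma\<^esub> path_degree es \<otimes>\<^bsub>Gamma\<^esub> path_degree (concat ws)))"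
        using Cons.prems(1)[of "es # ws"] False support_basis[OF s]
        by (simp add: path_degree_append Gamma_assoc)
    qed
    from homog_U_pow[OF this, of k] homog_support[OF gs(2) s, symmetric]
    show ?thesis
      using False by (simp add: gs algebra_simps Gamma_assoc)
  qed (simp add: homogeneous.zero)
  then show ?case
    by (auto simp: linear_extension_def intro!: homog_sum)
qed

lemma rho_eq_monomial:
  "const rho1 = monomial 0 Vertex0 [Arrow1]" "const rho2 = monomial 0 Vertex1 [Arrow2]"
  "const rho3 = monomial 0 Vertex0 [Arrow3]" "const rho4 = monomial 0 Vertex1 [Arrow4]"
  by (simp_all add: const_def rho1_def rho2_def rho3_def rho4_def monomial_def arrow_elem_def)

lemma var_U_mult_idem: "var_U * idem v = monomial 1 v []"
  by (simp add: var_U_def monomial_def mult_single)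

lemma graded_Gamma_graded: "graded (- 2) \<mu> \<Longrightarrow> Gamma_graded \<mu>"
  unfolding Gamma_graded_def graded_def
proof (intro bexI[OF _ U_degree_central] allI impI)
  fix xs gs
  assume \<mu>: "\<forall>xs gs. xs \<noteq> [] \<and> homog_list xs gs \<longrightarrow>
      \<mu> xs \<in> homog (shift (int (length xs) + - 2) 0 (Gamma_prod gs))"
    and A: "xs \<noteq> [] \<and> set gs \<subseteq> carrier Gamma \<and> list_all2 (\<lambda>x g. x \<in> homog g) xs gs"
  then have "homog_list xs gs"
    by (auto simp: homog_list_def list_all2_conv_all_nth)
  then show "\<mu> xs \<in> homog (lambda [^]\<^bsub>Gamma\<^esub> (int (length xs) - 2) \<otimes>\<^bsub>Gamma\<^esub> Gamma_prod gs)"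
    using \<mu> A by (simp add: lambda_int_pow_mult)
qed

text \<open>The value \<open>U \<iota>\<^sub>1\<close> of the first prescribed operation forces \<open>U\<close> to have the degree \<open>(-2; 0, 0) \<times> 1\<close>.\<close>

lemma torus_deformation_graded:
  assumes "torus_deformation \<mu>"
  shows "graded (- 2) \<mu>"
proof -
  obtain u where u: "u \<in> Gamma_center" and gr: "\<And>xs gs. xs \<noteq> [] \<Longrightarrow> set gs \<subseteq> carrier Gamma \<Longrightarrow>
      list_all2 (\<lambda>x g. x \<in> homogeneous u g) xs gs \<Longrightarrow>
      \<mu> xs \<in> homogeneous u (lambda [^]\<^bsub>Gamma\<^esub> (int (length xs) - 2) \<otimes>\<^bsub>Gamma\<^esub> Gamma_prod gs)"
    using assms unfolding torus_deformation_def Gamma_graded_def by metis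
  have arrow: "monomial 0 (source a) [a] \<in> homogeneous u (path_degree [a])" for a
    unfolding monomial_def by (rule homogeneous.gen) simp_all
  let ?xs = "[const rho4, const rho3, const rho2, const rho1]"
  let ?gs = "map (\<lambda>a. path_degree [a]) [Arrow4, Arrow3, Arrow2, Arrow1]"
  have "\<mu> ?xs \<in> homogeneous u (lambda [^]\<^bsub>Gamma\<^esub> (int (length ?xs) - 2) \<otimes>\<^bsub>Gamma\<^esub> Gamma_prod ?gs)"
    using arrow[of Arrow1] arrow[of Arrow2] arrow[of Arrow3] arrow[of Arrow4]
    by (intro gr) (auto simp: rho_eq_monomial)
  moreover have "\<mu> ?xs = monomial 1 Vertex1 []"
    using assms by (simp add: torus_deformation_def const_iota var_U_mult_idem)
  moreover have "lambda [^]\<^bsub>Gamma\<^esub> (int (length ?xs) - 2) \<otimes>\<^bsub>Gamma\<^esub> Gamma_prod ?gs = U_degree"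
    unfolding lambda_int_pow_mult by (simp add: path_degree_Cons Gamma_mult Gamma_one U_degree_def)
  ultimately have "u [^]\<^bsub>Gamma\<^esub> (1 :: nat) \<otimes>\<^bsub>Gamma\<^esub> path_degree [] = U_degree"
    using homogeneous_support[of _ u U_degree 1 Vertex1 "[]"] by (simp add: support_monomial)
  then have "u = U_degree"
    using u by (simp add: Gamma_center_def)
  then show ?thesis
    using gr unfolding graded_def
    by (metis (no_types, lifting) homog_list_carrier homog_list_def lambda_int_pow_mult
        list_all2_mono uminus_add_conv_diff add.commute)
qed

section \<open>The Hochschild complex on words of chords\<close>

abbreviation letters :: "arrow list \<Rightarrow> arrow list list" where
  "letters ds \<equiv> map (\<lambda>d. [d]) ds"

text \<open>The Hochschild differential of the algebra with coefficients in the algebra itself.\<close>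

definition coboundary :: "cochain \<Rightarrow> cochain" where
  "coboundary \<phi> xs =
    insertion_sum \<phi> multiply xs + hd xs * \<phi> (tl xs) + \<phi> (butlast xs) * last xs"

definition merge_word :: "arrow list list \<Rightarrow> bool" where
  "merge_word ws \<longleftrightarrow> (\<exists>ds p q rest. ws = letters ds @ [p] # q # rest \<and> descending (ds @ [p]) \<and>
    q \<noteq> [] \<and> ascending (p # q) \<and> chord_word rest)"

text \<open>Read the word from the left as long as it consists of single arrows that descend. At the first
failure either the new entry has more than one arrow, or it continues the last arrow to a chord.\<close>

lemma composable_word_cases:
  assumes "chord_word ws" "composable ws"
  obtains (critical) ds where "descending ds" "ws = letters ds"
  | (long) ds p q rest where "descending (ds @ [p])" "q \<noteq> []" "ascending (p # q)" "chord_word rest"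
      "ws = letters ds @ (p # q) # rest"
  | (merge) "merge_word ws"
proof -
  have "(\<exists>ds. descending ds \<and> ws = letters ds) \<or>
    (\<exists>ds p q rest. descending (ds @ [p]) \<and> q \<noteq> [] \<and> ascending (p # q) \<and> chord_word rest \<and>
      ws = letters ds @ (p # q) # rest) \<or> merge_word ws"
    using assms
  proof (induction ws)
    case Nil
    show ?case by (intro disjI1 exI[of _ "[]"]) simp
  next
    case (Cons w ws)
    obtain p q where w: "w = p # q"
      using Cons.prems(1) by (cases w) auto
    consider "q \<noteq> []" | "q = []" "ws = []" | r ws' where "q = []" "ws = r # ws'"
      by (cases ws) auto
    then show ?case
    proof cases
      case 1
      then show ?thesis
        using Cons.prems w by (intro disjI2 disjI1 exI[of _ "[]"]) auto
    next
      case 2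
      then show ?thesis
        using w by (intro disjI1 exI[of _ "[p]"]) simp
    next
      case 3
      then have r: "r \<noteq> []" "ascending r" "chord_word ws'" "target p = source (hd r)"
        using Cons.prems w by auto
      show ?thesis
      proof (cases "hd r = next_arrow p")
        case True
        then have "ascending (p # r)"
          using r by (cases r) auto
        then have "merge_word (w # ws)"
          unfolding merge_word_def using 3 r w by (intro exI[of _ "[]"]) auto
        then show ?thesis by blast
      next
        case False
        then have p: "p = next_arrow (hd r)"
          using composable_arrows r by blast
        have desc: "descending (p # ds @ [e])"
          if "descending (ds @ [e])" "ws = letters ds @ (e # s) # rest" for ds e s rest
        proof -
          have "hd r = hd (ds @ [e])"
            using that(2) 3(2) by (cases ds) auto
          then have "p = next_arrow (hd (ds @ [e]))"
            using p by (simp only:)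
          then show ?thesis
            using that(1) by (auto simp: successively_Cons)
        qed
        have "composable ws" "chord_word ws"
          using Cons.prems 3 by auto
        from Cons.IH[OF this(2,1)] show ?thesis
        proof (elim disjE exE conjE)
          fix ds assume a: "descending ds" "ws = letters ds"
          then have "descending (p # ds)"
            using 3 p by (cases ds) auto
          then show ?thesis
            using a 3 w by (intro disjI1 exI[of _ "p # ds"]) simp
        next
          fix ds e s rest
          assume b: "descending (ds @ [e])" "s \<noteq> []" "ascending (e # s)" "chord_word rest"
            "ws = letters ds @ (e # s) # rest"
          have "descending ((p # ds) @ [e])" "w # ws = letters (p # ds) @ (e # s) # rest"
            using desc[OF b(1,5)] 3 w b(5) by simp_all
          then show ?thesis
            using b by blast
        next
          assume "merge_word ws"
          then obtain ds e s rest where c: "ws = letters ds @ [e] # s # rest" "descending (ds @ [e])"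
              "s \<noteq> []" "ascending (e # s)" "chord_word rest"
            unfolding merge_word_def by (elim exE conjE)
          have "descending ((p # ds) @ [e])" "w # ws = letters (p # ds) @ [e] # s # rest"
            using desc[OF c(2,1)] 3 w c(1) by simp_all
          then have "merge_word (w # ws)"
            unfolding merge_word_def using c by blast
          then show ?thesis by blast
        qed
      qed
    qed
  qed
  then show thesis
    using that by blast
qed

lemma insertion_sum_multiply_Cons:
  assumes "slot_additive \<phi>"
  shows "insertion_sum \<phi> multiply (x # y # ys) =
    \<phi> ((x * y) # ys) + insertion_sum (\<lambda>zs. \<phi> (x # zs)) multiply (y # ys)"
proof -
  have 0: "\<phi> (0 # zs) = 0" for zs
    using slot_additive_0[OF assms, of "[]"] by simp
  have "deconc (\<lambda>a b. \<phi> (multiply (x # y # a) # b)) ys = \<phi> ((x * y) # ys)"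
    by (cases ys) (auto simp: multiply_def 0 intro!: deconc_eq_0)
  then show ?thesis
    by (simp add: insertion_sum_Cons[of _ _ x]) (simp add: multiply_def 0)
qed

lemma insertion_sum_multiply_single:
  assumes "slot_additive \<phi>"
  shows "insertion_sum \<phi> multiply [x] = 0"
  using slot_additive_0[OF assms, of "[]"] by (simp add: insertion_sum_Cons multiply_def)

lemma insertion_sum_multiply_chords_eq_0:
  assumes "slot_additive \<phi>"
    and "\<And>vs. chord_word vs \<Longrightarrow> length vs + 1 = length ws \<Longrightarrow> \<phi> (map chord vs) = 0"
    and "chord_word ws"
  shows "insertion_sum \<phi> multiply (map chord ws) = 0"
  using assms
proof (induction ws arbitrary: \<phi>)
  case (Cons w ws)
  show ?case
  proof (cases ws)
    case Nil
    then show ?thesis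
      by (simp add: insertion_sum_multiply_single Cons.prems(1))
  next
    case (Cons v ws')
    have "\<phi> ((chord w * chord v) # map chord ws') = 0"
      using Cons.prems(2)[of "(w @ v) # ws'"] Cons.prems(3) Cons
        slot_additive_0[OF Cons.prems(1), of "[]"]
      by (simp add: chord_mult)
    moreover have "insertion_sum (\<lambda>zs. \<phi> (chord w # zs)) multiply (map chord ws) = 0"
    proof (rule Cons.IH)
      show "slot_additive (\<lambda>zs. \<phi> (chord w # zs))"
        by (rule slot_additive_Cons[OF Cons.prems(1)])
      fix vs assume "chord_word vs" "length vs + 1 = length ws"
      then show "\<phi> (chord w # map chord vs) = 0"
        using Cons.prems(2)[of "w # vs"] Cons.prems(3) by simp
    qed (use Cons.prems(3) in simp)
    ultimately show ?thesis
      by (simp add: Cons insertion_sum_multiply_Cons Cons.prems(1))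
  qed
qed simp

text \<open>The only product of neighbours that survives is \<open>p q\<close>: the pairs before it descend, and products further
to the right keep the word a merge word, where \<open>\<phi>\<close> vanishes.\<close>

lemma insertion_sum_multiply_merge:
  assumes "slot_additive \<phi>"
    and "\<And>s vs. s \<noteq> [] \<Longrightarrow> ascending (p # s) \<Longrightarrow> chord_word vs \<Longrightarrow> length vs + 1 = length rest \<Longrightarrow>
      \<phi> (map chord (letters ds @ [p] # s # vs)) = 0"
    and "descending (ds @ [p])" "q \<noteq> []" "ascending (p # q)" "chord_word rest"
  shows "insertion_sum \<phi> multiply (map chord (letters ds @ [p] # q # rest)) =
    \<phi> (map chord (letters ds @ (p # q) # rest))"
  using assms
proof (induction ds arbitrary: \<phi>)
  case Nil
  have q: "ascending q"
    using Nil.prems by (cases q) auto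
  note add = slot_additive_Cons[OF Nil.prems(1), of "chord [p]", simplified]
  have "insertion_sum (\<lambda>zs. \<phi> (chord [p] # zs)) multiply (map chord (q # rest)) = 0"
  proof (cases rest)
    case Nil
    then show ?thesis
      using insertion_sum_multiply_single[OF add] by simp
  next
    case (Cons r rest')
    have r: "r \<noteq> []" "ascending r" "chord_word rest'"
      using Nil.prems(6) Cons by auto
    have 1: "\<phi> (chord [p] # (chord q * chord r) # map chord rest') = 0"
    proof (cases "ascending (q @ r)")
      case True
      then have "ascending (p # q @ r)"
        using Nil.prems(4,5) by (cases q) auto
      then show ?thesis
        using Nil.prems(2)[of "q @ r" rest'] Nil.prems(4) q r True Cons
        by (simp add: chord_mult)
    next
      case False
      then show ?thesis
        using Nil.prems(4) q r slot_additive_0[OF Nil.prems(1), of "[chord [p]]"]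
        by (simp add: chord_mult)
    qed
    have 2: "insertion_sum (\<lambda>zs. \<phi> (chord [p] # chord q # zs)) multiply (map chord rest) = 0"
    proof (rule insertion_sum_multiply_chords_eq_0)
      show "slot_additive (\<lambda>zs. \<phi> (chord [p] # chord q # zs))"
        using slot_additive_Cons[OF add, of "chord q"] by simp
      fix vs assume "chord_word vs" "length vs + 1 = length rest"
      then show "\<phi> (chord [p] # chord q # map chord vs) = 0"
        using Nil.prems(2)[of q vs] Nil.prems(4,5) by simp
    qed (rule Nil.prems(6))
    then show ?thesis
      using 1 by (simp add: Cons insertion_sum_multiply_Cons[OF add])
  qed
  then show ?case
    using Nil.prems q by (simp add: insertion_sum_multiply_Cons[OF Nil.prems(1)])
      (simp add: chord_mult[of "[p]" q, simplified])
next
  case (Cons d ds)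
  obtain e es where e: "ds @ [p] = e # es"
    by (cases ds) auto
  have d: "d = next_arrow e" "descending (ds @ [p])"
    using Cons.prems(3) e by auto
  have "\<not> ascending [d, e]"
    using d by auto
  then have 0: "chord [d] * chord [e] = 0"
    using chord_mult[of "[d]" "[e]"] by simp
  have "letters ds @ [p] # q # rest = letters (ds @ [p]) @ q # rest"
    by simp
  also have "\<dots> = [e] # letters es @ q # rest"
    by (simp only: e) simp
  finally have w: "letters ds @ [p] # q # rest = [e] # letters es @ q # rest" .
  have "map chord (letters (d # ds) @ [p] # q # rest) =
      chord [d] # map chord (letters ds @ [p] # q # rest)"
    by simp
  also have "\<dots> = chord [d] # chord [e] # map chord (letters es @ q # rest)"
    unfolding w by simp
  finally have "insertion_sum \<phi> multiply (map chord (letters (d # ds) @ [p] # q # rest)) =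
      insertion_sum \<phi> multiply (chord [d] # chord [e] # map chord (letters es @ q # rest))"
    by (simp only:)
  also have "\<dots> = insertion_sum (\<lambda>zs. \<phi> (chord [d] # zs)) multiply (map chord ([e] # letters es @ q # rest))"
    using slot_additive_0[OF Cons.prems(1), of "[]"] 0
    by (simp add: insertion_sum_multiply_Cons[OF Cons.prems(1)])
  also have "\<dots> = insertion_sum (\<lambda>zs. \<phi> (chord [d] # zs)) multiply (map chord (letters ds @ [p] # q # rest))"
    by (simp only: w)
  also have "\<dots> = \<phi> (chord [d] # map chord (letters ds @ (p # q) # rest))"
  proof (rule Cons.IH[OF slot_additive_Cons[OF Cons.prems(1)] _ d(2) Cons.prems(4,5,6)])
    fix s vs
    assume "s \<noteq> []" "ascending (p # s)" "chord_word vs" "length vs + 1 = length rest"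
    from Cons.prems(2)[OF this]
    show "\<phi> (chord [d] # map chord (letters ds @ [p] # s # vs)) = 0"
      by simp
  qed
  finally show ?case by simp
qed

text \<open>Multiplying by the first argument leaves a merge word unless the descending part is empty, and
  multiplying by the last argument leaves one unless \<open>q\<close> is the last entry. So the coboundary at a
  merge word is the value at the long word it comes from, up to terms that concern shorter words or
  critical ones.\<close>

lemma coboundary_merge:
  assumes add: "slot_additive \<phi>"
    and merge: "\<And>ws. merge_word ws \<Longrightarrow> length ws = n \<Longrightarrow> \<phi> (map chord ws) = 0"
    and ws: "descending (ds @ [p])" "q \<noteq> []" "ascending (p # q)" "chord_word rest"
    and n: "length (letters ds @ [p] # q # rest) = n + 1"
  shows "coboundary \<phi> (map chord (letters ds @ [p] # q # rest)) =
    \<phi> (map chord (letters ds @ (p # q) # rest))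
    + (if ds = [] then chord [p] * \<phi> (map chord (q # rest)) else 0)
    + (if rest = [] then \<phi> (map chord (letters (ds @ [p]))) * chord q else 0)"
proof -
  let ?w = "map chord (letters ds @ [p] # q # rest)"
  have "insertion_sum \<phi> multiply ?w = \<phi> (map chord (letters ds @ (p # q) # rest))"
  proof (rule insertion_sum_multiply_merge[OF add _ ws])
    fix s vs
    assume "s \<noteq> []" "ascending (p # s)" "chord_word vs" "length vs + 1 = length rest"
    then show "\<phi> (map chord (letters ds @ [p] # s # vs)) = 0"
      using ws(1) n by (intro merge) (auto simp: merge_word_def)
  qed
  moreover have "hd ?w * \<phi> (tl ?w) = (if ds = [] then chord [p] * \<phi> (map chord (q # rest)) else 0)"
  proof (cases ds)
    case (Cons d ds')
    have "descending (ds' @ [p])"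
      using ws(1) Cons by (cases ds') auto
    then have "merge_word (letters ds' @ [p] # q # rest)"
      using ws by (auto simp: merge_word_def)
    then show ?thesis
      using merge[of "letters ds' @ [p] # q # rest"] n Cons by simp
  qed simp
  moreover have "\<phi> (butlast ?w) * last ?w =
      (if rest = [] then \<phi> (map chord (letters (ds @ [p]))) * chord q else 0)"
  proof (cases rest rule: rev_cases)
    case Nil
    then show ?thesis by (simp add: butlast_append)
  next
    case (snoc rest' r)
    then have "merge_word (letters ds @ [p] # q # rest')"
      using ws by (auto simp: merge_word_def)
    then show ?thesis
      using merge[of "letters ds @ [p] # q # rest'"] n snoc by (simp add: butlast_append)
  qed
  ultimately show ?thesis
    by (simp add: coboundary_def)
qed

text \<open>By \<open>coboundary_merge\<close> the cocycle condition at a merge word expresses the value at the corresponding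
long word through a word with one arrow less and a critical word; induction on the number of arrows.\<close>

lemma cocycle_eq_0:
  assumes E: "multilinear E" "unital_on n E"
    and cocycle: "\<And>ws. merge_word ws \<Longrightarrow> length ws = n + 1 \<Longrightarrow> coboundary E (map chord ws) = 0"
    and merge: "\<And>ws. merge_word ws \<Longrightarrow> length ws = n \<Longrightarrow> E (map chord ws) = 0"
    and critical: "\<And>ds. descending ds \<Longrightarrow> length ds = n \<Longrightarrow> E (map chord (letters ds)) = 0"
    and n: "length xs = n"
  shows "E xs = 0"
proof (rule multilinear_eq_0[OF E _ n])
  fix ws
  assume "chord_word ws" "composable ws" "length ws = n"
  then show "E (map chord ws) = 0"
  proof (induction "length (concat ws)" arbitrary: ws rule: less_induct)
    case less
    from less.prems(1,2) show ?case
    proof (cases rule: composable_word_cases)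
      case (critical ds)
      then show ?thesis
        using assms(5)[of ds] less.prems(3) by simp
    next
      case merge
      then show ?thesis
        using assms(4)[of ws] less.prems(3) by simp
    next
      case (long ds p q rest)
      have len: "length (letters ds @ [p] # q # rest) = n + 1"
        using less.prems(3) long by simp
      have "merge_word (letters ds @ [p] # q # rest)"
        using long by (auto simp: merge_word_def)
      then have "coboundary E (map chord (letters ds @ [p] # q # rest)) = 0"
        using len by (rule cocycle)
      then have eq: "E (map chord (letters ds @ (p # q) # rest))
          + (if ds = [] then chord [p] * E (map chord (q # rest)) else 0)
          + (if rest = [] then E (map chord (letters (ds @ [p]))) * chord q else 0) = 0"
        using coboundary_merge[OF multilinear_additive[OF E(1)] merge long(1,2,3,4) len]
        by (simp only:)
      have "E (map chord (q # rest)) = 0" if "ds = []"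
      proof (cases "composable (q # rest)")
        case True
        show ?thesis
          using less.prems long that True by (intro less.hyps) (auto simp: successively_Cons)
      next
        case False
        then show ?thesis
          using long by (intro multilinear_not_composable[OF E(1)]) (auto simp: successively_Cons)
      qed
      then have B: "(if ds = [] then chord [p] * E (map chord (q # rest)) else 0) = 0"
        by (simp only: mult_zero_right if_cancel cong: if_cong)
      have "E (map chord (letters (ds @ [p]))) = 0" if "rest = []"
        using long less.prems(3) that by (intro critical) auto
      then have C: "(if rest = [] then E (map chord (letters (ds @ [p]))) * chord q else 0) = 0"
        by (simp only: mult_zero_left if_cancel cong: if_cong)
      show ?thesis
        using eq unfolding B C add_0_right long(5) .
    qed
  qed
qed

text \<open>The recursion that \<open>coboundary_merge\<close> dictates for a solution \<open>\<phi>\<close> of \<open>\<delta>\<phi> = R\<close> on merge words with \<open>\<phi> = 0\<close>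
there and \<open>\<phi> = c\<close> on critical words. The first list holds the descending arrows already read, the
second one the rest of the word. After a long chord has been split at its first arrow, the recursive
call concerns a word with one arrow less.\<close>

function gauge_solution ::
  "(arrow list list \<Rightarrow> torus_algebra_U) \<Rightarrow> (arrow list \<Rightarrow> torus_algebra_U) \<Rightarrow>
    arrow list \<Rightarrow> arrow list list \<Rightarrow> torus_algebra_U" where
  "gauge_solution R c ds [] = c ds"
| "gauge_solution R c ds ([] # ws) = 0"
| "gauge_solution R c ds ([p] # ws) =
    (if ws \<noteq> [] \<and> ascending (p # hd ws) then 0 else gauge_solution R c (ds @ [p]) ws)"
| "gauge_solution R c ds ((p # r # q) # ws) =
    R (letters ds @ [p] # (r # q) # ws)
    + (if ds = [] then chord [p] * gauge_solution R c [] ((r # q) # ws) else 0)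
    + (if ws = [] then c (ds @ [p]) * chord (r # q) else 0)"
  by pat_completeness auto
termination
  by (relation "measure (\<lambda>(R, c, ds, ws). length (concat ws))") auto

lemma gauge_solution_letter:
  assumes "descending (d # ds @ [p])"
  shows "gauge_solution R c es ([d] # letters ds @ (p # q) # rest) =
      gauge_solution R c (es @ [d]) (letters ds @ (p # q) # rest)"
  using assms by (cases ds) auto

lemma gauge_solution_merge:
  assumes "descending (ds @ [p])" "q \<noteq> []" "ascending (p # q)"
  shows "gauge_solution R c es (letters ds @ [p] # q # rest) = 0"
  using assms
proof (induction ds arbitrary: es)
  case Nil
  then show ?case by (cases q) auto
next
  case (Cons d ds)
  have "descending (ds @ [p])"
    using Cons.prems(1) by (cases ds) auto
  then show ?case
    using Cons.IH[of "es @ [d]"] Cons.prems gauge_solution_letter[of d ds p R c es "[]"]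
    by (simp del: gauge_solution.simps)
qed

lemma gauge_solution_critical:
  "descending ds \<Longrightarrow> gauge_solution R c es (letters ds) = c (es @ ds)"
proof (induction ds arbitrary: es)
  case (Cons d ds)
  then show ?case
    using Cons.IH[of "es @ [d]"] by (cases ds) auto
qed simp

lemma gauge_solution_long:
  assumes "descending (ds @ [p])" "q \<noteq> []"
  shows "gauge_solution R c es (letters ds @ (p # q) # rest) =
    R (letters (es @ ds) @ [p] # q # rest)
    + (if es @ ds = [] then chord [p] * gauge_solution R c [] (q # rest) else 0)
    + (if rest = [] then c (es @ ds @ [p]) * chord q else 0)"
  using assms
proof (induction ds arbitrary: es)
  case Nil
  then show ?case by (cases q) auto
next
  case (Cons d ds)
  have "descending (ds @ [p])"
    using Cons.prems(1) by (cases ds) auto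
  then show ?case
    using Cons.IH[of "es @ [d]"] Cons.prems gauge_solution_letter[of d ds p R c es q]
    by (simp del: gauge_solution.simps)
qed

lemma multilinear_idem_left:
  assumes "multilinear f" "chord_word (w # ws)"
  shows "idem v * f (map chord (w # ws)) = (if v = source (hd w) then f (map chord (w # ws)) else 0)"
proof -
  have "idem v * f (map chord (w # ws)) = f ((idem v * chord w) # map chord ws)"
    using multilinear_left[OF assms(1)] by simp
  then show ?thesis
    using assms(2) slot_additive_0[OF multilinear_additive[OF assms(1)], of "[]"]
    by (simp add: idem_chord)
qed

lemma multilinear_idem_right:
  assumes "multilinear f" "chord_word (ws @ [w])"
  shows "f (map chord (ws @ [w])) * idem v = (if v = target (last w) then f (map chord (ws @ [w])) else 0)"
proof -
  have "f (map chord (ws @ [w])) * idem v = f (map chord ws @ [chord w * idem v])"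
    using multilinear_right[OF assms(1)] by simp
  then show ?thesis
    using assms(2) slot_additive_0[OF multilinear_additive[OF assms(1)], of "map chord ws" "[]"]
    by (simp add: chord_idem)
qed

text \<open>Every term of the recursion starts at the vertex where the word starts.\<close>

lemma gauge_solution_idem_left:
  assumes "multilinear f"
    and "\<And>ds. length ds = n \<Longrightarrow> ds \<noteq> [] \<Longrightarrow> idem v * c ds = (if v = source (hd ds) then c ds else 0)"
    and "chord_word ws" "length ds + length ws = n" "ds @ concat ws \<noteq> []"
  shows "idem v * gauge_solution (\<lambda>ws. f (map chord ws)) c ds ws =
    (if v = source (hd (ds @ concat ws)) then gauge_solution (\<lambda>ws. f (map chord ws)) c ds ws else 0)"
  using assms(2-)
proof (induction "\<lambda>ws. f (map chord ws)" c ds ws rule: gauge_solution.induct)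
  case (3 c ds p ws)
  have "idem v * gauge_solution (\<lambda>ws. f (map chord ws)) c (ds @ [p]) ws =
      (if v = source (hd (ds @ p # concat ws))
       then gauge_solution (\<lambda>ws. f (map chord ws)) c (ds @ [p]) ws else 0)"
    if "\<not> (ws \<noteq> [] \<and> ascending (p # hd ws))"
    using 3(1)[OF that 3(2)] 3(3,4) by simp
  then show ?case
    by (cases "ws \<noteq> [] \<and> ascending (p # hd ws)")
      (simp_all only: gauge_solution.simps concat.simps append_Cons append_Nil mult_zero_right
        if_cancel if_True if_False not_False_eq_True simp_thms)
next
  case (4 c ds p r q ws)
  let ?s = "source (hd (ds @ [p]))"
  have word: "chord_word (letters ds @ [p] # (r # q) # ws)"
    using 4(3) by auto
  obtain a as where as: "letters ds @ [p] # (r # q) # ws = [a] # as" "source a = ?s"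
    by (cases ds) auto
  have 1: "idem v * f (map chord (letters ds @ [p] # (r # q) # ws)) =
      (if v = ?s then f (map chord (letters ds @ [p] # (r # q) # ws)) else 0)"
    using multilinear_idem_left[OF assms(1), of "[a]" as v] word as by simp
  have 2: "idem v * c (ds @ [p]) = (if v = ?s then c (ds @ [p]) else 0)" if "ws = []"
    using 4(2)[of "ds @ [p]"] 4(4) that by simp
  have 3: "idem v * (chord [p] * y) = (if v = source p then chord [p] * y else 0)" for y
    using idem_chord[of "[p]" v] by (simp add: mult.assoc[symmetric])
  show ?case
    using 1 2 3 by (cases "ds = []"; cases "ws = []")
      (simp_all add: distrib_left mult.assoc[symmetric] hd_append)
qed simp_all

lemma gauge_solution_idem_right:
  assumes "multilinear f"
    and "\<forall>ds. length ds = n \<and> ds \<noteq> [] \<longrightarrow> c ds * idem v = (if v = target (last ds) then c ds else 0)"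
    and "chord_word ws" "length ds + length ws = n" "ds @ concat ws \<noteq> []"
  shows "gauge_solution (\<lambda>ws. f (map chord ws)) c ds ws * idem v =
    (if v = target (last (ds @ concat ws)) then gauge_solution (\<lambda>ws. f (map chord ws)) c ds ws else 0)"
  using assms(2-)
proof (induction "\<lambda>ws. f (map chord ws)" c ds ws rule: gauge_solution.induct)
  case (3 c ds p ws)
  have "gauge_solution (\<lambda>ws. f (map chord ws)) c (ds @ [p]) ws * idem v =
      (if v = target (last (ds @ p # concat ws))
       then gauge_solution (\<lambda>ws. f (map chord ws)) c (ds @ [p]) ws else 0)"
    if "\<not> (ws \<noteq> [] \<and> ascending (p # hd ws))"
    using 3(1)[OF that 3(2)] 3(3,4) by simp
  then show ?case
    by (cases "ws \<noteq> [] \<and> ascending (p # hd ws)")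
      (simp_all only: gauge_solution.simps concat.simps append_Cons append_Nil mult_zero_left
        if_cancel if_True if_False not_False_eq_True simp_thms)
next
  case (4 c ds p r q ws)
  let ?s = "target (last (concat ((r # q) # ws)))"
  let ?w = "letters ds @ [p] # (r # q) # ws"
  have word: "chord_word ?w"
    using 4(3) by auto
  obtain a as where as: "?w = as @ [a]" "target (last a) = ?s"
  proof (cases ws rule: rev_cases)
    case Nil
    then show ?thesis
      using that[of "letters ds @ [[p]]" "r # q"] by simp
  next
    case (snoc vs v)
    moreover from this have "v \<noteq> []"
      using word by simp
    ultimately show ?thesis
      using that[of "letters ds @ [p] # (r # q) # vs" v] by (simp add: last_append)
  qed
  have 1: "f (map chord ?w) * idem v = (if v = ?s then f (map chord ?w) else 0)"
    using multilinear_idem_right[OF assms(1), of as a v] word as by simp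
  have 2: "gauge_solution (\<lambda>ws. f (map chord ws)) c [] ((r # q) # ws) * idem v =
      (if v = ?s then gauge_solution (\<lambda>ws. f (map chord ws)) c [] ((r # q) # ws) else 0)"
    if "ds = []"
  proof -
    have "chord_word ((r # q) # ws)" "length [] + length ((r # q) # ws) = n"
      "[] @ concat ((r # q) # ws) \<noteq> []"
      using word 4(4) that by simp_all
    from 4(1)[OF that 4(2) this] show ?thesis
      by (simp only: append_Nil)
  qed
  have 3: "chord (r # q) * idem v = (if v = ?s then chord (r # q) else 0)" if "ws = []"
    using chord_idem[of "r # q" v] word that by simp
  have "?s = target (last (ds @ concat ((p # r # q) # ws)))"
    by simp
  then show ?case
    using 1 2 3 unfolding gauge_solution.simps(4) distrib_right
    by (cases "ds = []"; cases "ws = []")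
      (simp_all add: mult.assoc del: gauge_solution.simps concat.simps list.map)
qed simp_all

lemma homog_list_chords:
  assumes "chord_word ws"
  shows "homog_list (map chord ws) (map path_degree ws)"
  using assms by (auto simp: homog_list_def list_all2_conv_all_nth ascending_is_path
      intro!: homog_monomial)

lemma Gamma_prod_path_degree: "Gamma_prod (map path_degree ws) = path_degree (concat ws)"
  by (induction ws) (simp_all add: path_degree_append)

lemma graded_chords:
  "graded d f \<Longrightarrow> chord_word ws \<Longrightarrow> ws \<noteq> [] \<Longrightarrow>
    f (map chord ws) \<in> homog (shift (int (length ws) + d) 0 (path_degree (concat ws)))"
  using gradedD[of d f "map chord ws" "map path_degree ws"] homog_list_chords
  by (simp add: Gamma_prod_path_degree)

lemma concat_letters [simp]: "concat (letters ds) = ds"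
  by (induction ds) auto

lemma gauge_solution_homog:
  assumes "graded d f"
    and "\<And>ds. length ds = n \<Longrightarrow> c ds \<in> homog (shift (int n + 1 + d) 0 (path_degree ds))"
    and "chord_word ws" "length ds + length ws = n"
  shows "gauge_solution (\<lambda>ws. f (map chord ws)) c ds ws \<in>
    homog (shift (int n + 1 + d) 0 (path_degree (ds @ concat ws)))"
  using assms(2-)
proof (induction "\<lambda>ws. f (map chord ws)" c ds ws rule: gauge_solution.induct)
  case (3 c ds p ws)
  then show ?case by (simp add: homogeneous.zero)
next
  case (4 c ds p r q ws)
  let ?w = "letters ds @ [p] # (r # q) # ws"
  let ?g = "shift (int n + 1 + d) 0 (path_degree (ds @ concat ((p # r # q) # ws)))"
  have word: "chord_word ?w" "chord_word ((r # q) # ws)"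
    using 4(3) by auto
  have "f (map chord ?w) \<in> homog (shift (int (length ?w) + d) 0 (path_degree (concat ?w)))"
    using word(1) by (intro graded_chords[OF assms(1)]) simp_all
  moreover have "shift (int (length ?w) + d) 0 (path_degree (concat ?w)) = ?g"
    using 4(4) by (auto simp: algebra_simps)
  ultimately have 1: "f (map chord ?w) \<in> homog ?g"
    by simp
  have 2: "chord [p] * gauge_solution (\<lambda>ws. f (map chord ws)) c [] ((r # q) # ws) \<in> homog ?g"
    if "ds = []"
  proof -
    have "chord [p] \<in> homog (path_degree [p])"
      by (intro homog_monomial) simp_all
    from homog_mult[OF this 4(1)[OF that 4(2) word(2)]] 4(4) that
    show ?thesis
      by (simp del: gauge_solution.simps add: path_degree_append[symmetric])
  qed
  have 3: "c (ds @ [p]) * chord (r # q) \<in> homog ?g" if "ws = []"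
  proof -
    have "chord (r # q) \<in> homog (path_degree (r # q))"
      using word(2) by (intro homog_monomial) (simp_all add: ascending_is_path[of "r # q", simplified])
    from homog_mult[OF 4(2)[of "ds @ [p]"] this] 4(4) that
    show ?thesis
      by (simp add: path_degree_append[symmetric])
  qed
  show ?case
    using 1 2 3 unfolding gauge_solution.simps(4)
    by (intro homogeneous.add) (auto simp del: gauge_solution.simps intro: homogeneous.zero)
qed (simp_all add: homogeneous.zero)

lemma descending_composable: "descending ds \<Longrightarrow> composable (letters ds)"
  by (auto simp: successively_map target_next_arrow elim!: successively_mono)

text \<open>Half of the Koszul property: on merge words the equation \<open>\<delta>\<phi> = f\<close> is solvable without any condition on
\<open>f\<close>, and \<open>\<phi>\<close> can be chosen freely on critical words. If \<open>\<delta>\<phi> - f\<close> turns out to be a cocycle that vanishes on critical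
words, then \<open>cocycle_eq_0\<close> shows that \<open>\<phi>\<close> solves the equation everywhere.\<close>

lemma hochschild_solution:
  assumes f: "multilinear f" "graded d f" and n: "n \<noteq> 0"
    and c: "\<And>ds v. length ds = n \<Longrightarrow> idem v * c ds = (if v = source (hd ds) then c ds else 0)"
      "\<And>ds v. length ds = n \<Longrightarrow> c ds * idem v = (if v = target (last ds) then c ds else 0)"
      "\<And>ds. length ds = n \<Longrightarrow> c ds \<in> homog (shift (int n + 1 + d) 0 (path_degree ds))"
  obtains \<phi> where "multilinear \<phi>" "graded (d + 1) \<phi>"
    "\<And>xs. length xs \<noteq> n \<Longrightarrow> \<phi> xs = 0"
    "\<And>xs. 1 \<in> set xs \<Longrightarrow> \<phi> xs = 0"
    "\<And>ds. descending ds \<Longrightarrow> length ds = n \<Longrightarrow> \<phi> (map chord (letters ds)) = c ds"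
    "\<And>ws. merge_word ws \<Longrightarrow> length ws = n + 1 \<Longrightarrow> coboundary \<phi> (map chord ws) = f (map chord ws)"
proof -
  define S where "S = gauge_solution (\<lambda>ws. f (map chord ws)) c"
  define W where "W ws = (if length ws = n \<and> composable ws then S [] ws else 0)" for ws
  have ne: "concat ws \<noteq> []" if "chord_word ws" "length ws = n" for ws
    using that n by (cases ws) auto
  show thesis
  proof
    show mult: "multilinear (word_extension W)"
    proof (rule multilinear_word_extension)
      fix w ws v assume w: "chord_word (w # ws)"
      then have "source (hd ([] @ concat (w # ws))) = source (hd w)"
        by (cases w) auto
      then have "idem v * S [] (w # ws) = (if v = source (hd w) then S [] (w # ws) else 0)"
        if "length (w # ws) = n"
        unfolding S_def using gauge_solution_idem_left[OF f(1) c(1) w, of n "[]"] ne[OF w] that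
        by (simp only: append_Nil list.size add_0 simp_thms)
      then show "idem v * W (w # ws) = (if v = source (hd w) then W (w # ws) else 0)"
        by (cases "length (w # ws) = n \<and> composable (w # ws)") (simp_all only: W_def if_True if_False mult_zero_right if_cancel simp_thms)
    next
      fix w ws v assume w: "chord_word (ws @ [w])"
      then have "target (last ([] @ concat (ws @ [w]))) = target (last w)"
        by (cases w) auto
      then have "S [] (ws @ [w]) * idem v = (if v = target (last w) then S [] (ws @ [w]) else 0)"
        if "length (ws @ [w]) = n"
        using gauge_solution_idem_right[OF f(1), of n c v "ws @ [w]" "[]"] c(2) w ne[OF w] that
        by (simp add: S_def)
      then show "W (ws @ [w]) * idem v = (if v = target (last w) then W (ws @ [w]) else 0)"
        by (cases "length (ws @ [w]) = n \<and> composable (ws @ [w])") (simp_all only: W_def if_True if_False mult_zero_left if_cancel simp_thms)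
    qed (simp add: W_def)
    show "word_extension W xs = 0" if "length xs \<noteq> n" for xs
      using that by (intro word_extension_eq_0) (simp add: W_def)
    then show "graded (d + 1) (word_extension W)"
      unfolding graded_def
    proof (intro allI impI, elim conjE)
      fix xs gs
      assume xs: "homog_list xs gs" and z: "\<And>xs. length xs \<noteq> n \<Longrightarrow> word_extension W xs = 0"
      show "word_extension W xs \<in> homog (shift (int (length xs) + (d + 1)) 0 (Gamma_prod gs))"
      proof (cases "length xs = n")
        case True
        have "W ws \<in> homog (shift (int n + 1 + d) 0 (\<one>\<^bsub>Gamma\<^esub> \<otimes>\<^bsub>Gamma\<^esub> path_degree (concat ws)))"
          if "chord_word ws" "length ws = length xs" for ws
          using gauge_solution_homog[OF f(2), of n c ws "[]"] c(3) that True
          by (simp add: W_def S_def homogeneous.zero)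
        from word_extension_homog[OF this xs] True show ?thesis
          by (simp add: algebra_simps)
      qed (simp add: z homogeneous.zero)
    qed
    show "word_extension W xs = 0" if "1 \<in> set xs" for xs
      using that word_extension_one by (metis split_list)
    have W: "word_extension W (map chord ws) = W ws" if "chord_word ws" for ws
      using that by (rule word_extension_chords)
    show crit: "word_extension W (map chord (letters ds)) = c ds" if ds: "descending ds" "length ds = n" for ds
    proof -
      have "composable (letters ds)"
        by (rule descending_composable[OF ds(1)])
      then show ?thesis
        using W[of "letters ds"] ds gauge_solution_critical[OF ds(1), of _ c "[]"]
        by (simp add: W_def S_def)
    qed
    have merge: "word_extension W (map chord ws) = 0" if m: "merge_word ws" for ws
    proof -
      obtain ds p q rest where w: "ws = letters ds @ [p] # q # rest" "descending (ds @ [p])"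
        "q \<noteq> []" "ascending (p # q)" "chord_word rest"
        using m unfolding merge_word_def by (elim exE conjE)
      then have "chord_word ws"
        by (cases q) auto
      then have "word_extension W (map chord ws) = W ws"
        by (rule W)
      also have "\<dots> = 0"
        unfolding W_def S_def w(1) gauge_solution_merge[OF w(2,3,4)] by simp
      finally show ?thesis .
    qed
    show "coboundary (word_extension W) (map chord ws) = f (map chord ws)"
      if m: "merge_word ws" "length ws = n + 1" for ws
    proof -
      obtain ds p q rest where w: "ws = letters ds @ [p] # q # rest" "descending (ds @ [p])"
        "q \<noteq> []" "ascending (p # q)" "chord_word rest"
        using m(1) unfolding merge_word_def by (elim exE conjE)
      have n: "length (letters ds @ [p] # q # rest) = n + 1"
        using m(2) w(1) by simp
      let ?long = "letters ds @ (p # q) # rest"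
      have q: "ascending q"
        using w(3,4) by (cases q) auto
      have long: "chord_word ?long" "chord_word (q # rest)"
        using w q by auto
      show ?thesis
      proof (cases "composable ?long")
        case True
        have "word_extension W (map chord ?long) = S [] ?long"
          using W[OF long(1)] True n by (simp add: W_def)
        also have "\<dots> = f (map chord ws) + (if ds = [] then chord [p] * S [] (q # rest) else 0)
            + (if rest = [] then c (ds @ [p]) * chord q else 0)"
          unfolding S_def gauge_solution_long[OF w(2,3)] w(1) by simp
        finally have L: "word_extension W (map chord ?long) = \<dots>" .
        have A: "(if ds = [] then chord [p] * word_extension W (map chord (q # rest)) else 0) =
            (if ds = [] then chord [p] * S [] (q # rest) else 0)"
        proof (cases "ds = []")
          case T: True
          then have "composable (q # rest)"
            using True w(3) by (cases rest) auto
          then show ?thesis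
            using W[OF long(2)] n T by (simp add: W_def)
        qed simp
        have B: "(if rest = [] then word_extension W (map chord (letters (ds @ [p]))) * chord q else 0) =
            (if rest = [] then c (ds @ [p]) * chord q else 0)"
        proof (cases "rest = []")
          case True
          then show ?thesis
            using crit[of "ds @ [p]"] w(2) n by simp
        qed simp
        \<comment> \<open>The two boundary terms were put into the recursion in order to cancel here.\<close>
        have cancel: "a + x + y + x + y = a" for a x y :: torus_algebra_U
          by (simp add: algebra_simps)
        have "coboundary (word_extension W) (map chord (letters ds @ [p] # q # rest)) =
            word_extension W (map chord ?long)
            + (if ds = [] then chord [p] * word_extension W (map chord (q # rest)) else 0)
            + (if rest = [] then word_extension W (map chord (letters (ds @ [p]))) * chord q else 0)"
          by (rule coboundary_merge[OF slot_additive_word_extension merge w(2,3,4,5) n])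
        then show ?thesis
          unfolding A B L cancel w(1) .
      next
        case False
        \<comment> \<open>If the long word is not composable, neither is the split one; all terms vanish, and the term with \<open>q\<close>
          as last factor does not occur, since without \<open>rest\<close> the long word is composable.\<close>
        have desc: "composable (letters (ds @ [p]))"
          by (rule descending_composable[OF w(2)])
        have "\<not> composable ws"
        proof
          assume "composable ws"
          then have "composable ?long"
            using w(3) unfolding w(1)
            by (cases rest) (auto simp: successively_append_iff)
          then show False using False by blast
        qed
        moreover have "chord_word ws"
          using w q by auto
        ultimately have f0: "f (map chord ws) = 0"
          using multilinear_not_composable[OF f(1)] by blast
        have L: "word_extension W (map chord ?long) = 0"
          using W[OF long(1)] False by (simp add: W_def)
        have A: "(if ds = [] then chord [p] * word_extension W (map chord (q # rest)) else 0) = 0"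
        proof (cases "ds = []")
          case True
          then have "\<not> composable (q # rest)"
            using False w(3) by (cases rest) auto
          then show ?thesis
            using W[OF long(2)] by (simp add: W_def)
        qed simp
        have "rest \<noteq> []"
        proof
          assume "rest = []"
          then have "composable ?long"
            using desc by (auto simp: successively_append_iff)
          then show False using False by blast
        qed
        then show ?thesis
          using coboundary_merge[OF slot_additive_word_extension merge w(2,3,4,5) n]
          unfolding w(1) L A using f0 w(1) by simp
      qed
    qed
  qed
qed

section \<open>The defect of an A-infinity structure\<close>

lemma deconc_last:
  assumes "\<And>a b. a @ b = xs \<Longrightarrow> b \<noteq> [] \<Longrightarrow> \<psi> a b = 0"
  shows "deconc \<psi> xs = \<psi> xs []"
proof (cases xs rule: rev_cases)
  case (snoc ys y)
  have "deconc (\<lambda>a b. \<psi> a (b @ [y])) ys = 0"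
    by (rule deconc_eq_0) (auto intro: assms simp: snoc)
  then show ?thesis
    by (simp add: snoc deconc_append_Cons)
qed simp

lemma deconc_last_two:
  assumes "\<And>a b. a @ b = xs \<Longrightarrow> length b \<ge> 2 \<Longrightarrow> \<psi> a b = 0"
  shows "deconc \<psi> xs = \<psi> xs [] + (if xs = [] then 0 else \<psi> (butlast xs) [last xs])"
proof (cases xs rule: rev_cases)
  case (snoc ys y)
  have "deconc (\<lambda>a b. \<psi> a (b @ [y])) ys = \<psi> ys [y]"
  proof (rule trans[OF deconc_last])
    fix a b assume "a @ b = ys" "b \<noteq> []"
    then show "\<psi> a (b @ [y]) = 0"
      by (intro assms) (auto simp: snoc Suc_le_eq)
  qed simp
  then show ?thesis
    by (simp add: snoc deconc_append_Cons add.commute)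
qed simp

lemma insertion_sum_whole:
  assumes "\<And>a. length a \<ge> 2 \<Longrightarrow> \<phi> a = 0"
  shows "insertion_sum \<phi> g xs = (if xs = [] then 0 else \<phi> [g xs])"
proof (cases xs)
  case (Cons x ys)
  have "deconc (\<lambda>a b. \<phi> (g (x # a) # b)) ys = \<phi> [g (x # ys)]"
    by (rule deconc_last) (auto intro!: assms simp: Suc_le_eq)
  moreover have "insertion_sum (\<lambda>ys. \<phi> (x # ys)) g ys = 0"
    by (rule insertion_sum_eq_0) (auto intro!: assms)
  ultimately show ?thesis
    by (simp add: Cons insertion_sum_Cons)
qed simp

text \<open>If the inner map vanishes on short windows, only the windows that omit at most one argument remain.\<close>

lemma insertion_sum_long_windows:
  assumes add: "slot_additive \<phi>" and n: "length xs = n + 1" "n \<noteq> 0"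
    and e: "\<And>a b c. xs = a @ b @ c \<Longrightarrow> b \<noteq> [] \<Longrightarrow> length b < n \<Longrightarrow> e b = 0"
  shows "insertion_sum \<phi> e xs = \<phi> [e (butlast xs), last xs] + \<phi> [hd xs, e (tl xs)] + \<phi> [e xs]"
proof -
  obtain x ys where xs: "xs = x # ys" "length ys = n"
    using n(1) by (cases xs) auto
  then obtain y ys' where ys: "ys = y # ys'"
    using n(2) by (cases ys) auto
  have 0: "\<phi> (0 # zs) = 0" for zs
    using slot_additive_0[OF add, of "[]"] by simp
  have z: "\<phi> (x # 0 # zs) = 0" for zs
    using slot_additive_0[OF add, of "[x]"] by simp
  have "deconc (\<lambda>a b. \<phi> (e (x # a) # b)) ys = \<phi> [e xs] + \<phi> [e (x # butlast ys), last ys]"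
  proof (subst deconc_last_two)
    fix a b assume "a @ b = ys" "length b \<ge> 2"
    then have "e (x # a) = 0"
      using xs by (intro e[of "[]" _ b]) auto
    then show "\<phi> (e (x # a) # b) = 0" by (simp add: 0)
  qed (simp_all add: xs ys)
  moreover have "deconc (\<lambda>a b. \<phi> (x # e (y # a) # b)) ys' = \<phi> [x, e ys]"
  proof (subst deconc_last)
    fix a b assume "a @ b = ys'" "b \<noteq> []"
    then have "e (y # a) = 0"
      using xs ys by (intro e[of "[x]" _ b]) auto
    then show "\<phi> (x # e (y # a) # b) = 0" by (simp add: z)
  qed (simp add: ys)
  moreover have "insertion_sum (\<lambda>zs. \<phi> (x # y # zs)) e ys' = 0"
  proof (rule insertion_sum_eq_0)
    fix a b c assume "ys' = a @ b @ c" "b \<noteq> []"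
    then have "e b = 0"
      using xs ys by (intro e[of "x # y # a" _ c]) auto
    then show "\<phi> (x # y # a @ [e b] @ c) = 0"
      using slot_additive_0[OF add, of "x # y # a" c] by simp
  qed
  ultimately show ?thesis
    using ys by (simp add: xs(1) insertion_sum_Cons[of _ _ x] insertion_sum_Cons[of _ _ y] add_ac)
qed

lemma short_list_cases:
  obtains "xs = []" | x where "xs = [x]" | x y where "xs = [x, y]" | "3 \<le> length xs"
proof (cases xs)
  case (Cons x ys)
  then show thesis
    using that by (cases ys; cases "tl ys") auto
qed

text \<open>If the outer map vanishes on short lists, a longer window shortens the list too much, so that only the
product can be inserted.\<close>

lemma insertion_sum_multiply:
  assumes add: "slot_additive \<phi>"
    and \<phi>: "\<And>ys. ys \<noteq> [] \<Longrightarrow> length ys + 1 < length xs \<Longrightarrow> \<phi> ys = 0"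
    and g: "\<And>x. g [x] = 0" "\<And>x y. g [x, y] = x * y"
  shows "insertion_sum \<phi> g xs = insertion_sum \<phi> multiply xs"
proof (rule insertion_sum_cong)
  fix a b c assume xs: "xs = a @ b @ c" "b \<noteq> []"
  show "\<phi> (a @ [g b] @ c) = \<phi> (a @ [multiply b] @ c)"
  proof (cases b rule: short_list_cases)
    case 4
    then have "multiply b = 0"
      by (auto simp: multiply_def split: list.split)
    moreover have "\<phi> (a @ [g b] @ c) = 0"
      using 4 xs by (intro \<phi>) auto
    ultimately show ?thesis
      using slot_additive_0[OF add] by simp
  qed (use xs in \<open>simp_all add: g multiply_def\<close>)
qed

lemma insertion_sum_add_right:
  assumes "slot_additive \<phi>"
  shows "insertion_sum \<phi> (\<lambda>ys. g ys + h ys) xs = insertion_sum \<phi> g xs + insertion_sum \<phi> h xs"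
  using assms unfolding insertion_sum_def
  by (simp add: sum.distrib slot_additive_def hom_add_def)

text \<open>A window containing the unit contributes only when it has two entries; the unit then disappears, once
against each neighbour.\<close>

lemma insertion_sum_unit:
  fixes \<phi> :: cochain
  assumes add: "slot_additive \<phi>"
    and g: "\<And>x y. g [x, y] = x * y" "\<And>ys. 1 \<in> set ys \<Longrightarrow> length ys \<noteq> 2 \<Longrightarrow> g ys = 0"
  shows "insertion_sum \<phi> g (xs @ 1 # ys) =
    insertion_sum (\<lambda>a. \<phi> (a @ 1 # ys)) g xs + insertion_sum (\<lambda>b. \<phi> (xs @ 1 # b)) g ys
    + ((if xs = [] then 0 else \<phi> (xs @ ys)) + (if ys = [] then 0 else \<phi> (xs @ ys)))"
proof -
  note 0 = slot_additive_0[OF add]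
  define J where "J = (\<lambda>a b. deconc (\<lambda>c d. \<phi> (a @ g (b @ 1 # c) # d)) ys)"
  have J0: "J a [] = (if ys = [] then 0 else \<phi> (a @ ys))" for a
  proof (cases ys)
    case (Cons y ys')
    have "deconc (\<lambda>c d. \<phi> (a @ g (1 # y # c) # d)) ys' = \<phi> (a @ y # ys')"
      by (cases ys') (auto intro!: deconc_eq_0 simp: g 0)
    then show ?thesis
      by (simp add: J_def Cons g 0)
  qed (simp add: J_def g 0)
  have J1: "J a [x] = \<phi> (a @ x # ys)" for a x
    by (cases ys) (auto intro!: deconc_eq_0 simp: J_def g 0)
  have J2: "J a b = 0" if "length b \<ge> 2" for a b
    unfolding J_def by (rule deconc_eq_0) (use that in \<open>simp add: g 0\<close>)
  have "deconc J xs = J xs [] + (if xs = [] then 0 else J (butlast xs) [last xs])"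
    by (rule deconc_last_two) (rule J2)
  also have "\<dots> = (if xs = [] then 0 else \<phi> (xs @ ys)) + (if ys = [] then 0 else \<phi> (xs @ ys))"
    by (cases xs rule: rev_cases) (simp_all add: J0 J1)
  finally have "deconc (\<lambda>a b. deconc (\<lambda>c d. \<phi> (a @ g (b @ 1 # c) # d)) ys) xs = \<dots>"
    by (simp add: J_def)
  then show ?thesis
    by (simp add: insertion_sum_mid algebra_simps)
qed

definition unital_structure :: "cochain \<Rightarrow> bool" where
  "unital_structure \<mu> \<longleftrightarrow> multilinear \<mu> \<and> (\<forall>x. \<mu> [x] = 0) \<and> (\<forall>x y. \<mu> [x, y] = x * y) \<and>
    (\<forall>xs. 1 \<in> set xs \<and> length xs \<noteq> 2 \<longrightarrow> \<mu> xs = 0)"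

lemma unital_structureD:
  assumes "unital_structure \<mu>"
  shows "multilinear \<mu>" "slot_additive \<mu>" "\<mu> [x] = 0" "\<mu> [x, y] = x * y"
    "1 \<in> set xs \<Longrightarrow> length xs \<noteq> 2 \<Longrightarrow> \<mu> xs = 0"
  using assms multilinear_additive by (auto simp: unital_structure_def)

text \<open>Multiplying the unit with its left and with its right neighbour gives the same list. At an end of the
list the missing neighbour is replaced by the outer product with the unit.\<close>

lemma defect_unital:
  assumes \<mu>: "unital_structure \<mu>" and "1 \<in> set zs"
  shows "insertion_sum \<mu> \<mu> zs = 0"
proof -
  note D = unital_structureD[OF \<mu>]
  obtain xs ys where zs: "zs = xs @ 1 # ys"
    using assms(2) by (meson split_list)
  have 1: "insertion_sum (\<lambda>a. \<mu> (a @ 1 # ys)) \<mu> xs = (if xs = [] \<or> ys \<noteq> [] then 0 else \<mu> xs)"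
  proof (cases "ys = []")
    case True
    then show ?thesis
      by (subst insertion_sum_whole) (auto simp: D)
  next
    case False
    then show ?thesis
      by (auto intro!: insertion_sum_eq_0 D(5))
  qed
  have 2: "insertion_sum (\<lambda>b. \<mu> (xs @ 1 # b)) \<mu> ys = (if ys = [] \<or> xs \<noteq> [] then 0 else \<mu> ys)"
  proof (cases "xs = []")
    case True
    then show ?thesis
      by (subst insertion_sum_whole) (auto simp: D)
  next
    case False
    then show ?thesis
      by (auto intro!: insertion_sum_eq_0 D(5))
  qed
  show ?thesis
    unfolding zs by (subst insertion_sum_unit) (auto simp: D 1 2)
qed

text \<open>The pre-Lie identity gives \<open>E \<circ> \<mu> = \<mu> \<circ> E\<close> for the defect \<open>E\<close>. If \<open>E\<close> vanishes below arity \<open>n\<close>, then in arity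
\<open>n + 1\<close> only the products survive on both sides, and this is the cocycle condition.\<close>

lemma defect_cocycle:
  assumes \<mu>: "unital_structure \<mu>"
    and E: "\<And>ys. ys \<noteq> [] \<Longrightarrow> length ys < n \<Longrightarrow> insertion_sum \<mu> \<mu> ys = 0"
    and n: "length xs = n + 1" "n \<noteq> 0"
  shows "coboundary (insertion_sum \<mu> \<mu>) xs = 0"
proof -
  note D = unital_structureD[OF \<mu>]
  have add: "slot_additive (insertion_sum \<mu> \<mu>)"
    by (intro slot_additive_insertion_sum D)
  have "insertion_sum (insertion_sum \<mu> \<mu>) \<mu> xs = insertion_sum (insertion_sum \<mu> \<mu>) multiply xs"
    using n by (intro insertion_sum_multiply add E D) auto
  moreover have "insertion_sum \<mu> (insertion_sum \<mu> \<mu>) xs =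
      insertion_sum \<mu> \<mu> (butlast xs) * last xs + hd xs * insertion_sum \<mu> \<mu> (tl xs)"
    using insertion_sum_long_windows[OF D(2) n, of "insertion_sum \<mu> \<mu>"] E by (simp add: D)
  moreover have "insertion_sum (insertion_sum \<mu> \<mu>) \<mu> xs = insertion_sum \<mu> (insertion_sum \<mu> \<mu>) xs"
    by (rule insertion_sum_pre_Lie[OF D(2)]) simp
  ultimately show ?thesis
    by (simp add: coboundary_def algebra_simps)
qed

section \<open>Descending words of arrows\<close>

lemma descending_four:
  assumes "descending ds" "length ds = 4"
  shows "ds \<in> {[Arrow1, Arrow4, Arrow3, Arrow2], [Arrow2, Arrow1, Arrow4, Arrow3],
    [Arrow3, Arrow2, Arrow1, Arrow4], [Arrow4, Arrow3, Arrow2, Arrow1]}"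
proof -
  obtain a b c d where ds: "ds = [a, b, c, d]"
    using assms(2) by (auto simp: length_Suc_conv numeral_eq_Suc)
  show ?thesis
    using assms(1) unfolding ds by (cases d) auto
qed

lemma descending_sublist:
  assumes "descending ds" "map chord (letters ds) = a @ b @ c"
  obtains bs where "b = map chord (letters bs)" "descending bs" "length bs = length b"
proof -
  define bs where "bs = take (length b) (drop (length a) ds)"
  have b: "b = map chord (letters bs)"
    unfolding bs_def take_map[symmetric] drop_map[symmetric] assms(2) by simp
  have "ds = take (length a) ds @ bs @ drop (length b) (drop (length a) ds)"
    unfolding bs_def by (simp only: append_take_drop_id)
  then have "descending (take (length a) ds @ bs @ drop (length b) (drop (length a) ds))"
    using assms(1) by (simp only:)
  then have "descending bs"
    by (simp only: successively_append_iff)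
  moreover have "length bs = length b"
    using b by simp
  ultimately show thesis
    using that b by blast
qed

lemma chord_descending_pair: "descending [a, b] \<Longrightarrow> chord [a] * chord [b] = 0"
  using chord_mult[of "[a]" "[b]"] by auto

lemma descending_four_source: "descending ds \<Longrightarrow> length ds = 4 \<Longrightarrow> target (last ds) = source (hd ds)"
  using descending_four[of ds] by auto

section \<open>Existence\<close>

text \<open>The values of the operations on critical words: \<open>U\<close> times the idempotent at the start for the four
descending cycles.\<close>

definition four_cycle :: "arrow list \<Rightarrow> torus_algebra_U" where
  "four_cycle ds =
    (if descending ds \<and> length ds = 4 then monomial 1 (source (hd ds)) [] else 0)"

text \<open>All operations of arity less than \<open>n\<close> have been chosen and the higher ones are zero. The relation in
arity \<open>n\<close> involves \<open>\<mu>\<^sub>n\<close> only together with \<open>\<mu>\<^sub>1 = 0\<close>, so it is already required.\<close>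

definition partial_deformation :: "nat \<Rightarrow> cochain \<Rightarrow> bool" where
  "partial_deformation n \<mu> \<longleftrightarrow> unital_structure \<mu> \<and> graded (- 2) \<mu> \<and>
    (\<forall>xs. n \<le> length xs \<longrightarrow> \<mu> xs = 0) \<and>
    (\<forall>xs. xs \<noteq> [] \<and> length xs \<le> n \<longrightarrow> insertion_sum \<mu> \<mu> xs = 0) \<and>
    (\<forall>ds. descending ds \<and> 3 \<le> length ds \<and> length ds < n \<longrightarrow>
      \<mu> (map chord (letters ds)) = four_cycle ds)"

lemma multiply_length: "length xs \<noteq> 2 \<Longrightarrow> multiply xs = 0"
  by (auto simp: multiply_def split: list.split)

lemma multiply_pair [simp]: "multiply [x, y] = x * y"
  by (simp add: multiply_def)

lemma unital_structure_multiply: "unital_structure multiply"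
proof -
  have "multilinear multiply"
  proof (rule multilinearI)
    have "hom_add (\<lambda>x. multiply (xs @ x # ys))" for xs ys
    proof (cases "length xs + length ys = 1")
      case True
      then consider y where "xs = []" "ys = [y]" | z where "xs = [z]" "ys = []"
        by (cases xs; cases ys) auto
      then show ?thesis
        by cases (simp_all add: hom_add_mult_left hom_add_mult_right)
    qed (simp add: multiply_length hom_add_def)
    then show "slot_additive multiply"
      by (simp add: slot_additive_def)
    fix k v x xs
    let ?c = "monomial k v []"
    show "multiply ((?c * x) # xs) = ?c * multiply (x # xs)"
    proof (cases "length xs = 1")
      case True
      then show ?thesis by (cases xs) (auto simp: mult.assoc)
    qed (simp add: multiply_length)
    show "multiply (xs @ [x * ?c]) = multiply (xs @ [x]) * ?c"
    proof (cases "length xs = 1")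
      case True
      then show ?thesis by (cases xs) (auto simp: mult.assoc)
    qed (simp add: multiply_length)
    fix y ys
    show "multiply (xs @ (x * ?c) # y # ys) = multiply (xs @ x # (?c * y) # ys)"
    proof (cases "xs = [] \<and> ys = []")
      case True
      then show ?thesis by (simp add: mult.assoc)
    qed (auto simp: multiply_length)
  qed
  then show ?thesis
    by (simp add: unital_structure_def multiply_length)
qed

lemma partial_deformation_multiply: "partial_deformation 3 multiply"
proof -
  have "graded (- 2) multiply"
    unfolding graded_def
  proof (intro allI impI, elim conjE)
    fix xs gs assume hom: "homog_list xs gs"
    show "multiply xs \<in> homog (shift (int (length xs) + - 2) 0 (Gamma_prod gs))"
    proof (cases "length xs = 2")
      case True
      then obtain x y where xs: "xs = [x, y]"
        by (auto simp: numeral_eq_Suc length_Suc_conv)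
      then obtain g h where "gs = [g, h]" "x \<in> homog g" "y \<in> homog h"
        using hom unfolding xs homog_list_def list_all2_Cons1 list_all2_Nil by blast
      then show ?thesis
        using homog_mult[of x g y h] by (simp add: xs)
    qed (simp add: multiply_length homogeneous.zero)
  qed
  moreover have "insertion_sum multiply multiply xs = 0" if "xs \<noteq> []" "length xs \<le> 3" for xs
  proof -
    show ?thesis
    proof (cases xs rule: short_list_cases)
      case 4
      then have "length xs = 3"
        using that by simp
      then obtain x y z where "xs = [x, y, z]"
        by (auto simp: numeral_eq_Suc length_Suc_conv)
      then show ?thesis
        by (simp add: insertion_sum_Cons multiply_def mult.assoc)
    qed (use that in \<open>simp_all add: insertion_sum_Cons multiply_def\<close>)
  qed
  moreover have "multiply xs = 0" if "3 \<le> length xs" for xs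
    using that by (auto simp: multiply_def split: list.split)
  ultimately show ?thesis
    using unital_structure_multiply by (auto simp: partial_deformation_def)
qed

lemma four_cycle_homog:
  assumes "length ds = n"
  shows "four_cycle ds \<in> homog (shift (int n + 1 + - 3) 0 (path_degree ds))"
proof (cases "descending ds \<and> length ds = 4")
  case True
  then have "shift (- 2 * int 1) (int 1) (path_degree []) = shift (int n + 1 + - 3) 0 (path_degree ds)"
    using descending_four[of ds] assms
    by (auto simp: path_degree_Cons Gamma_mult Gamma_one)
  then have "monomial 1 (source (hd ds)) [] \<in> homog (shift (int n + 1 + - 3) 0 (path_degree ds))"
    by (intro homog_monomial) simp
  then show ?thesis
    using True by (simp add: four_cycle_def)
qed (auto simp: four_cycle_def homogeneous.zero)

text \<open>The only windows with a nonzero operation have length four and return \<open>U\<close> times an idempotent, which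
  makes the outer operation vanish unless it is the product. This leaves words of length five, where
  the two terms agree because the first and the last arrow do.\<close>

lemma defect_critical:
  assumes \<mu>: "unital_structure \<mu>"
    and critical: "\<And>ds. descending ds \<Longrightarrow> 3 \<le> length ds \<Longrightarrow> length ds < length es \<Longrightarrow>
      \<mu> (map chord (letters ds)) = four_cycle ds"
    and es: "descending es" "4 \<le> length es"
  shows "insertion_sum \<mu> \<mu> (map chord (letters es)) = 0"
proof -
  note D = unital_structureD[OF \<mu>]
  note zero = slot_additive_0[OF D(2)]
  have window: "\<mu> b = 0 \<or> length b = 4"
    if abc: "map chord (letters es) = a @ b @ c" and ne: "b \<noteq> []" and len: "length b < length es" for a b c
  proof -
    obtain bs where bs: "b = map chord (letters bs)" "descending bs" "length bs = length b"
      using descending_sublist[OF es(1) abc] by blast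
    show ?thesis
    proof (cases bs rule: short_list_cases)
      case (3 d e)
      then show ?thesis
        using bs chord_descending_pair[of d e] by (simp add: D)
    next
      case 4
      then have "\<mu> b = four_cycle bs"
        using critical[OF bs(2) 4] bs(1) len unfolding bs(3) by (simp only:)
      then show ?thesis
        using bs(3) by (simp add: four_cycle_def)
    qed (use ne bs in \<open>auto simp: D\<close>)
  qed
  show ?thesis
  proof (cases "length es = 5")
    case True
    have sum: "insertion_sum \<mu> \<mu> (map chord (letters es)) =
        \<mu> (butlast (map chord (letters es))) * last (map chord (letters es))
        + hd (map chord (letters es)) * \<mu> (tl (map chord (letters es)))"
    proof (subst insertion_sum_long_windows[OF D(2), of _ 4])
      fix a b c assume "map chord (letters es) = a @ b @ c" "b \<noteq> []" "length b < 4"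
      then show "\<mu> b = 0"
        using window[of a b c] True by auto
    qed (simp_all add: True D)
    obtain d ds where ds: "es = d # ds" "descending ds" "length ds = 4"
      using es True by (cases es) (auto simp: successively_Cons)
    have d: "d = next_arrow (hd ds)"
      using es(1) ds by (cases ds) auto
    have last: "butlast es = d # butlast ds" "last es = last ds" "descending (d # butlast ds)"
      "last ds = d" "length (d # butlast ds) = 4" "map chord (letters (d # butlast ds)) = butlast (map chord (letters es))"
      using descending_four[OF ds(2,3)] d unfolding ds(1) by auto
    have "\<mu> (map chord (letters (d # butlast ds))) = monomial 1 (source d) []"
      using critical[OF last(3)] last(3,5) True by (simp add: four_cycle_def)
    then have 1: "\<mu> (butlast (map chord (letters es))) = monomial 1 (source d) []"
      by (simp only: last(6))
    have 2: "\<mu> (tl (map chord (letters es))) = monomial 1 (source (hd ds)) []"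
      using critical[OF ds(2)] ds True by (simp add: four_cycle_def)
    have 3: "last (map chord (letters es)) = chord [d]" "hd (map chord (letters es)) = chord [d]"
      using ds last by (auto simp: last_map)
    show ?thesis
      unfolding sum 1 2 3 by (simp add: monomial_mult d target_next_arrow)
  next
    case False
    show ?thesis
    proof (rule insertion_sum_eq_0)
      fix a b c assume abc: "map chord (letters es) = a @ b @ c" "b \<noteq> []"
      obtain bs where bs: "b = map chord (letters bs)" "descending bs" "length bs = length b"
        using descending_sublist[OF es(1) abc(1)] by blast
      have len: "length es = length a + length b + length c"
        using arg_cong[OF abc(1), of length] by simp
      consider "length b = length es" | "\<mu> b = 0" | "length b = 4" "length b < length es"
        using window[OF abc] len by linarith
      then show "\<mu> (a @ [\<mu> b] @ c) = 0"
      proof cases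
        case 1
        then show ?thesis
          using len by (simp add: D)
      next
        case 2
        then show ?thesis
          using zero by simp
      next
        case 3
        then have "length bs = 4"
          using bs(3) by (simp only:)
        moreover have "length bs < length es"
          using bs(3) 3(2) by (simp only:)
        ultimately have b: "\<mu> b = monomial 1 (source (hd bs)) []"
          using critical[OF bs(2)] unfolding bs(1) by (simp add: four_cycle_def bs(2))
        have "unital_on (length es - 3) \<mu>"
          using False es(2) by (auto simp: unital_on_def intro!: D(5))
        then have "\<mu> (a @ idem (source (hd bs)) # c) = 0"
          using len 3 by (intro unital_on_idem[OF D(1)]) auto
        then have "\<mu> (a @ (U_pow 1 * idem (source (hd bs))) # c) = 0"
          by (simp only: multilinear_U_pow[OF D(1)] mult_zero_right)
        then show ?thesis
          by (simp add: b U_pow_monomial)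
      qed
    qed
  qed
qed

text \<open>The new operation \<open>\<phi>\<close> changes the defect in arity \<open>n + 1\<close> by its coboundary and does not change it in lower
arities. With \<open>\<phi>\<close> from \<open>hochschild_solution\<close> the new defect is a cocycle that vanishes on merge words, and
by \<open>defect_critical\<close> also on critical words.\<close>

lemma partial_deformation_extend:
  assumes P: "partial_deformation n \<mu>" and n: "3 \<le> n"
  shows "\<exists>\<mu>'. partial_deformation (Suc n) \<mu>' \<and> (\<forall>xs. length xs < n \<longrightarrow> \<mu>' xs = \<mu> xs)"
proof -
  have \<mu>: "unital_structure \<mu>" and gr: "graded (- 2) \<mu>"
    and top: "\<And>xs. n \<le> length xs \<Longrightarrow> \<mu> xs = 0"
    and def: "\<And>xs. xs \<noteq> [] \<Longrightarrow> length xs \<le> n \<Longrightarrow> insertion_sum \<mu> \<mu> xs = 0"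
    and crit: "\<And>ds. descending ds \<Longrightarrow> 3 \<le> length ds \<Longrightarrow> length ds < n \<Longrightarrow>
      \<mu> (map chord (letters ds)) = four_cycle ds"
    using P by (auto simp: partial_deformation_def)
  note D = unital_structureD[OF \<mu>]
  have mult: "multilinear (insertion_sum \<mu> \<mu>)"
    by (intro multilinear_insertion_sum D)
  have grE: "graded (- 3) (insertion_sum \<mu> \<mu>)"
    using graded_insertion_sum[OF gr gr] by simp
  have c1: "idem v * four_cycle ds = (if v = source (hd ds) then four_cycle ds else 0)" for v ds
    by (simp add: four_cycle_def monomial_mult)
  have c2: "four_cycle ds * idem v = (if v = target (last ds) then four_cycle ds else 0)" for v ds
    by (auto simp: four_cycle_def monomial_mult descending_four_source)
  have n0: "n \<noteq> 0"
    using n by simp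
  obtain \<phi> where \<phi>: "multilinear \<phi>" "graded (- 3 + 1) \<phi>"
    "\<And>xs. length xs \<noteq> n \<Longrightarrow> \<phi> xs = 0" "\<And>xs. 1 \<in> set xs \<Longrightarrow> \<phi> xs = 0"
    "\<And>ds. descending ds \<Longrightarrow> length ds = n \<Longrightarrow> \<phi> (map chord (letters ds)) = four_cycle ds"
    "\<And>ws. merge_word ws \<Longrightarrow> length ws = n + 1 \<Longrightarrow>
      coboundary \<phi> (map chord ws) = insertion_sum \<mu> \<mu> (map chord ws)"
    by (rule hochschild_solution[OF mult grE n0 c1 c2 four_cycle_homog])
      (assumption | rule that)+
  define \<mu>' where "\<mu>' xs = \<mu> xs + \<phi> xs" for xs
  have low: "\<mu>' xs = \<mu> xs" if "length xs < n" for xs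
    using that by (simp add: \<mu>'_def \<phi>(3))
  have sum: "\<mu>' = (\<lambda>xs. \<mu> xs + \<phi> xs)"
    by (simp add: \<mu>'_def fun_eq_iff)
  have \<mu>': "unital_structure \<mu>'"
    using D \<phi> n multilinear_add[OF D(1) \<phi>(1)] unfolding unital_structure_def sum by auto
  note D' = unital_structureD[OF \<mu>']
  have top': "\<mu>' xs = 0" if "Suc n \<le> length xs" for xs
    using that by (simp add: \<mu>'_def top \<phi>(3))
  have crit': "\<mu>' (map chord (letters ds)) = four_cycle ds"
    if "descending ds" "3 \<le> length ds" "length ds < n + 1" for ds
  proof (cases "length ds = n")
    case True
    then show ?thesis
      using \<phi>(5)[OF that(1) True] by (simp add: \<mu>'_def top)
  next
    case False
    then have "length ds < n"
      using that(3) by simp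
    then show ?thesis
      using crit[OF that(1,2)] by (simp add: low)
  qed
  have def_low: "insertion_sum \<mu>' \<mu>' xs = 0" if "xs \<noteq> []" "length xs \<le> n" for xs
  proof -
    have "insertion_sum \<mu>' \<mu>' xs = insertion_sum \<mu> \<mu> xs"
    proof (rule insertion_sum_cong)
      fix a b c assume xs: "xs = a @ b @ c" "b \<noteq> []"
      then have len: "length a + length b + length c \<le> n"
        using that(2) by simp
      consider x where "b = [x]" | "length b \<ge> 2" "length b < n" | "length a = 0" "length c = 0"
      proof (cases "length b < n")
        case True
        then show ?thesis
          using that xs(2) by (cases b rule: short_list_cases) auto
      next
        case False
        then have "length a = 0" "length c = 0"
          using len by linarith+
        then show ?thesis by (rule that(3))
      qed
      then show "\<mu>' (a @ [\<mu>' b] @ c) = \<mu> (a @ [\<mu> b] @ c)"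
      proof cases
        case 1
        then show ?thesis
          using slot_additive_0[OF D(2)] slot_additive_0[OF D'(2)] by (simp add: D D')
      next
        case 2
        then show ?thesis
          using xs that(2) by (simp add: low)
      next
        case 3
        then show ?thesis by (simp add: D D')
      qed
    qed
    then show ?thesis
      using def that by simp
  qed
  have def_n: "insertion_sum \<mu>' \<mu>' xs = insertion_sum \<mu> \<mu> xs + coboundary \<phi> xs"
    if "length xs = n + 1" for xs
  proof -
    have "insertion_sum \<mu>' \<mu>' xs = insertion_sum \<mu> \<mu>' xs + insertion_sum \<phi> \<mu>' xs"
      unfolding sum by (rule insertion_sum_add_left)
    also have "insertion_sum \<mu> \<mu>' xs = insertion_sum \<mu> \<mu> xs + insertion_sum \<mu> \<phi> xs"
      unfolding sum by (rule insertion_sum_add_right[OF D(2)])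
    also have "insertion_sum \<mu> \<phi> xs = \<phi> (butlast xs) * last xs + hd xs * \<phi> (tl xs)"
      using insertion_sum_long_windows[OF D(2) that, of \<phi>] n by (simp add: \<phi>(3) D)
    also have "insertion_sum \<phi> \<mu>' xs = insertion_sum \<phi> multiply xs"
      using that n by (intro insertion_sum_multiply multilinear_additive \<phi> D') auto
    finally show ?thesis
      by (simp add: coboundary_def algebra_simps)
  qed
  have "insertion_sum \<mu>' \<mu>' xs = 0" if xs: "length xs = n + 1" for xs
  proof (rule cocycle_eq_0[where n = "n + 1"])
    show "multilinear (insertion_sum \<mu>' \<mu>')"
      by (intro multilinear_insertion_sum D')
    show "unital_on (n + 1) (insertion_sum \<mu>' \<mu>')"
      using defect_unital[OF \<mu>'] by (simp add: unital_on_def)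
    show "coboundary (insertion_sum \<mu>' \<mu>') (map chord ws) = 0" if "length ws = n + 1 + 1" for ws
      using that by (intro defect_cocycle[OF \<mu>', of "n + 1"] def_low) auto
    show "insertion_sum \<mu>' \<mu>' (map chord ws) = 0" if "merge_word ws" "length ws = n + 1" for ws
      using that by (simp add: def_n \<phi>(6))
    show "insertion_sum \<mu>' \<mu>' (map chord (letters ds)) = 0" if "descending ds" "length ds = n + 1" for ds
      using that n by (intro defect_critical[OF \<mu>'] crit') auto
  qed (rule xs)
  then have "insertion_sum \<mu>' \<mu>' xs = 0" if "xs \<noteq> []" "length xs \<le> Suc n" for xs
    using that def_low by (cases "length xs = n + 1") auto
  moreover have "graded (- 2) \<mu>'"
    unfolding sum using gr \<phi>(2) by (intro graded_add) simp_all
  ultimately have "partial_deformation (Suc n) \<mu>'"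
    unfolding partial_deformation_def using \<mu>' top' crit' by auto
  then show ?thesis
    using low by blast
qed

text \<open>Stages that settle one arity after the other have a limit, which agrees with a late enough stage on
all lists of bounded length.\<close>

lemma staged_limit:
  assumes base: "P n0 (f0 :: 'a list \<Rightarrow> 'b)"
    and step: "\<And>n f. n0 \<le> n \<Longrightarrow> P n f \<Longrightarrow> \<exists>f'. P (Suc n) f' \<and> (\<forall>xs. length xs < n \<longrightarrow> f' xs = f xs)"
  obtains F f m where "\<And>N. P (m N) (f N)" "\<And>N. N \<le> m N" "\<And>N xs. length xs \<le> N \<Longrightarrow> F xs = f N xs"
proof -
  have "\<exists>S. \<forall>k. P (n0 + k) (S k) \<and> (\<forall>xs. length xs < n0 + k \<longrightarrow> S (Suc k) xs = S k xs)"
    by (rule dependent_nat_choice) (use base step in auto)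
  then obtain S where S: "\<And>k. P (n0 + k) (S k)"
    "\<And>k xs. length xs < n0 + k \<Longrightarrow> S (Suc k) xs = S k xs"
    by blast
  have agree: "S (k + j) xs = S k xs" if "length xs < n0 + k" for k j xs
    using that by (induction j) (simp_all add: S(2))
  define F where "F xs = S (length xs + 1) xs" for xs
  have "F xs = S (N + 1) xs" if "length xs \<le> N" for N xs
    using agree[of xs "N + 1" "length xs + 1"] agree[of xs "length xs + 1" "N + 1"] that
    by (simp add: F_def add.commute)
  then show thesis
    by (intro that[of "\<lambda>N. n0 + (N + 1)" "\<lambda>N. S (N + 1)" F] S(1)) simp_all
qed

lemma multilinear_local:
  assumes "\<And>N. \<exists>f. multilinear f \<and> (\<forall>xs. length xs < N \<longrightarrow> F xs = f xs)"
  shows "multilinear F"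
proof -
  have "\<exists>f. multilinear f \<and> (\<forall>xs. length xs \<le> N \<longrightarrow> F xs = f xs)" for N
    using assms[of "Suc N"] by (simp add: less_Suc_eq_le)
  then obtain f where f: "\<And>N. multilinear (f N)" "\<And>N xs. length xs \<le> N \<Longrightarrow> F xs = f N xs"
    by metis
  have F: "F xs = f (length xs) xs" for xs
    by (rule f(2)) simp
  show ?thesis
  proof (rule multilinearI)
    have "hom_add (\<lambda>x. F (xs @ x # ys))" for xs ys
      using multilinear_additive[OF f(1), THEN slot_additive_D] by (simp add: F)
    then show "slot_additive F"
      by (simp add: slot_additive_def)
  qed (simp_all add: F multilinear_left[OF f(1)] multilinear_right[OF f(1)] multilinear_middle[OF f(1)])
qed

theorem torus_deformation_exists: "\<exists>\<mu>. torus_deformation \<mu>"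
proof -
  obtain \<mu> f m where f: "\<And>N. partial_deformation (m N) (f N)" "\<And>N. N \<le> m N"
    "\<And>N xs. length xs \<le> N \<Longrightarrow> \<mu> xs = f N xs"
    by (rule staged_limit[where P = partial_deformation,
          OF partial_deformation_multiply partial_deformation_extend])
      (assumption | rule that)+
  have us: "unital_structure (f N)" and gr: "graded (- 2) (f N)" for N
    using f(1)[of N] by (auto simp: partial_deformation_def)
  have "multilinear \<mu>"
    by (rule multilinear_local) (metis f(3) less_imp_le us unital_structureD(1))
  have "graded (- 2) \<mu>"
    unfolding graded_def by (metis f(3) order_refl gr graded_def)
  have \<mu>: "unital_structure \<mu>"
    unfolding unital_structure_def using \<open>multilinear \<mu>\<close> unital_structureD(3-5)[OF us] f(3)
    by (metis order_refl)
  have "insertion_sum \<mu> \<mu> xs = 0" if "xs \<noteq> []" for xs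
  proof -
    have "insertion_sum \<mu> \<mu> xs = insertion_sum (f (length xs)) (f (length xs)) xs"
    proof (rule insertion_sum_cong)
      fix a b c assume xs: "xs = a @ b @ c" "b \<noteq> []"
      then have "length (a @ [y] @ c) \<le> length xs" for y
        by (cases b) auto
      then show "\<mu> (a @ [\<mu> b] @ c) = f (length xs) (a @ [f (length xs) b] @ c)"
        using f(3)[of b "length xs"] f(3)[of "a @ [_] @ c" "length xs"] xs by simp
    qed
    also have "\<dots> = 0"
      using f(1,2)[of "length xs"] that by (auto simp: partial_deformation_def)
    finally show ?thesis .
  qed
  moreover have "\<mu> xs = 0" if len: "length xs \<noteq> 2" and iota: "const iota0 \<in> set xs \<or> const iota1 \<in> set xs" for xs
  proof -
    obtain v where "idem v \<in> set xs"
      using iota by (auto simp: const_iota)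
    then obtain ys zs where xs: "xs = ys @ idem v # zs"
      by (meson split_list)
    have "unital_on (length xs) \<mu>"
      using len unital_structureD(5)[OF \<mu>] by (auto simp: unital_on_def)
    then show ?thesis
      using unital_on_idem[OF \<open>multilinear \<mu>\<close>, of "length xs" ys v zs] by (simp add: xs)
  qed
  ultimately have "A_infinity_deformation \<mu>"
    unfolding A_infinity_deformation_def using unital_structureD(1,3,4)[OF \<mu>] by blast
  moreover have crit: "\<mu> (map chord (letters ds)) = four_cycle ds" if "descending ds" "length ds = 4" for ds
    using f(1,2)[of 5] f(3)[of "map chord (letters ds)" 5] that
    by (simp add: partial_deformation_def)
  moreover have "\<mu> [const rho4, const rho3, const rho2, const rho1] = var_U * const iota1"
    using crit[of "[Arrow4, Arrow3, Arrow2, Arrow1]"]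
    by (simp add: rho_eq_monomial const_iota var_U_mult_idem four_cycle_def)
  moreover have "\<mu> [const rho3, const rho2, const rho1, const rho4] = var_U * const iota0"
    using crit[of "[Arrow3, Arrow2, Arrow1, Arrow4]"]
    by (simp add: rho_eq_monomial const_iota var_U_mult_idem four_cycle_def)
  ultimately show ?thesis
    using graded_Gamma_graded[OF \<open>graded (- 2) \<mu>\<close>] unfolding torus_deformation_def by blast
qed

section \<open>The defect of a homomorphism\<close>

lemma deconc_first:
  assumes "\<And>a b. a @ b = xs \<Longrightarrow> a \<noteq> [] \<Longrightarrow> \<psi> a b = 0"
  shows "deconc \<psi> xs = \<psi> [] xs"
proof (cases xs)
  case (Cons x ys)
  have "deconc (\<lambda>a. \<psi> (x # a)) ys = 0"
    by (rule deconc_eq_0) (auto intro: assms simp: Cons)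
  then show ?thesis by (simp add: Cons)
qed simp

lemma block_sum_zero [simp]: "block_sum (\<lambda>_. 0) f xs = 0"
  by (simp add: block_sum_def)

lemma block_sum_eq_0:
  assumes "\<And>bs. bs \<noteq> [] \<Longrightarrow> \<phi> bs = 0" "xs \<noteq> []"
  shows "block_sum \<phi> f xs = 0"
proof -
  have "\<phi> (map f bs) = 0" if "bs \<in> blocks xs" for bs
  proof -
    have "map f bs \<noteq> []"
      using that assms(2) by (auto simp: blocks_def)
    then show ?thesis by (rule assms(1))
  qed
  then show ?thesis
    by (simp add: block_sum_def)
qed

lemma block_sum_whole:
  assumes "\<And>bs. length bs \<ge> 2 \<Longrightarrow> \<phi> bs = 0" "xs \<noteq> []"
  shows "block_sum \<phi> f xs = \<phi> [f xs]"
proof -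
  obtain x ys where xs: "xs = x # ys"
    using assms(2) by (cases xs) auto
  have "deconc (\<lambda>a b. block_sum (\<lambda>cs. \<phi> (f (x # a) # cs)) f b) ys = \<phi> [f (x # ys)]"
    by (rule trans[OF deconc_last])
      (auto intro!: block_sum_eq_0 assms(1) simp: Suc_le_eq)
  then show ?thesis
    by (simp add: xs block_sum_Cons)
qed

lemma block_sum_cong:
  assumes "\<And>b. b \<noteq> [] \<Longrightarrow> length b \<le> length xs \<Longrightarrow> f b = g b"
  shows "block_sum \<phi> f xs = block_sum \<phi> g xs"
proof -
  have "map f bs = map g bs" if bs: "bs \<in> blocks xs" for bs
  proof (rule map_cong[OF refl])
    fix b assume b: "b \<in> set bs"
    then have "length b \<le> length (concat bs)"
      by (induction bs) auto
    then show "f b = g b"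
      using bs b by (intro assms) (auto simp: blocks_def)
  qed
  then show ?thesis
    unfolding block_sum_def by (intro sum.cong refl arg_cong[where f = \<phi>])
qed

lemma marked_sum_short:
  assumes "slot_additive \<phi>" "\<And>b. b \<noteq> [] \<Longrightarrow> length b \<le> length xs \<Longrightarrow> e b = 0"
  shows "marked_sum \<phi> f e xs = 0"
  using assms
proof (induction xs arbitrary: \<phi> rule: length_induct)
  case (1 xs)
  show ?case
  proof (cases xs)
    case (Cons x ys)
    have 0: "\<phi> (0 # zs) = 0" for zs
      using slot_additive_0[OF 1(2), of "[]"] by simp
    show ?thesis
      unfolding Cons marked_sum_Cons
    proof (rule deconc_eq_0)
      fix a b assume ab: "a @ b = ys"
      then have "e (x # a) = 0"
        by (intro 1(3)) (auto simp: Cons)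
      moreover have "marked_sum (\<lambda>ys. \<phi> (f (x # a) # ys)) f e b = 0"
        using ab 1(3) by (intro 1(1)[rule_format] slot_additive_Cons[OF 1(2)]) (auto simp: Cons)
      ultimately show "block_sum (\<lambda>ys. \<phi> (e (x # a) # ys)) f b
          + marked_sum (\<lambda>ys. \<phi> (f (x # a) # ys)) f e b = 0"
        by (simp add: 0)
    qed
  qed simp
qed

lemma marked_sum_whole:
  assumes "slot_additive \<phi>" "\<And>b. b \<noteq> [] \<Longrightarrow> length b < length xs \<Longrightarrow> e b = 0" "xs \<noteq> []"
  shows "marked_sum \<phi> f e xs = \<phi> [e xs]"
proof -
  obtain x ys where xs: "xs = x # ys"
    using assms(3) by (cases xs) auto
  have 0: "\<phi> (0 # zs) = 0" for zs
    using slot_additive_0[OF assms(1), of "[]"] by simp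
  have m: "marked_sum (\<lambda>ys. \<phi> (f (x # a) # ys)) f e b = 0" if "a @ b = ys" for a b
    using that assms(2) by (intro marked_sum_short slot_additive_Cons[OF assms(1)]) (auto simp: xs)
  have "deconc (\<lambda>a b. block_sum (\<lambda>ys. \<phi> (e (x # a) # ys)) f b
      + marked_sum (\<lambda>ys. \<phi> (f (x # a) # ys)) f e b) ys = \<phi> [e (x # ys)]"
  proof (rule trans[OF deconc_last])
    fix a b assume ab: "a @ b = ys" "b \<noteq> []"
    then have "e (x # a) = 0"
      by (intro assms(2)) (auto simp: xs)
    then show "block_sum (\<lambda>ys. \<phi> (e (x # a) # ys)) f b
        + marked_sum (\<lambda>ys. \<phi> (f (x # a) # ys)) f e b = 0"
      using m ab by (simp add: 0)
  qed simp
  then show ?thesis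
    by (simp add: xs marked_sum_Cons)
qed

lemma marked_sum_long_blocks:
  assumes add: "slot_additive \<phi>" and n: "length xs = n + 1" "n \<noteq> 0"
    and e: "\<And>b. b \<noteq> [] \<Longrightarrow> length b < n \<Longrightarrow> e b = 0"
  shows "marked_sum \<phi> f e xs =
    \<phi> [e (butlast xs), f [last xs]] + \<phi> [f [hd xs], e (tl xs)] + \<phi> [e xs]"
proof -
  obtain x ys where xs: "xs = x # ys" "length ys = n"
    using n(1) by (cases xs) auto
  then have ys: "ys \<noteq> []"
    using n(2) by auto
  have 0: "\<phi> (0 # zs) = 0" for zs
    using slot_additive_0[OF add, of "[]"] by simp
  have "deconc (\<lambda>a b. block_sum (\<lambda>cs. \<phi> (e (x # a) # cs)) f b) ys =
      \<phi> [e xs] + \<phi> [e (x # butlast ys), f [last ys]]"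
  proof (subst deconc_last_two)
    fix a b assume "a @ b = ys" "length b \<ge> 2"
    then have "e (x # a) = 0"
      using xs by (intro e) auto
    then show "block_sum (\<lambda>cs. \<phi> (e (x # a) # cs)) f b = 0" by (simp add: 0)
  qed (simp_all add: xs ys block_sum_Cons)
  moreover have "deconc (\<lambda>a b. marked_sum (\<lambda>cs. \<phi> (f (x # a) # cs)) f e b) ys = \<phi> [f [x], e ys]"
  proof (subst deconc_first)
    fix a b assume "a @ b = ys" "a \<noteq> []"
    then have "length b < n"
      using xs by (cases a) auto
    then show "marked_sum (\<lambda>cs. \<phi> (f (x # a) # cs)) f e b = 0"
      using e by (intro marked_sum_short slot_additive_Cons[OF add]) auto
  next
    show "marked_sum (\<lambda>cs. \<phi> (f [x] # cs)) f e ys = \<phi> [f [x], e ys]"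
      using xs e ys by (intro marked_sum_whole slot_additive_Cons[OF add]) auto
  qed
  ultimately show ?thesis
    using ys by (simp add: xs(1) marked_sum_Cons deconc_add add_ac)
qed

definition unital_map :: "cochain \<Rightarrow> bool" where
  "unital_map f \<longleftrightarrow> multilinear f \<and> (\<forall>x. f [x] = x) \<and>
    (\<forall>xs. 1 \<in> set xs \<and> length xs \<noteq> 1 \<longrightarrow> f xs = 0)"

lemma unital_mapD:
  assumes "unital_map f"
  shows "multilinear f" "slot_additive f" "f [x] = x"
    "1 \<in> set xs \<Longrightarrow> length xs \<noteq> 1 \<Longrightarrow> f xs = 0"
  using assms multilinear_additive by (auto simp: unital_map_def)

text \<open>In characteristic two the difference of the two sides of the homomorphism equation is their sum.\<close>

definition hom_defect ::
  "cochain \<Rightarrow> cochain \<Rightarrow>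
   cochain \<Rightarrow> cochain" where
  "hom_defect \<mu> \<nu> f xs = block_sum \<nu> f xs + insertion_sum f \<mu> xs"

text \<open>The unit can only form a block of its own, which then has to meet the product \<open>\<nu>\<^sub>2\<close> at an end of the list.
These terms cancel against the products of the unit with its neighbours.\<close>

lemma hom_defect_unital:
  assumes \<mu>: "unital_structure \<mu>" and \<nu>: "unital_structure \<nu>" and f: "unital_map f"
    and "1 \<in> set zs"
  shows "hom_defect \<mu> \<nu> f zs = 0"
proof -
  note M = unital_structureD[OF \<mu>] and N = unital_structureD[OF \<nu>] and F = unital_mapD[OF f]
  obtain xs ys where zs: "zs = xs @ 1 # ys"
    using assms(4) by (meson split_list)
  let ?K = "\<lambda>a b c d. block_sum (\<lambda>as. block_sum (\<lambda>ds. \<nu> (as @ f (b @ 1 # c) # ds)) f d) f a"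
  have K0: "?K a b c d = 0" if "b \<noteq> [] \<or> c \<noteq> []" for a b c d
    using that slot_additive_0[OF N(2)] by (simp add: F)
  have "block_sum \<nu> f zs = ?K xs [] [] ys"
    unfolding zs block_sum_mid
    by (subst deconc_last, rule deconc_eq_0, rule K0, simp, rule deconc_first, rule K0, simp)
  also have "\<dots> = (if xs = [] \<and> ys \<noteq> [] then f ys else if xs \<noteq> [] \<and> ys = [] then f xs else 0)"
  proof -
    consider "xs = []" "ys = []" | "xs = []" "ys \<noteq> []" | "xs \<noteq> []" "ys = []" | "xs \<noteq> []" "ys \<noteq> []"
      by blast
    then show ?thesis
    proof cases
      case 1
      then show ?thesis by (simp add: F N)
    next
      case 2
      then show ?thesis
        by (simp add: F) (subst block_sum_whole, auto simp: N)
    next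
      case 3
      then show ?thesis
        by (simp add: F) (subst block_sum_whole, auto simp: N)
    next
      case 4
      have "block_sum (\<lambda>ds. \<nu> (as @ 1 # ds)) f ys = 0" if "as \<noteq> []" for as
      proof (rule block_sum_eq_0)
        fix bs :: "torus_algebra_U list" assume "bs \<noteq> []"
        then show "\<nu> (as @ 1 # bs) = 0"
          using that by (cases as; cases bs) (auto intro!: N(5))
      qed (rule 4)
      then have "block_sum (\<lambda>as. block_sum (\<lambda>ds. \<nu> (as @ 1 # ds)) f ys) f xs = 0"
        using 4 by (auto intro: block_sum_eq_0[where \<phi> = "\<lambda>as. block_sum (\<lambda>ds. \<nu> (as @ 1 # ds)) f ys"])
      then show ?thesis
        using 4 by (simp add: F)
    qed
  qed
  finally have B: "block_sum \<nu> f zs = \<dots>" .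
  have "insertion_sum (\<lambda>a. f (a @ 1 # ys)) \<mu> xs = 0" "insertion_sum (\<lambda>b. f (xs @ 1 # b)) \<mu> ys = 0"
    by (auto intro!: insertion_sum_eq_0 F(4))
  then have "insertion_sum f \<mu> zs =
      (if xs = [] then 0 else f (xs @ ys)) + (if ys = [] then 0 else f (xs @ ys))"
    unfolding zs by (subst insertion_sum_unit[OF F(2) M(4,5)]) auto
  then show ?thesis
    unfolding hom_defect_def B by auto
qed

lemma multilinear_hom_defect:
  "multilinear \<mu> \<Longrightarrow> multilinear \<nu> \<Longrightarrow> multilinear f \<Longrightarrow> multilinear (hom_defect \<mu> \<nu> f)"
  unfolding hom_defect_def[abs_def]
  by (intro multilinear_add multilinear_block_sum multilinear_insertion_sum)

text \<open>Let \<open>E\<close> be the defect. Inserting \<open>\<mu>\<close> into it gives, by \<open>insertion_sum_block_sum\<close> and \<open>\<mu> \<circ> \<mu> = 0\<close>, the marked sum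
of \<open>f \<circ> \<mu>\<close>; by \<open>marked_sum_block_sum\<close> and \<open>\<nu> \<circ> \<nu> = 0\<close> the marked sum of the other half of \<open>E\<close> is zero. So
inserting \<open>\<mu>\<close> into \<open>E\<close> equals marking \<open>E\<close> inside \<open>\<nu>\<close>, and in the lowest arity only products remain.\<close>

lemma hom_defect_cocycle:
  assumes \<mu>: "unital_structure \<mu>" and \<nu>: "unital_structure \<nu>" and f: "unital_map f"
    and \<mu>0: "\<And>xs. xs \<noteq> [] \<Longrightarrow> insertion_sum \<mu> \<mu> xs = 0"
    and \<nu>0: "\<And>xs. xs \<noteq> [] \<Longrightarrow> insertion_sum \<nu> \<nu> xs = 0"
    and E: "\<And>ys. ys \<noteq> [] \<Longrightarrow> length ys < n \<Longrightarrow> hom_defect \<mu> \<nu> f ys = 0"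
    and n: "length xs = n + 1" "n \<noteq> 0"
  shows "coboundary (hom_defect \<mu> \<nu> f) xs = 0"
proof -
  note M = unital_structureD[OF \<mu>] and N = unital_structureD[OF \<nu>] and F = unital_mapD[OF f]
  let ?E = "hom_defect \<mu> \<nu> f"
  have add: "slot_additive ?E"
    by (intro multilinear_additive multilinear_hom_defect M N F)
  have "insertion_sum \<nu> \<nu> xs = 0" for xs
    using \<nu>0 by (cases "xs = []") auto
  then have 1: "marked_sum \<nu> f (block_sum \<nu> f) xs = 0"
    unfolding marked_sum_block_sum[OF N(2)] by (simp add: block_sum_def)
  have "insertion_sum f (insertion_sum \<mu> \<mu>) xs = 0"
    by (rule insertion_sum_eq_0) (simp add: \<mu>0 slot_additive_0[OF F(2)])
  then have 2: "insertion_sum (insertion_sum f \<mu>) \<mu> xs = 0"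
    by (subst insertion_sum_pre_Lie[OF F(2)]) simp_all
  have "marked_sum \<nu> f ?E xs = marked_sum \<nu> f (insertion_sum f \<mu>) xs"
    unfolding hom_defect_def[abs_def] marked_sum_add[OF N(2)] 1 by simp
  also have "\<dots> = insertion_sum (block_sum \<nu> f) \<mu> xs"
    by (rule insertion_sum_block_sum[OF N(2), symmetric])
  also have "\<dots> = insertion_sum ?E \<mu> xs"
    unfolding hom_defect_def[abs_def] insertion_sum_add_left 2 by simp
  also have "\<dots> = insertion_sum ?E multiply xs"
    using n by (intro insertion_sum_multiply add E M) auto
  finally have "insertion_sum ?E multiply xs = marked_sum \<nu> f ?E xs" by simp
  also have "\<dots> = ?E (butlast xs) * last xs + hd xs * ?E (tl xs)"
    using marked_sum_long_blocks[OF N(2) n, of ?E f] E by (simp add: N F)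
  finally show ?thesis
    by (simp add: coboundary_def algebra_simps)
qed

lemma block_sum_perturb_whole:
  fixes \<chi> :: cochain
  assumes add: "slot_additive \<chi>" and \<phi>: "\<And>b. length b \<noteq> length xs \<Longrightarrow> \<phi> b = 0" and "xs \<noteq> []"
  shows "block_sum \<chi> (\<lambda>b. f b + \<phi> b) xs = block_sum \<chi> f xs + \<chi> [\<phi> xs]"
proof -
  obtain x ys where xs: "xs = x # ys"
    using assms(3) by (cases xs) auto
  let ?g = "\<lambda>b. f b + \<phi> b"
  have hd: "\<chi> ((y + z) # zs) = \<chi> (y # zs) + \<chi> (z # zs)" for y z zs
    using slot_additive_hd[OF add] by (simp add: hom_add_def)
  have "block_sum \<chi> ?g xs = deconc (\<lambda>a b. block_sum (\<lambda>cs. \<chi> (?g (x # a) # cs)) ?g b) ys"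
    by (simp add: xs block_sum_Cons)
  also have "\<dots> = deconc (\<lambda>a b. block_sum (\<lambda>cs. \<chi> (f (x # a) # cs)) f b
      + (if b = [] then \<chi> [\<phi> (x # a)] else 0)) ys"
  proof (intro deconc_cong refl)
    fix a b assume ab: "a @ b = ys"
    show "block_sum (\<lambda>cs. \<chi> (?g (x # a) # cs)) ?g b =
        block_sum (\<lambda>cs. \<chi> (f (x # a) # cs)) f b + (if b = [] then \<chi> [\<phi> (x # a)] else 0)"
    proof (cases "b = []")
      case False
      then have "\<phi> (x # a) = 0"
        using ab by (intro \<phi>) (auto simp: xs)
      moreover have "block_sum (\<lambda>cs. \<chi> (f (x # a) # cs)) ?g b = block_sum (\<lambda>cs. \<chi> (f (x # a) # cs)) f b"
        using ab by (intro block_sum_cong) (auto simp: xs \<phi>)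
      ultimately show ?thesis
        using False by simp
    qed (simp add: hd)
  qed
  also have "\<dots> = block_sum \<chi> f xs + \<chi> [\<phi> xs]"
    by (simp add: deconc_add xs block_sum_Cons) (subst deconc_last, simp_all)
  finally show ?thesis .
qed

text \<open>In arity \<open>n + 1\<close> a block of length \<open>n\<close> leaves a single argument, on its right or on its left.\<close>

lemma block_sum_perturb:
  fixes \<nu> :: cochain
  assumes add: "slot_additive \<nu>" and \<phi>: "\<And>b. length b \<noteq> n \<Longrightarrow> \<phi> b = 0"
    and n: "2 \<le> n" "length xs = n + 1"
  shows "block_sum \<nu> (\<lambda>b. f b + \<phi> b) xs =
    block_sum \<nu> f xs + (\<nu> [\<phi> (butlast xs), f [last xs]] + \<nu> [f [hd xs], \<phi> (tl xs)])"
proof -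
  obtain x ys where xs: "xs = x # ys" and ys: "length ys = n"
    using n(2) by (cases xs) auto
  let ?g = "\<lambda>b. f b + \<phi> b"
  have hd: "\<nu> ((y + z) # zs) = \<nu> (y # zs) + \<nu> (z # zs)" for y z zs
    using slot_additive_hd[OF add] by (simp add: hom_add_def)
  have "block_sum \<nu> ?g xs = deconc (\<lambda>a b. block_sum (\<lambda>cs. \<nu> (?g (x # a) # cs)) ?g b) ys"
    by (simp add: xs block_sum_Cons)
  also have "\<dots> = deconc (\<lambda>a b. block_sum (\<lambda>cs. \<nu> (f (x # a) # cs)) f b
      + ((if length b = 1 then \<nu> [\<phi> (x # a), f b] else 0) + (if a = [] then \<nu> [f [x], \<phi> b] else 0))) ys"
  proof (intro deconc_cong refl)
    fix a b assume ab: "a @ b = ys"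
    then have len: "length a + length b = n"
      using ys by auto
    consider "a = []" | y where "b = [y]" "a \<noteq> []" | "length b \<noteq> 1" "a \<noteq> []"
      by (cases "length b = 1") (auto simp: length_Suc_conv)
    then show "block_sum (\<lambda>cs. \<nu> (?g (x # a) # cs)) ?g b =
        block_sum (\<lambda>cs. \<nu> (f (x # a) # cs)) f b
        + ((if length b = 1 then \<nu> [\<phi> (x # a), f b] else 0) + (if a = [] then \<nu> [f [x], \<phi> b] else 0))"
    proof cases
      case 1
      then have "block_sum (\<lambda>cs. \<nu> (f [x] # cs)) ?g b =
          block_sum (\<lambda>cs. \<nu> (f [x] # cs)) f b + \<nu> [f [x], \<phi> b]"
        using len n \<phi> by (intro block_sum_perturb_whole slot_additive_Cons[OF add]) auto
      then show ?thesis
        using 1 len n by (simp add: \<phi>)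
    next
      case 2
      then show ?thesis
        using n by (simp add: block_sum_Cons \<phi>[of "[y]"] hd)
    next
      case 3
      then have "\<phi> (x # a) = 0"
        using len by (intro \<phi>) auto
      moreover have "block_sum (\<lambda>cs. \<nu> (f (x # a) # cs)) ?g b = block_sum (\<lambda>cs. \<nu> (f (x # a) # cs)) f b"
      proof (rule block_sum_cong)
        fix c :: "'a list" assume "length c \<le> length b"
        moreover have "length b < n"
          using len 3 by (cases a) auto
        ultimately show "?g c = f c"
          by (simp add: \<phi>)
      qed
      ultimately show ?thesis
        using 3 by simp
    qed
  qed
  also have "\<dots> = block_sum \<nu> f xs + (\<nu> [\<phi> (x # butlast ys), f [last ys]] + \<nu> [f [x], \<phi> ys])"
  proof -
    have "deconc (\<lambda>a b. if length b = 1 then \<nu> [\<phi> (x # a), f b] else 0) ys =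
        \<nu> [\<phi> (x # butlast ys), f [last ys]]"
      using ys n by (subst deconc_last_two) auto
    moreover have "deconc (\<lambda>a b. if a = [] then \<nu> [f [x], \<phi> b] else 0) ys = \<nu> [f [x], \<phi> ys]"
      by (subst deconc_first) auto
    ultimately show ?thesis
      by (simp only: deconc_add xs block_sum_Cons)
  qed
  finally show ?thesis
    using ys n by (auto simp: xs)
qed

section \<open>Degrees of descending words\<close>

lemma descending_is_path: "descending ds \<Longrightarrow> ds \<noteq> [] \<Longrightarrow> is_path (source (hd ds)) ds"
proof (induction ds)
  case (Cons d ds)
  then show ?case
    by (cases ds) (auto simp: target_next_arrow)
qed simp

lemma four_arrows:
  assumes "length es \<ge> 4"
  obtains a b c d fs where "es = a # b # c # d # fs"
  using assms that by (auto simp: numeral_eq_Suc Suc_le_length_iff)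

text \<open>Four consecutive arrows form a cycle whose degree is central, namely that of \<open>U\<close> for an ascending
cycle. Thus only paths with at most three arrows have to be compared.\<close>

lemma ascending_degree:
  assumes "ascending es" "is_path v es"
  shows "\<exists>fs q. ascending fs \<and> is_path v fs \<and> length fs < 4 \<and> length es = 4 * q + length fs \<and>
    path_degree es = shift (- 2 * int q) (int q) (path_degree fs)"
  using assms
proof (induction es rule: length_induct)
  case (1 es)
  show ?case
  proof (cases "length es < 4")
    case True
    then show ?thesis
      using 1 by (intro exI[of _ es] exI[of _ 0]) simp
  next
    case False
    then obtain a b c d gs where es: "es = a # b # c # d # gs"
      by (auto intro: four_arrows[of es])
    have eq: "b = next_arrow a" "c = next_arrow b" "d = next_arrow c" "v = source a"
      using 1(2,3) by (auto simp: es)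
    have lt: "length gs < length es"
      by (simp add: es)
    have gs: "ascending gs" "is_path v gs"
      using 1(2,3) eq by (cases a; auto simp: es successively_Cons)+
    have deg: "path_degree es = shift (- 2) 1 (path_degree gs)"
      unfolding es eq by (cases a; cases "path_degree gs"; auto simp: path_degree_Cons Gamma_mult field_simps)
    obtain fs q where "ascending fs" "is_path v fs" "length fs < 4" "length gs = 4 * q + length fs"
      "path_degree gs = shift (- 2 * int q) (int q) (path_degree fs)"
      using 1(1)[rule_format, OF lt gs] by blast
    then show ?thesis
      using deg by (intro exI[of _ fs] exI[of _ "Suc q"]) (simp add: es algebra_simps)
  qed
qed

text \<open>A descending cycle has the central degree \<open>(-4; 0, 0) \<times> 1\<close>.\<close>

lemma descending_degree:
  assumes "descending ds" "is_path v ds"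
  shows "\<exists>fs q. descending fs \<and> is_path v fs \<and> length fs < 4 \<and> length ds = 4 * q + length fs \<and>
    path_degree ds = shift (- 4 * int q) (int q) (path_degree fs)"
  using assms
proof (induction ds rule: length_induct)
  case (1 es)
  show ?case
  proof (cases "length es < 4")
    case True
    then show ?thesis
      using 1 by (intro exI[of _ es] exI[of _ 0]) simp
  next
    case False
    then obtain a b c d gs where es: "es = a # b # c # d # gs"
      by (auto intro: four_arrows[of es])
    have eq: "a = next_arrow b" "b = next_arrow c" "c = next_arrow d" "v = source a"
      using 1(2,3) by (auto simp: es)
    have lt: "length gs < length es"
      by (simp add: es)
    have gs: "descending gs" "is_path v gs"
      using 1(2,3) eq by (cases d; auto simp: es successively_Cons)+
    have deg: "path_degree es = shift (- 4) 1 (path_degree gs)"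
      unfolding es eq by (cases d; cases "path_degree gs"; auto simp: path_degree_Cons Gamma_mult field_simps)
    obtain fs q where "descending fs" "is_path v fs" "length fs < 4" "length gs = 4 * q + length fs"
      "path_degree gs = shift (- 4 * int q) (int q) (path_degree fs)"
      using 1(1)[rule_format, OF lt gs] by blast
    then show ?thesis
      using deg by (intro exI[of _ fs] exI[of _ "Suc q"]) (simp add: es algebra_simps)
  qed
qed

text \<open>Half-integers become integers, so that the parity arguments of \<open>critical_degree\<close> are decidable in
Presburger arithmetic.\<close>

fun doubled_degree :: "Gamma_elem \<Rightarrow> int \<times> int \<times> int \<times> int" where
  "doubled_degree ((m, a, b), w) = (\<lfloor>2 * m\<rfloor>, \<lfloor>2 * a\<rfloor>, \<lfloor>2 * b\<rfloor>, w)"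

lemma floor_minus_one: "\<lfloor>- 1 :: rat\<rfloor> = - 1"
  by (rule floor_unique) simp_all

lemma shift_eq_shiftD:
  assumes "shift n k ((m, a, b), w) = shift n' k' ((m', a', b'), w')"
  shows "2 * n + \<lfloor>2 * m\<rfloor> = 2 * n' + \<lfloor>2 * m'\<rfloor> \<and> a = a' \<and> b = b' \<and> w + k = w' + k'"
proof -
  have "2 * m + of_int (2 * n) = 2 * m' + of_int (2 * n')"
    using assms by simp
  then have "\<lfloor>2 * m + of_int (2 * n)\<rfloor> = \<lfloor>2 * m' + of_int (2 * n')\<rfloor>"
    by (rule arg_cong)
  then show ?thesis
    using assms by (simp only: floor_add_int[symmetric]) simp
qed

lemma short_ascending:
  assumes "ascending fs" "is_path v fs" "length fs < 4"
  shows "fs = [] \<or> (v = Vertex0 \<and> fs \<in> {[Arrow1], [Arrow1, Arrow2], [Arrow1, Arrow2, Arrow3],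
      [Arrow3], [Arrow3, Arrow4], [Arrow3, Arrow4, Arrow1]}) \<or>
    (v = Vertex1 \<and> fs \<in> {[Arrow2], [Arrow2, Arrow3], [Arrow2, Arrow3, Arrow4],
      [Arrow4], [Arrow4, Arrow1], [Arrow4, Arrow1, Arrow2]})"
proof -
  consider "fs = []" | a where "fs = [a]" | a b where "fs = [a, b]" | a b c where "fs = [a, b, c]"
  proof (cases fs rule: short_list_cases)
    case 4
    then have "length fs = 3"
      using assms(3) by simp
    then show ?thesis
      using that by (auto simp: numeral_eq_Suc length_Suc_conv)
  qed (use that in auto)
  then show ?thesis
  proof cases
    case (2 a)
    then show ?thesis using assms by (cases a) auto
  next
    case (3 a b)
    then show ?thesis using assms by (cases a) auto
  next
    case (4 a b c)
    then show ?thesis using assms by (cases a) auto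
  qed simp
qed

lemma short_descending:
  assumes "descending fs" "is_path v fs" "length fs < 4"
  shows "fs = [] \<or> (v = Vertex0 \<and> fs \<in> {[Arrow1], [Arrow1, Arrow4], [Arrow1, Arrow4, Arrow3],
      [Arrow3], [Arrow3, Arrow2], [Arrow3, Arrow2, Arrow1]}) \<or>
    (v = Vertex1 \<and> fs \<in> {[Arrow2], [Arrow2, Arrow1], [Arrow2, Arrow1, Arrow4],
      [Arrow4], [Arrow4, Arrow3], [Arrow4, Arrow3, Arrow2]})"
proof -
  consider "fs = []" | a where "fs = [a]" | a b where "fs = [a, b]" | a b c where "fs = [a, b, c]"
  proof (cases fs rule: short_list_cases)
    case 4
    then have "length fs = 3"
      using assms(3) by simp
    then show ?thesis
      using that by (auto simp: numeral_eq_Suc length_Suc_conv)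
  qed (use that in auto)
  then show ?thesis
  proof cases
    case (2 a)
    then show ?thesis using assms by (cases a) auto
  next
    case (3 a b)
    then show ?thesis using assms by (cases b) auto
  next
    case (4 a b c)
    then show ?thesis using assms by (cases c) auto
  qed simp
qed

text \<open>After removal of full cycles both paths have at most three arrows. Their start vertices and their
degrees in the two abelian components leave few pairs, and for all of them except the empty paths the
first component has the wrong parity. For empty paths it yields exactly one cycle on either side.\<close>

lemma critical_degree:
  assumes ds: "descending ds" "is_path v ds" and es: "ascending es" "is_path v es" "ds \<noteq> []"
    and eq: "shift (- 2 * int k) (int k) (path_degree es) = shift (int (length ds) - 2) 0 (path_degree ds)"
  shows "length ds = 4 \<and> (k = 1 \<and> es = [] \<or> k = 0 \<and> length es = 4)"
proof -
  obtain fs q where fs: "ascending fs" "is_path v fs" "length fs < 4" "length es = 4 * q + length fs"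
    "path_degree es = shift (- 2 * int q) (int q) (path_degree fs)"
    using ascending_degree[OF es(1,2)] by blast
  obtain gs p where gs: "descending gs" "is_path v gs" "length gs < 4" "length ds = 4 * p + length gs"
    "path_degree ds = shift (- 4 * int p) (int p) (path_degree gs)"
    using descending_degree[OF ds] by blast
  obtain m a b w where f: "path_degree fs = ((m, a, b), w)"
    by (cases "path_degree fs") auto
  obtain m' a' b' w' where g: "path_degree gs = ((m', a', b'), w')"
    by (cases "path_degree gs") auto
  \<comment> \<open>The unknowns are the exponent \<open>K\<close> of \<open>U\<close>, counting ascending cycles as \<open>U\<close>, and the number \<open>P\<close> of descending
    cycles; the rest is a finite table.\<close>
  define K L P where "K = int (k + q)" and "L = int (length gs)" and "P = int p"
  have "shift (- 2 * K) K (path_degree fs) = shift (L - 2) P (path_degree gs)"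
    using eq unfolding fs(5) gs(5) gs(4) K_def L_def P_def by (simp add: algebra_simps)
  then have eqs: "- 4 * K + \<lfloor>2 * m\<rfloor> = 2 * L - 4 + \<lfloor>2 * m'\<rfloor>" "a = a'" "b = b'" "w + K = w' + P"
    unfolding f g by (auto dest!: shift_eq_shiftD simp del: shift.simps)
  define M A B where "M = \<lfloor>2 * m\<rfloor>" and "A = \<lfloor>2 * a\<rfloor>" and "B = \<lfloor>2 * b\<rfloor>"
  define M' A' B' where "M' = \<lfloor>2 * m'\<rfloor>" and "A' = \<lfloor>2 * a'\<rfloor>" and "B' = \<lfloor>2 * b'\<rfloor>"
  have eqs': "- 4 * K + M = 2 * L - 4 + M'" "A = A'" "B = B'" "w + K = w' + P"
    using eqs by (simp_all only: M_def M'_def A_def A'_def B_def B'_def)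
  have f': "(M, A, B, w) = doubled_degree (path_degree fs)"
    by (simp add: f M_def A_def B_def)
  have g': "(M', A', B', w') = doubled_degree (path_degree gs)"
    by (simp add: g M'_def A'_def B'_def)
  have F: "(fs = [] \<and> M = 0 \<and> A = 0 \<and> B = 0 \<and> w = 0) \<or>
      (v = Vertex0 \<and> (M = - 1 \<and> A = 1 \<and> B = - 1 \<and> w = 0 \<or>
        M = - 1 \<and> A = 2 \<and> B = 0 \<and> w = 0 \<or>
        M = - 1 \<and> A = 1 \<and> B = 1 \<and> w = 0 \<or>
        M = - 1 \<and> A = - 1 \<and> B = 1 \<and> w = 0 \<or>
        M = - 3 \<and> A = - 2 \<and> B = 0 \<and> w = 1 \<or>
        M = - 3 \<and> A = - 1 \<and> B = - 1 \<and> w = 1)) \<or>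
      (v = Vertex1 \<and> (M = - 1 \<and> A = 1 \<and> B = 1 \<and> w = 0 \<or>
        M = - 1 \<and> A = 0 \<and> B = 2 \<and> w = 0 \<or>
        M = - 3 \<and> A = - 1 \<and> B = 1 \<and> w = 1 \<or>
        M = - 3 \<and> A = - 1 \<and> B = - 1 \<and> w = 1 \<or>
        M = - 3 \<and> A = 0 \<and> B = - 2 \<and> w = 1 \<or>
        M = - 3 \<and> A = 1 \<and> B = - 1 \<and> w = 1))"
    using short_ascending[OF fs(1-3)] f'
    by (elim disjE conjE insertE emptyE) (simp_all add: path_degree_Cons Gamma_mult Gamma_one floor_minus_one)
  have G: "(gs = [] \<and> L = 0 \<and> M' = 0 \<and> A' = 0 \<and> B' = 0 \<and> w' = 0) \<or>
      (v = Vertex0 \<and> (L = 1 \<and> M' = - 1 \<and> A' = 1 \<and> B' = - 1 \<and> w' = 0 \<or>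
        L = 2 \<and> M' = - 5 \<and> A' = 0 \<and> B' = - 2 \<and> w' = 1 \<or>
        L = 3 \<and> M' = - 7 \<and> A' = - 1 \<and> B' = - 1 \<and> w' = 1 \<or>
        L = 1 \<and> M' = - 1 \<and> A' = - 1 \<and> B' = 1 \<and> w' = 0 \<or>
        L = 2 \<and> M' = - 3 \<and> A' = 0 \<and> B' = 2 \<and> w' = 0 \<or>
        L = 3 \<and> M' = - 5 \<and> A' = 1 \<and> B' = 1 \<and> w' = 0)) \<or>
      (v = Vertex1 \<and> (L = 1 \<and> M' = - 1 \<and> A' = 1 \<and> B' = 1 \<and> w' = 0 \<or>
        L = 2 \<and> M' = - 3 \<and> A' = 2 \<and> B' = 0 \<and> w' = 0 \<or>
        L = 3 \<and> M' = - 7 \<and> A' = 1 \<and> B' = - 1 \<and> w' = 1 \<or>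
        L = 1 \<and> M' = - 3 \<and> A' = - 1 \<and> B' = - 1 \<and> w' = 1 \<or>
        L = 2 \<and> M' = - 5 \<and> A' = - 2 \<and> B' = 0 \<and> w' = 1 \<or>
        L = 3 \<and> M' = - 7 \<and> A' = - 1 \<and> B' = 1 \<and> w' = 1))"
    using short_descending[OF gs(1-3)] g'
    by (elim disjE conjE insertE emptyE) (simp_all add: path_degree_Cons Gamma_mult Gamma_one L_def floor_minus_one)
  have "fs = [] \<and> gs = [] \<and> K = 1 \<and> P = 1"
    using F G eqs'
    by (elim disjE conjE; (simp only: vertex.distinct)?; presburger?)
  then have "fs = [] \<and> gs = [] \<and> k + q = 1 \<and> p = 1"
    by (simp add: K_def P_def)
  then show ?thesis
    using fs(4) gs(4) by (cases q) auto
qed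

lemma support_idem_left: "support (idem v * x) \<subseteq> {(k, w, es). w = v}"
proof (induction x rule: monomial_induct)
  case (monomial k w es)
  then show ?case
    by (simp add: monomial_mult support_monomial)
qed (auto simp: distrib_left support_add)

lemma critical_value:
  assumes f: "multilinear f" "graded (- 2) f" and ds: "descending ds" "ds \<noteq> []"
    and s: "(k, v, es) \<in> support (f (map chord (letters ds)))"
  shows "length ds = 4 \<and> v = source (hd ds) \<and> is_path v es \<and> ascending es \<and>
    (k = 1 \<and> es = [] \<or> k = 0 \<and> length es = 4)"
proof -
  let ?x = "f (map chord (letters ds))"
  obtain d ds' where d: "ds = d # ds'"
    using ds(2) by (cases ds) auto
  have "idem (source d) * ?x = ?x"
    using multilinear_idem_left[OF f(1), of "[d]" "letters ds'" "source d"] d by auto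
  then have v: "v = source (hd ds)"
    using s support_idem_left[of "source d" ?x] d by auto
  note es = support_basis[OF s]
  have "?x \<in> homog (shift (int (length (letters ds)) + - 2) 0 (path_degree (concat (letters ds))))"
    using ds(2) by (intro graded_chords[OF f(2)]) auto
  from homog_support[OF this s]
  have "shift (- 2 * int k) (int k) (path_degree es) = shift (int (length ds) - 2) 0 (path_degree ds)"
    by simp
  from critical_degree[OF ds(1) _ _ _ ds(2) this, of v] descending_is_path[OF ds] es v
  show ?thesis by simp
qed

lemma critical_value_eq_0:
  assumes "multilinear f" "graded (- 2) f" "descending ds" "ds \<noteq> []" "length ds \<noteq> 4"
  shows "f (map chord (letters ds)) = 0"
proof (rule support_eq_empty, rule ccontr)
  assume "support (f (map chord (letters ds))) \<noteq> {}"
  then obtain k v es where "(k, v, es) \<in> support (f (map chord (letters ds)))"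
    by auto
  from critical_value[OF assms(1-4) this] assms(5) show False by simp
qed

section \<open>The operations on descending words of length four\<close>

lemma torus_deformation_unital_structure:
  assumes "torus_deformation \<mu>"
  shows "unital_structure \<mu>" "xs \<noteq> [] \<Longrightarrow> insertion_sum \<mu> \<mu> xs = 0"
proof -
  have A: "multilinear \<mu>" "\<And>xs. xs \<noteq> [] \<Longrightarrow> insertion_sum \<mu> \<mu> xs = 0" "\<And>x. \<mu> [x] = 0"
    "\<And>x y. \<mu> [x, y] = x * y"
    "\<And>xs. length xs \<noteq> 2 \<Longrightarrow> const iota0 \<in> set xs \<or> const iota1 \<in> set xs \<Longrightarrow> \<mu> xs = 0"
    using assms unfolding torus_deformation_def A_infinity_deformation_def by blast+
  have "\<mu> xs = 0" if xs: "1 \<in> set xs" "length xs \<noteq> 2" for xs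
  proof -
    obtain ys zs where s: "xs = ys @ 1 # zs"
      using xs(1) by (meson split_list)
    have "\<mu> xs = \<mu> (ys @ idem Vertex0 # zs) + \<mu> (ys @ idem Vertex1 # zs)"
      using multilinear_additive[OF A(1)]
      by (simp add: s one_eq_monomials slot_additive_def hom_add_def)
    also have "\<dots> = 0"
      using A(5)[of "ys @ idem Vertex0 # zs"] A(5)[of "ys @ idem Vertex1 # zs"] xs(2)
      by (simp add: s const_iota)
    finally show ?thesis .
  qed
  then show "unital_structure \<mu>"
    using A by (auto simp: unital_structure_def)
  show "xs \<noteq> [] \<Longrightarrow> insertion_sum \<mu> \<mu> xs = 0"
    by (rule A(2))
qed

lemma short_critical_window:
  assumes \<mu>: "unital_structure \<mu>" "graded (- 2) \<mu>" and ds: "descending ds" "length ds < 4" "ds \<noteq> []"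
  shows "\<mu> (map chord (letters ds)) = 0"
  using ds by (intro critical_value_eq_0 unital_structureD(1)[OF \<mu>(1)] \<mu>(2)) auto

text \<open>All operations on fewer than four descending arrows vanish, so the relation on five of them has just
two terms.\<close>

lemma five_word_relation:
  assumes \<mu>: "torus_deformation \<mu>" and ds: "descending [a, b, c, d, e]"
  shows "\<mu> (map chord (letters [a, b, c, d])) * chord [e] =
    chord [a] * \<mu> (map chord (letters [b, c, d, e]))"
proof -
  note us = torus_deformation_unital_structure[OF \<mu>]
  note D = unital_structureD[OF us(1)]
  let ?w = "map chord (letters [a, b, c, d, e])"
  have "0 = insertion_sum \<mu> \<mu> ?w"
    by (simp add: us(2))
  also have "\<dots> = \<mu> [\<mu> (butlast ?w), last ?w] + \<mu> [hd ?w, \<mu> (tl ?w)] + \<mu> [\<mu> ?w]"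
  proof (rule insertion_sum_long_windows[OF D(2), where n = 4])
    fix x y z assume w: "?w = x @ y @ z" "y \<noteq> []" "length y < 4"
    obtain bs where bs: "y = map chord (letters bs)" "descending bs" "length bs = length y"
      using descending_sublist[OF ds w(1)] by blast
    have "length bs < 4"
      using w(3) unfolding bs(3) .
    moreover have "bs \<noteq> []"
      using w(2) bs(1) by auto
    ultimately show "\<mu> y = 0"
      unfolding bs(1) by (intro short_critical_window us torus_deformation_graded \<mu> bs)
  qed simp_all
  finally have "\<mu> (map chord (letters [a, b, c, d])) * chord [e]
      + chord [a] * \<mu> (map chord (letters [b, c, d, e])) = 0"
    by (simp add: D)
  then show ?thesis
    by (rule eq_iff_add_eq_0[THEN iffD2])
qed

lemma eq_sum_over_support:
  assumes "support x \<subseteq> A" "finite A"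
  shows "x = (\<Sum>(k, v, es)\<in>A. if (k, v, es) \<in> support x then monomial k v es else 0)"
proof -
  have "x = (\<Sum>(k, v, es)\<in>support x. monomial k v es)"
    using linear_extension_support[of x] by (simp add: linear_extension_def)
  also have "\<dots> = (\<Sum>(k, v, es)\<in>A. if (k, v, es) \<in> support x then monomial k v es else 0)"
    using assms by (intro sum.mono_neutral_cong_left) auto
  finally show ?thesis .
qed

lemma three_monomials:
  assumes "support x \<subseteq> {(i, u, a), (j, v, b), (k, w, c)}" "distinct [(i, u, a), (j, v, b), (k, w, c)]"
  obtains p q r :: bool where
    "x = (if p then monomial i u a else 0) + (if q then monomial j v b else 0) + (if r then monomial k w c else 0)"
proof
  show "x = (if (i, u, a) \<in> support x then monomial i u a else 0)
    + (if (j, v, b) \<in> support x then monomial j v b else 0)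
    + (if (k, w, c) \<in> support x then monomial k w c else 0)"
    using assms(2) by (subst eq_sum_over_support[OF assms(1)]) (auto simp: add.assoc)
qed

lemma ascending_four:
  assumes "ascending es" "is_path v es" "length es = 4"
  shows "es = (if v = Vertex0 then [Arrow1, Arrow2, Arrow3, Arrow4] else [Arrow2, Arrow3, Arrow4, Arrow1]) \<or>
    es = (if v = Vertex0 then [Arrow3, Arrow4, Arrow1, Arrow2] else [Arrow4, Arrow1, Arrow2, Arrow3])"
proof -
  obtain a b c d where es: "es = [a, b, c, d]"
    using assms(3) by (auto simp: length_Suc_conv numeral_eq_Suc)
  show ?thesis
    using assms(1,2) unfolding es by (cases a) auto
qed

text \<open>Write \<open>x\<^sub>i\<close> for the value on the word starting with \<open>\<rho>\<^sub>i\<close>. The relations \<open>x\<^sub>1\<rho>\<^sub>1 = \<rho>\<^sub>1x\<^sub>4\<close> and \<open>\<rho>\<^sub>3x\<^sub>2 = x\<^sub>3\<rho>\<^sub>3\<close> force the term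
  with \<open>U\<close> and exclude the closed chord that does not annihilate \<open>\<rho>\<^sub>1\<close>, respectively \<open>\<rho>\<^sub>3\<close>; the relation \<open>x\<^sub>2\<rho>\<^sub>2 = \<rho>\<^sub>2x\<^sub>1\<close> says that
  the two remaining closed chords occur together.\<close>

lemma torus_deformation_four_words:
  assumes \<mu>: "torus_deformation \<mu>"
  obtains e :: bool where
    "\<mu> (map chord (letters [Arrow1, Arrow4, Arrow3, Arrow2])) =
      monomial 1 Vertex0 [] + (if e then monomial 0 Vertex0 [Arrow3, Arrow4, Arrow1, Arrow2] else 0)"
    "\<mu> (map chord (letters [Arrow2, Arrow1, Arrow4, Arrow3])) =
      monomial 1 Vertex1 [] + (if e then monomial 0 Vertex1 [Arrow2, Arrow3, Arrow4, Arrow1] else 0)"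
    "\<mu> (map chord (letters [Arrow3, Arrow2, Arrow1, Arrow4])) = monomial 1 Vertex0 []"
    "\<mu> (map chord (letters [Arrow4, Arrow3, Arrow2, Arrow1])) = monomial 1 Vertex1 []"
proof -
  note us = torus_deformation_unital_structure[OF \<mu>]
  note gr = torus_deformation_graded[OF \<mu>]
  define x1 where "x1 = \<mu> (map chord (letters [Arrow1, Arrow4, Arrow3, Arrow2]))"
  define x2 where "x2 = \<mu> (map chord (letters [Arrow2, Arrow1, Arrow4, Arrow3]))"
  have x3: "\<mu> (map chord (letters [Arrow3, Arrow2, Arrow1, Arrow4])) = monomial 1 Vertex0 []"
    and x4: "\<mu> (map chord (letters [Arrow4, Arrow3, Arrow2, Arrow1])) = monomial 1 Vertex1 []"
    using \<mu> by (simp_all add: torus_deformation_def rho_eq_monomial const_iota var_U_mult_idem)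
  have r1: "x1 * chord [Arrow1] = monomial 1 Vertex0 [Arrow1]"
    using five_word_relation[OF \<mu>, of Arrow1 Arrow4 Arrow3 Arrow2 Arrow1] x4
    by (simp add: x1_def monomial_mult)
  have r2: "x2 * chord [Arrow2] = chord [Arrow2] * x1"
    using five_word_relation[OF \<mu>, of Arrow2 Arrow1 Arrow4 Arrow3 Arrow2]
    by (simp add: x1_def x2_def)
  have r3: "chord [Arrow3] * x2 = monomial 1 Vertex0 [Arrow3]"
    using five_word_relation[OF \<mu>, of Arrow3 Arrow2 Arrow1 Arrow4 Arrow3] x3
    by (simp add: x2_def monomial_mult)
  note val = critical_value[OF unital_structureD(1)[OF us(1)] gr]
  have "support x1 \<subseteq> {(1, Vertex0, []), (0, Vertex0, [Arrow1, Arrow2, Arrow3, Arrow4]),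
      (0, Vertex0, [Arrow3, Arrow4, Arrow1, Arrow2])}"
  proof
    fix t assume t: "t \<in> support x1"
    obtain k v es where kv: "t = (k, v, es)" by (cases t)
    have "v = Vertex0 \<and> is_path v es \<and> ascending es \<and> (k = 1 \<and> es = [] \<or> k = 0 \<and> length es = 4)"
      using val[OF _ _ t[unfolded kv x1_def]] by auto
    then show "t \<in> {(1, Vertex0, []), (0, Vertex0, [Arrow1, Arrow2, Arrow3, Arrow4]),
      (0, Vertex0, [Arrow3, Arrow4, Arrow1, Arrow2])}"
      using ascending_four[of es v] kv by auto
  qed
  from three_monomials[OF this] obtain p q r :: bool where x1:
    "x1 = (if p then monomial 1 Vertex0 [] else 0)
      + (if q then monomial 0 Vertex0 [Arrow1, Arrow2, Arrow3, Arrow4] else 0)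
      + (if r then monomial 0 Vertex0 [Arrow3, Arrow4, Arrow1, Arrow2] else 0)"
    by auto
  have "support x2 \<subseteq> {(1, Vertex1, []), (0, Vertex1, [Arrow2, Arrow3, Arrow4, Arrow1]),
      (0, Vertex1, [Arrow4, Arrow1, Arrow2, Arrow3])}"
  proof
    fix t assume t: "t \<in> support x2"
    obtain k v es where kv: "t = (k, v, es)" by (cases t)
    have "v = Vertex1 \<and> is_path v es \<and> ascending es \<and> (k = 1 \<and> es = [] \<or> k = 0 \<and> length es = 4)"
      using val[OF _ _ t[unfolded kv x2_def]] by auto
    then show "t \<in> {(1, Vertex1, []), (0, Vertex1, [Arrow2, Arrow3, Arrow4, Arrow1]),
      (0, Vertex1, [Arrow4, Arrow1, Arrow2, Arrow3])}"
      using ascending_four[of es v] kv by auto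
  qed
  from three_monomials[OF this] obtain p' q' r' :: bool where x2:
    "x2 = (if p' then monomial 1 Vertex1 [] else 0)
      + (if q' then monomial 0 Vertex1 [Arrow2, Arrow3, Arrow4, Arrow1] else 0)
      + (if r' then monomial 0 Vertex1 [Arrow4, Arrow1, Arrow2, Arrow3] else 0)"
    by auto
  have "p \<and> \<not> q"
    using arg_cong[OF r1, of support] unfolding x1
    by (cases p; cases q; cases r) (simp_all add: distrib_right monomial_mult monomial_eq_0 support_add support_monomial)
  moreover have "p' \<and> \<not> r'"
    using arg_cong[OF r3, of support] unfolding x2
    by (cases p'; cases q'; cases r') (simp_all add: distrib_left monomial_mult monomial_eq_0 support_add support_monomial)
  moreover have "q' \<longleftrightarrow> r"
    using arg_cong[OF r2, of support] calculation unfolding x1 x2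
    by (cases q'; cases r)
      (simp_all add: distrib_left distrib_right monomial_mult monomial_eq_0 support_add support_monomial)
  ultimately show thesis
    using that[of r] x1 x2 x3 x4 by (simp add: x1_def x2_def)
qed

section \<open>Uniqueness\<close>

text \<open>The identity as a family with a single component; it is the first stage of every isomorphism below.\<close>

definition single_input :: cochain where
  "single_input xs = (case xs of [x] \<Rightarrow> x | _ \<Rightarrow> 0)"

lemma single_input_length: "length xs \<noteq> 1 \<Longrightarrow> single_input xs = 0"
  by (auto simp: single_input_def split: list.split)

lemma single_input_single [simp]: "single_input [x] = x"
  by (simp add: single_input_def)

lemma unital_map_single_input: "unital_map single_input"
proof -
  have "multilinear single_input"
  proof (rule multilinearI)
    have "hom_add (\<lambda>x. single_input (xs @ x # ys))" for xs ys
    proof (cases "xs = [] \<and> ys = []")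
      case True
      then show ?thesis by (simp add: hom_add_def)
    qed (auto simp: single_input_length hom_add_def)
    then show "slot_additive single_input"
      by (simp add: slot_additive_def)
    fix k v x xs
    let ?c = "monomial k v []"
    show "single_input ((?c * x) # xs) = ?c * single_input (x # xs)"
      by (cases xs) (simp_all add: single_input_def)
    show "single_input (xs @ [x * ?c]) = single_input (xs @ [x]) * ?c"
      by (cases "xs = []") (simp_all add: single_input_length)
    fix y ys
    show "single_input (xs @ (x * ?c) # y # ys) = single_input (xs @ x # (?c * y) # ys)"
      by (simp add: single_input_length)
  qed
  then show ?thesis
    by (simp add: unital_map_def single_input_length)
qed

text \<open>As for \<open>partial_deformation\<close>, the equation in arity \<open>n\<close> holds already, because \<open>f\<^sub>n\<close> enters it only with
\<open>\<mu>\<^sub>1\<close> and \<open>\<nu>\<^sub>1\<close>, which are zero.\<close>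

definition partial_hom ::
  "cochain \<Rightarrow> cochain \<Rightarrow>
   nat \<Rightarrow> cochain \<Rightarrow> bool" where
  "partial_hom \<mu> \<nu> n f \<longleftrightarrow> unital_map f \<and> graded (- 1) f \<and>
    (\<forall>xs. n \<le> length xs \<longrightarrow> f xs = 0) \<and>
    (\<forall>xs. xs \<noteq> [] \<and> length xs \<le> n \<longrightarrow> hom_defect \<mu> \<nu> f xs = 0) \<and>
    (\<forall>ds. descending ds \<and> length ds = 2 \<longrightarrow> f (map chord (letters ds)) = 0)"

lemma partial_hom_single_input:
  assumes \<mu>: "unital_structure \<mu>" and \<nu>: "unital_structure \<nu>"
  shows "partial_hom \<mu> \<nu> 2 single_input"
proof -
  note M = unital_structureD[OF \<mu>] and N = unital_structureD[OF \<nu>]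
  have "graded (- 1) single_input"
    unfolding graded_def
  proof (intro allI impI, elim conjE)
    fix xs gs assume hom: "homog_list xs gs"
    show "single_input xs \<in> homog (shift (int (length xs) + - 1) 0 (Gamma_prod gs))"
    proof (cases "length xs = 1")
      case True
      then obtain x where xs: "xs = [x]"
        by (auto simp: length_Suc_conv)
      then obtain g where "gs = [g]" "x \<in> homog g"
        using hom unfolding xs homog_list_def list_all2_Cons1 list_all2_Nil by blast
      then show ?thesis
        by (simp add: xs)
    qed (simp add: single_input_length homogeneous.zero)
  qed
  moreover have "hom_defect \<mu> \<nu> single_input xs = 0" if xs: "xs \<noteq> []" "length xs \<le> 2" for xs
  proof (cases xs rule: short_list_cases)
    case (2 x)
    then show ?thesis
      by (simp add: hom_defect_def block_sum_Cons insertion_sum_Cons M N)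
  next
    case (3 x y)
    then show ?thesis
      by (simp add: hom_defect_def block_sum_Cons insertion_sum_Cons M N single_input_length)
  qed (use xs in auto)
  ultimately show ?thesis
    using unital_map_single_input by (auto simp: partial_hom_def single_input_length)
qed

lemma insertion_sum_multiply_critical:
  assumes "slot_additive \<phi>" "descending ds"
  shows "insertion_sum \<phi> multiply (map chord (letters ds)) = 0"
proof (rule insertion_sum_eq_0)
  fix a b c assume w: "map chord (letters ds) = a @ b @ c" "b \<noteq> []"
  obtain bs where bs: "b = map chord (letters bs)" "descending bs" "length bs = length b"
    using descending_sublist[OF assms(2) w(1)] by blast
  have "multiply b = 0"
  proof (cases bs rule: short_list_cases)
    case (3 x y)
    then show ?thesis
      using bs(1,2) chord_descending_pair[of x y] by simp
  next
    case 4
    then show ?thesis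
      unfolding bs(3) by (intro multiply_length) simp
  qed (simp_all add: bs(1) multiply_length)
  then show "\<phi> (a @ [multiply b] @ c) = 0"
    using slot_additive_0[OF assms(1)] by simp
qed

text \<open>The other terms of the homomorphism equation contain one of the listed zero values.\<close>

lemma hom_defect_four:
  assumes \<mu>: "unital_structure \<mu>" and \<nu>: "unital_structure \<nu>" and f: "unital_map f"
    and f0: "\<And>xs. 3 \<le> length xs \<Longrightarrow> f xs = 0" "f [a, b] = 0" "f [b, c] = 0" "f [c, d] = 0"
    and \<mu>0: "\<mu> [a, b, c] = 0" "\<mu> [b, c, d] = 0"
  shows "hom_defect \<mu> \<nu> f [a, b, c, d] = \<nu> [a, b, c, d] + \<mu> [a, b, c, d]"
proof -
  note M = unital_structureD[OF \<mu>] and N = unital_structureD[OF \<nu>] and F = unital_mapD[OF f]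
  have \<nu>z: "\<nu> (0 # zs) = 0" "\<nu> (x # 0 # zs) = 0" "\<nu> (x # y # 0 # zs) = 0" for x y zs
    using slot_additive_0[OF N(2), of "[]"] slot_additive_0[OF N(2), of "[x]"]
      slot_additive_0[OF N(2), of "[x, y]"] by simp_all
  have fz: "f [0, x] = 0" "f [x, 0] = 0" for x
    using slot_additive_0[OF F(2), of "[]"] slot_additive_0[OF F(2), of "[x]" "[]"] by simp_all
  show ?thesis
    by (simp add: hom_defect_def block_sum_Cons insertion_sum_Cons F M N f0 \<mu>0 \<nu>z fz)
qed

text \<open>If the bits of the two deformations differ, take \<open>c\<close> with the value \<open>\<rho>\<^sub>3\<rho>\<^sub>4\<rho>\<^sub>1\<close> on \<open>(\<rho>\<^sub>1, \<rho>\<^sub>4, \<rho>\<^sub>3)\<close>. Multiplied by \<open>\<rho>\<^sub>2\<close>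
  on the right or on the left it gives the two closed chords that occur in
  \<open>torus_deformation_four_words\<close>.\<close>

lemma four_word_correction:
  assumes \<mu>: "torus_deformation \<mu>" and \<nu>: "torus_deformation \<nu>"
  obtains c where
    "\<And>ds v. idem v * c ds = (if v = source (hd ds) then c ds else 0)"
    "\<And>ds v. c ds * idem v = (if v = target (last ds) then c ds else 0)"
    "\<And>ds. length ds = 3 \<Longrightarrow> c ds \<in> homog (shift (int 3 + 1 + - 2) 0 (path_degree ds))"
    "\<And>a b e d. descending [a, b, e, d] \<Longrightarrow>
      \<nu> (map chord (letters [a, b, e, d])) + \<mu> (map chord (letters [a, b, e, d])) =
      chord [a] * c [b, e, d] + c [a, b, e] * chord [d]"
proof -
  obtain p where p:
    "\<mu> (map chord (letters [Arrow1, Arrow4, Arrow3, Arrow2])) =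
      monomial 1 Vertex0 [] + (if p then monomial 0 Vertex0 [Arrow3, Arrow4, Arrow1, Arrow2] else 0)"
    "\<mu> (map chord (letters [Arrow2, Arrow1, Arrow4, Arrow3])) =
      monomial 1 Vertex1 [] + (if p then monomial 0 Vertex1 [Arrow2, Arrow3, Arrow4, Arrow1] else 0)"
    "\<mu> (map chord (letters [Arrow3, Arrow2, Arrow1, Arrow4])) = monomial 1 Vertex0 []"
    "\<mu> (map chord (letters [Arrow4, Arrow3, Arrow2, Arrow1])) = monomial 1 Vertex1 []"
    by (rule torus_deformation_four_words[OF \<mu>]) (assumption | rule that)+
  obtain q where q:
    "\<nu> (map chord (letters [Arrow1, Arrow4, Arrow3, Arrow2])) =
      monomial 1 Vertex0 [] + (if q then monomial 0 Vertex0 [Arrow3, Arrow4, Arrow1, Arrow2] else 0)"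
    "\<nu> (map chord (letters [Arrow2, Arrow1, Arrow4, Arrow3])) =
      monomial 1 Vertex1 [] + (if q then monomial 0 Vertex1 [Arrow2, Arrow3, Arrow4, Arrow1] else 0)"
    "\<nu> (map chord (letters [Arrow3, Arrow2, Arrow1, Arrow4])) = monomial 1 Vertex0 []"
    "\<nu> (map chord (letters [Arrow4, Arrow3, Arrow2, Arrow1])) = monomial 1 Vertex1 []"
    by (rule torus_deformation_four_words[OF \<nu>]) (assumption | rule that)+
  define c where "c ds = (if p \<noteq> q \<and> ds = [Arrow1, Arrow4, Arrow3]
      then monomial 0 Vertex0 [Arrow3, Arrow4, Arrow1] else 0)" for ds
  show thesis
  proof
    show "idem v * c ds = (if v = source (hd ds) then c ds else 0)" for ds v
      by (simp add: c_def monomial_mult)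
    show "c ds * idem v = (if v = target (last ds) then c ds else 0)" for ds v
      by (auto simp: c_def monomial_mult)
    show "c ds \<in> homog (shift (int 3 + 1 + - 2) 0 (path_degree ds))" if "length ds = 3" for ds
    proof (cases "p \<noteq> q \<and> ds = [Arrow1, Arrow4, Arrow3]")
      case True
      have "shift (- 2 * int 0) (int 0) (path_degree [Arrow3, Arrow4, Arrow1]) =
          shift (int 3 + 1 + - 2) 0 (path_degree [Arrow1, Arrow4, Arrow3])"
        by (simp add: path_degree_Cons Gamma_mult Gamma_one)
      from homog_monomial[OF _ this, of Vertex0] show ?thesis
        unfolding c_def using True by simp
    qed (auto simp: c_def homogeneous.zero)
    have pq: "x + (if q then y else 0) + (x + (if p then y else 0)) = (if p \<noteq> q then y else 0)"
      for x y :: torus_algebra_U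
      by (auto simp: algebra_simps)
    fix a b e d assume "descending [a, b, e, d]"
    then have "[a, b, e, d] \<in> {[Arrow1, Arrow4, Arrow3, Arrow2], [Arrow2, Arrow1, Arrow4, Arrow3],
        [Arrow3, Arrow2, Arrow1, Arrow4], [Arrow4, Arrow3, Arrow2, Arrow1]}"
      by (intro descending_four) auto
    then consider "[a, b, e, d] = [Arrow1, Arrow4, Arrow3, Arrow2]" | "[a, b, e, d] = [Arrow2, Arrow1, Arrow4, Arrow3]"
      | "[a, b, e, d] = [Arrow3, Arrow2, Arrow1, Arrow4]" | "[a, b, e, d] = [Arrow4, Arrow3, Arrow2, Arrow1]"
      by blast
    then show "\<nu> (map chord (letters [a, b, e, d])) + \<mu> (map chord (letters [a, b, e, d])) =
        chord [a] * c [b, e, d] + c [a, b, e] * chord [d]"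
    proof cases
      case 1
      then have s: "a = Arrow1" "b = Arrow4" "e = Arrow3" "d = Arrow2"
        by simp_all
      show ?thesis
        unfolding s p q pq by (simp add: c_def monomial_mult)
    next
      case 2
      then have s: "a = Arrow2" "b = Arrow1" "e = Arrow4" "d = Arrow3"
        by simp_all
      show ?thesis
        unfolding s p q pq by (simp add: c_def monomial_mult)
    next
      case 3
      then have s: "a = Arrow3" "b = Arrow2" "e = Arrow1" "d = Arrow4"
        by simp_all
      show ?thesis
        unfolding s p q by (simp add: c_def)
    next
      case 4
      then have s: "a = Arrow4" "b = Arrow3" "e = Arrow2" "d = Arrow1"
        by simp_all
      show ?thesis
        unfolding s p q by (simp add: c_def)
    qed
  qed
qed

text \<open>The new component \<open>\<phi>\<close> changes the defect in arity \<open>n + 1\<close> by its coboundary. On critical words the defect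
vanishes for degree reasons unless \<open>n = 3\<close>, and there the critical values of \<open>\<phi>\<close> are those of
\<open>four_word_correction\<close>.\<close>

lemma partial_hom_extend:
  assumes \<mu>: "torus_deformation \<mu>" and \<nu>: "torus_deformation \<nu>"
    and P: "partial_hom \<mu> \<nu> n f" and n: "2 \<le> n"
  shows "\<exists>f'. partial_hom \<mu> \<nu> (Suc n) f' \<and> (\<forall>xs. length xs < n \<longrightarrow> f' xs = f xs)"
proof -
  note um = torus_deformation_unital_structure[OF \<mu>] and un = torus_deformation_unital_structure[OF \<nu>]
  note gm = torus_deformation_graded[OF \<mu>] and gn = torus_deformation_graded[OF \<nu>]
  have f: "unital_map f" and gf: "graded (- 1) f"
    and top: "\<And>xs. n \<le> length xs \<Longrightarrow> f xs = 0"
    and def: "\<And>xs. xs \<noteq> [] \<Longrightarrow> length xs \<le> n \<Longrightarrow> hom_defect \<mu> \<nu> f xs = 0"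
    and crit: "\<And>ds. descending ds \<Longrightarrow> length ds = 2 \<Longrightarrow> f (map chord (letters ds)) = 0"
    using P by (auto simp: partial_hom_def)
  note M = unital_structureD[OF um(1)] and N = unital_structureD[OF un(1)] and F = unital_mapD[OF f]
  have graded_defect: "graded (- 2) (hom_defect \<mu> \<nu> g)" if "graded (- 1) g" for g
    unfolding hom_defect_def[abs_def]
    using graded_insertion_sum[OF that gm] graded_block_sum[OF gn that] by (intro graded_add) simp_all
  have mult: "multilinear (hom_defect \<mu> \<nu> f)"
    by (intro multilinear_hom_defect M N F)
  obtain c where c:
    "\<And>ds v. idem v * c ds = (if v = source (hd ds) then c ds else 0)"
    "\<And>ds v. c ds * idem v = (if v = target (last ds) then c ds else 0)"
    "\<And>ds. length ds = n \<Longrightarrow> c ds \<in> homog (shift (int n + 1 + - 2) 0 (path_degree ds))"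
    "\<And>a b e d. n = 3 \<Longrightarrow> descending [a, b, e, d] \<Longrightarrow>
      \<nu> (map chord (letters [a, b, e, d])) + \<mu> (map chord (letters [a, b, e, d])) =
      chord [a] * c [b, e, d] + c [a, b, e] * chord [d]"
    "\<And>ds. n = 2 \<Longrightarrow> c ds = 0"
  proof (cases "n = 3")
    case True
    obtain c where c:
      "\<And>ds v. idem v * c ds = (if v = source (hd ds) then c ds else 0)"
      "\<And>ds v. c ds * idem v = (if v = target (last ds) then c ds else 0)"
      "\<And>ds. length ds = 3 \<Longrightarrow> c ds \<in> homog (shift (int 3 + 1 + - 2) 0 (path_degree ds))"
      "\<And>a b e d. descending [a, b, e, d] \<Longrightarrow>
        \<nu> (map chord (letters [a, b, e, d])) + \<mu> (map chord (letters [a, b, e, d])) =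
        chord [a] * c [b, e, d] + c [a, b, e] * chord [d]"
      by (rule four_word_correction[OF \<mu> \<nu>]) (assumption | rule that)+
    show thesis
      by (rule that[of c]) (use c True in auto)
  next
    case False
    show thesis
      by (rule that[of "\<lambda>_. 0"]) (use False in \<open>auto simp: homogeneous.zero\<close>)
  qed
  have n0: "n \<noteq> 0"
    using n by simp
  obtain \<phi> where \<phi>: "multilinear \<phi>" "graded (- 2 + 1) \<phi>"
    "\<And>xs. length xs \<noteq> n \<Longrightarrow> \<phi> xs = 0" "\<And>xs. 1 \<in> set xs \<Longrightarrow> \<phi> xs = 0"
    "\<And>ds. descending ds \<Longrightarrow> length ds = n \<Longrightarrow> \<phi> (map chord (letters ds)) = c ds"
    "\<And>ws. merge_word ws \<Longrightarrow> length ws = n + 1 \<Longrightarrow>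
      coboundary \<phi> (map chord ws) = hom_defect \<mu> \<nu> f (map chord ws)"
    by (rule hochschild_solution[OF mult graded_defect[OF gf] n0 c(1,2,3)])
      (assumption | rule that)+
  note add\<phi> = multilinear_additive[OF \<phi>(1)]
  define f' where "f' = (\<lambda>xs. f xs + \<phi> xs)"
  have low: "f' xs = f xs" if "length xs < n" for xs
    using that by (simp add: f'_def \<phi>(3))
  have f': "unital_map f'"
    using F \<phi> n multilinear_add[OF F(1) \<phi>(1)] unfolding unital_map_def f'_def by auto
  have gf': "graded (- 1) f'"
    unfolding f'_def using gf \<phi>(2) by (intro graded_add) simp_all
  note F' = unital_mapD[OF f']
  have ins: "insertion_sum f' \<mu> xs = insertion_sum f \<mu> xs + insertion_sum \<phi> \<mu> xs" for xs
    unfolding f'_def by (rule insertion_sum_add_left)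
  have def_low: "hom_defect \<mu> \<nu> f' xs = 0" if xs: "xs \<noteq> []" "length xs \<le> n" for xs
  proof -
    have "block_sum \<nu> f' xs = block_sum \<nu> f xs"
    proof (cases "length xs = n")
      case True
      then show ?thesis
        unfolding f'_def using xs \<phi>(3)
        by (subst block_sum_perturb_whole) (auto simp: N)
    next
      case False
      then show ?thesis
        using xs by (intro block_sum_cong low) auto
    qed
    moreover have "insertion_sum \<phi> \<mu> xs = 0"
    proof (rule insertion_sum_eq_0)
      fix a b e assume abe: "xs = a @ b @ e" "b \<noteq> []"
      show "\<phi> (a @ [\<mu> b] @ e) = 0"
      proof (cases b rule: short_list_cases)
        case (2 x)
        then show ?thesis
          using slot_additive_0[OF add\<phi>] by (simp add: M)
      qed (use abe xs in \<open>auto intro!: \<phi>(3)\<close>)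
    qed
    ultimately show ?thesis
      using def[OF xs] by (simp add: hom_defect_def ins)
  qed
  have def_n: "hom_defect \<mu> \<nu> f' xs = hom_defect \<mu> \<nu> f xs + coboundary \<phi> xs"
    if xs: "length xs = n + 1" for xs
  proof -
    have "block_sum \<nu> f' xs = block_sum \<nu> f xs + (\<phi> (butlast xs) * last xs + hd xs * \<phi> (tl xs))"
      unfolding f'_def using block_sum_perturb[OF N(2) \<phi>(3) n xs] by (simp add: N F)
    moreover have "insertion_sum \<phi> \<mu> xs = insertion_sum \<phi> multiply xs"
      using xs by (intro insertion_sum_multiply add\<phi> \<phi>(3) M) auto
    ultimately show ?thesis
      by (simp add: hom_defect_def ins coboundary_def algebra_simps)
  qed
  have "hom_defect \<mu> \<nu> f' xs = 0" if xs: "length xs = n + 1" for xs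
  proof (rule cocycle_eq_0[where n = "n + 1"])
    show mult': "multilinear (hom_defect \<mu> \<nu> f')"
      by (intro multilinear_hom_defect M N F')
    show "unital_on (n + 1) (hom_defect \<mu> \<nu> f')"
      using hom_defect_unital[OF um(1) un(1) f'] by (simp add: unital_on_def)
    show "coboundary (hom_defect \<mu> \<nu> f') (map chord ws) = 0" if "length ws = n + 1 + 1" for ws
      using that by (intro hom_defect_cocycle[OF um(1) un(1) f' um(2) un(2), of "n + 1"] def_low) auto
    show "hom_defect \<mu> \<nu> f' (map chord ws) = 0" if "merge_word ws" "length ws = n + 1" for ws
      using that by (simp add: def_n \<phi>(6))
    show "hom_defect \<mu> \<nu> f' (map chord (letters ds)) = 0" if ds: "descending ds" "length ds = n + 1" for ds
    proof (cases "n = 3")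
      case False
      then show ?thesis
        using ds by (intro critical_value_eq_0 mult' graded_defect gf') auto
    next
      case True
      then obtain a b e d where abed: "ds = [a, b, e, d]"
        using ds(2) by (auto simp: length_Suc_conv numeral_eq_Suc)
      have d3: "descending [a, b, e]" "descending [b, e, d]" and d2: "descending [a, b]" "descending [b, e]" "descending [e, d]"
        and d4: "descending [a, b, e, d]"
        using ds(1) by (auto simp: abed)
      have \<mu>3: "\<mu> (map chord (letters ds')) = 0" if "descending ds'" "length ds' = 3" for ds'
        using that by (intro short_critical_window[OF um(1) gm]) auto
      have "hom_defect \<mu> \<nu> f (map chord (letters ds)) =
          \<nu> (map chord (letters ds)) + \<mu> (map chord (letters ds))"
        using hom_defect_four[OF um(1) un(1) f, of "chord [a]" "chord [b]" "chord [e]" "chord [d]"]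
          top True crit[OF d2(1)] crit[OF d2(2)] crit[OF d2(3)] \<mu>3[OF d3(1)] \<mu>3[OF d3(2)]
        by (simp add: abed)
      also have "\<dots> = chord [a] * c [b, e, d] + c [a, b, e] * chord [d]"
        unfolding abed by (rule c(4)[OF True d4])
      also have "\<dots> = coboundary \<phi> (map chord (letters ds))"
        using insertion_sum_multiply_critical[OF add\<phi> ds(1)] \<phi>(5)[OF d3(1)] \<phi>(5)[OF d3(2)] True
        by (simp add: coboundary_def abed)
      finally show ?thesis
        using def_n[of "map chord (letters ds)"] ds(2) by simp
    qed
  qed (rule xs)
  then have "hom_defect \<mu> \<nu> f' xs = 0" if "xs \<noteq> []" "length xs \<le> Suc n" for xs
    using that def_low by (cases "length xs = n + 1") auto
  moreover have "f' xs = 0" if "Suc n \<le> length xs" for xs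
    using that by (simp add: f'_def top \<phi>(3))
  moreover have "f' (map chord (letters ds)) = 0" if ds: "descending ds" "length ds = 2" for ds
    using crit[OF ds] \<phi>(5)[OF ds(1)] c(5) ds(2) \<phi>(3)[of "map chord (letters ds)"]
    by (cases "n = 2") (simp_all add: f'_def)
  ultimately have "partial_hom \<mu> \<nu> (Suc n) f'"
    unfolding partial_hom_def using f' gf' by blast
  then show ?thesis
    using low by blast
qed

theorem torus_deformation_unique:
  assumes \<mu>: "torus_deformation \<mu>" and \<nu>: "torus_deformation \<nu>"
  shows "A_infinity_isomorphic \<mu> \<nu>"
proof -
  obtain F f m where f: "\<And>N. partial_hom \<mu> \<nu> (m N) (f N)" "\<And>N. N \<le> m N"
    "\<And>N xs. length xs \<le> N \<Longrightarrow> F xs = f N xs"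
    by (rule staged_limit[where P = "partial_hom \<mu> \<nu>",
          OF partial_hom_single_input[OF torus_deformation_unital_structure(1)[OF \<mu>]
              torus_deformation_unital_structure(1)[OF \<nu>]]
            partial_hom_extend[OF \<mu> \<nu>]])
      (assumption | rule that)+
  have um: "unital_map (f N)" for N
    using f(1)[of N] by (simp add: partial_hom_def)
  have "multilinear F"
    by (rule multilinear_local) (metis f(3) less_imp_le um unital_mapD(1))
  moreover have "(\<Sum>bs\<in>blocks xs. \<nu> (map F bs)) = insertion_sum F \<mu> xs" if "xs \<noteq> []" for xs
  proof -
    let ?f = "f (length xs)"
    have "block_sum \<nu> F xs = block_sum \<nu> ?f xs"
      by (rule block_sum_cong) (rule f(3))
    moreover have "insertion_sum F \<mu> xs = insertion_sum ?f \<mu> xs"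
    proof (rule insertion_sum_cong)
      fix a b c assume xs: "xs = a @ b @ c" "b \<noteq> []"
      then show "F (a @ [\<mu> b] @ c) = ?f (a @ [\<mu> b] @ c)"
        by (intro f(3)) (cases b, auto)
    qed
    moreover have "hom_defect \<mu> \<nu> ?f xs = 0"
      using f(1,2)[of "length xs"] that by (auto simp: partial_hom_def)
    ultimately have "block_sum \<nu> F xs = insertion_sum F \<mu> xs"
      using eq_iff_add_eq_0 by (metis hom_defect_def)
    then show ?thesis
      by (simp add: block_sum_def)
  qed
  moreover have "(\<lambda>x. F [x]) = id"
    using f(3)[of "[_]" 1] unital_mapD(3)[OF um] by (auto simp: fun_eq_iff)
  ultimately have "A_infinity_hom \<mu> \<nu> F" "bij (\<lambda>x. F [x])"
    by (simp_all add: A_infinity_hom_def)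
  then show ?thesis
    unfolding A_infinity_isomorphic_def by blast
qed

theorem theorem5p45:
  shows "(\<exists>\<mu>. torus_deformation \<mu>) \<and>
    (\<forall>\<mu> \<nu>. torus_deformation \<mu> \<and> torus_deformation \<nu> \<longrightarrow> A_infinity_isomorphic \<mu> \<nu>)"
  using torus_deformation_exists torus_deformation_unique by blast

end
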